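(* Let $\xi$ be a (possibly killed) subordinator with Laplace exponent $\phi\not\equiv0$, exponential functional $I=\int_0^\infty e^{-\xi_s}ds$, and associated remainder random variable $R$. (1) The functions $\lambda\mapsto\phi(\lambda)$ and $\lambda\mapsto\phi^*(\lambda):=\lambda/\phi(\lambda)$ on $(0,\infty)$ satisfy Webster's conditions, and the moment generating functions of $\log R$ and $\log I$ are given by $$\mathbf{E}[R^s]=\Gamma_\phi(s+1)\quad\text{and}\quad \mathbf{E}[I^s]=\Gamma_{\phi^*}(s+1)=\frac{\Gamma(s+1)}{\Gamma_\phi(s+1)},\qquad s>-1.$$ (2) Assume that $q=\phi(0)=0$. Let $\alpha>0$, let $\mathbf{e}_\alpha$ be an exponentially distributed random variable with parameter $\alpha$ independent of $\xi$, let $I_t=\int_0^t e^{-\xi_s}ds$ for $t>0$, and set $\phi_{c,\alpha}(\cdot)=\phi(\cdot+c)+\alpha$ for $c\ge0$. Then the joint distribution of $(I_{\mathbf{e}_\alpha},\xi_{\mathbf{e}_\alpha})$ is characterized by $$\mathbf{E}\left[(I_{\mathbf{e}_\alpha})^s e^{-\mu\xi_{\mathbf{e}_\alpha}}\right]=\frac{\alpha}{\alpha+\phi(\mu)}\,\frac{\Gamma(s+1)}{\Gamma_{\phi_{\mu,\alpha}}(s+1)},\qquad \mu\ge0,\ s>-1.$$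
   Context: A (possibly killed) subordinator $\xi$ is a $[0,\infty]$-valued Lévy process with non-decreasing paths, started at $0$, with absorbing state $+\infty$; convention $e^{-\infty}=0$. Its Laplace exponent is $\phi(\lambda)=-\log\mathbf{E}[e^{-\lambda\xi_1}]=q+\lambda a+\int_{(0,\infty)}(1-e^{-\lambda x})\Pi(dx)$, where $q\ge0$ is the killing term, $a\ge0$ the drift, and $\Pi$ the Lévy measure on $(0,\infty)$ with $\int(x\wedge1)\Pi(dx)<\infty$. The trivial case $\phi\equiv0$ is excluded, so $I<\infty$ a.s. Remainder random variable: $R$ is a positive random variable whose law is the (unique, moment-determinate) law with $\mathbf{E}[R^n]=\prod_{i=1}^n\phi(i)$, $n\ge1$. (If $I$ and $R$ are independent, then $IR$ has the standard exponential law.) Webster's conditions: a function $g:(0,\infty)\to(0,\infty)$ satisfies Webster's conditions if $g$ is log-concave and $\lim_{s\to\infty}g(s+c)/g(s)=1$ for every $c>0$. For such $g$, let $g'_\pm$ be its right and left derivatives, $a_n=\frac{g'_-(n)+g'_+(n)}{2g(n)}$ for $n\ge1$, $\gamma_g=\lim_{n\to\infty}\left(\sum_{j=1}^n a_j-\log g(n)\right)$, and define the generalized gamma function $$\Gamma_g(s)=\frac{e^{-\gamma_g s}}{g(s)}\prod_{n=1}^\infty\frac{g(n)}{g(n+s)}e^{a_n s},\quad s>0.$$ $\Gamma$ is the usual gamma function. *)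

theory Defs
  imports "HOL-Probability.Probability"
begin

section \<open>Killed subordinators\<close>

definition process_sigma ::
  "'a measure \<Rightarrow> (real \<Rightarrow> 'a \<Rightarrow> ennreal) \<Rightarrow> real set \<Rightarrow> 'a measure" where
  "process_sigma M X T =
     sigma (space M) (\<Union>u\<in>T. {X u -` B \<inter> space M | B. B \<in> sets borel})"

text \<open>
  The last clause is the Levy property of a killed process: conditionally on being
  alive at time \<open>t\<close>, the increment over \<open>[t, t + h]\<close> is independent of the past up to
  time \<open>t\<close> and distributed as \<open>xi h\<close> (whose law may charge \<open>\<infinity>\<close>). Left limits exist and
  \<open>\<infinity>\<close> is absorbing by monotonicity.
\<close>

definition killed_subordinator :: "'a measure \<Rightarrow> (real \<Rightarrow> 'a \<Rightarrow> ennreal) \<Rightarrow> bool" where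
  "killed_subordinator M xi \<longleftrightarrow>
     prob_space M \<and>
     (\<forall>t\<ge>0. xi t \<in> borel_measurable M) \<and>
     (\<forall>\<omega>\<in>space M.
        xi 0 \<omega> = 0 \<and>
        mono_on {0..} (\<lambda>t. xi t \<omega>) \<and>
        (\<forall>t\<ge>0. continuous (at_right t) (\<lambda>u. xi u \<omega>))) \<and>
     (\<forall>t\<ge>0. \<forall>h\<ge>0. \<forall>A\<in>sets (process_sigma M xi {0..t}). \<forall>B\<in>sets borel.
        measure M {\<omega>\<in>A. xi t \<omega> < \<infinity> \<and> xi (t + h) \<omega> - xi t \<omega> \<in> B}
        = measure M {\<omega>\<in>A. xi t \<omega> < \<infinity>} * measure M {\<omega>\<in>space M. xi h \<omega> \<in> B})"

text \<open>
  \<open>exp_neg l x\<close> is \<open>e\<^sup>-\<^sup>l\<^sup>x\<close> with \<open>e\<^sup>-\<^sup>\<infinity> = 0\<close>. The value at \<open>x = \<infinity>\<close> is \<open>0\<close> also for \<open>l = 0\<close>,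
  so that the Laplace exponent at \<open>0\<close> is the killing rate.
\<close>

definition exp_neg :: "real \<Rightarrow> ennreal \<Rightarrow> real" where
  "exp_neg l x = (if x = \<infinity> then 0 else exp (- (l * enn2real x)))"

definition laplace_exponent ::
  "'a measure \<Rightarrow> (real \<Rightarrow> 'a \<Rightarrow> ennreal) \<Rightarrow> real \<Rightarrow> real" where
  "laplace_exponent M xi l = - ln (\<integral>\<omega>. exp_neg l (xi 1 \<omega>) \<partial>M)"

text \<open>
  If the integral over \<open>[0, \<infinity>)\<close> diverges, \<open>exp_functional\<close> takes the value \<open>0\<close>, and then
  \<open>exp_functional xi \<omega> powr s = 0\<close> for all \<open>s\<close>, including \<open>s = 0\<close>. Hence a total mass \<open>1\<close>
  for the zeroth moment excludes divergence almost surely.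
\<close>

definition exp_functional :: "(real \<Rightarrow> 'a \<Rightarrow> ennreal) \<Rightarrow> 'a \<Rightarrow> real" where
  "exp_functional xi \<omega> = (LINT u:{0..}|lborel. exp_neg 1 (xi u \<omega>))"

definition exp_functional_upto :: "(real \<Rightarrow> 'a \<Rightarrow> ennreal) \<Rightarrow> real \<Rightarrow> 'a \<Rightarrow> real" where
  "exp_functional_upto xi t \<omega> = (LINT u:{0..t}|lborel. exp_neg 1 (xi u \<omega>))"

definition remainder_variable :: "(real \<Rightarrow> real) \<Rightarrow> 'b measure \<Rightarrow> ('b \<Rightarrow> real) \<Rightarrow> bool" where
  "remainder_variable phi N R \<longleftrightarrow>
     prob_space N \<and>
     R \<in> borel_measurable N \<and>
     (AE x in N. 0 < R x) \<and>
     (\<forall>n\<ge>1. integrable N (\<lambda>x. R x ^ n) \<and>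
             (\<integral>x. R x ^ n \<partial>N) = (\<Prod>i=1..n. phi (real i)))"

definition conjugate_exponent :: "(real \<Rightarrow> real) \<Rightarrow> real \<Rightarrow> real" where
  "conjugate_exponent phi l = l / phi l"

text \<open>
  An exponential time is used to evaluate the process, whose values at negative times carry
  no meaning; hence it is nonnegative everywhere and not only almost surely.
\<close>

definition independent_exponential_time ::
  "'a measure \<Rightarrow> (real \<Rightarrow> 'a \<Rightarrow> ennreal) \<Rightarrow> real \<Rightarrow> ('a \<Rightarrow> real) \<Rightarrow> bool" where
  "independent_exponential_time M xi \<alpha> e \<longleftrightarrow>
     (\<forall>\<omega>\<in>space M. 0 \<le> e \<omega>) \<and>
     distributed M lborel e (exponential_density \<alpha>) \<and>
     prob_space.indep_set M
       {e -` B \<inter> space M | B. B \<in> sets borel}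
       (sets (process_sigma M xi {0..}))"

definition shifted_exponent :: "(real \<Rightarrow> real) \<Rightarrow> real \<Rightarrow> real \<Rightarrow> real \<Rightarrow> real" where
  "shifted_exponent phi c \<alpha> l = phi (l + c) + \<alpha>"


section \<open>Generalized gamma functions\<close>

text \<open>A function \<open>g : (0, \<infinity>) \<rightarrow> (0, \<infinity>)\<close> is a total function whose values outside \<open>(0, \<infinity>)\<close> are ignored.\<close>

definition webster_conditions :: "(real \<Rightarrow> real) \<Rightarrow> bool" where
  "webster_conditions g \<longleftrightarrow>
     (\<forall>s>0. 0 < g s) \<and>
     concave_on {0<..} (\<lambda>s. ln (g s)) \<and>
     (\<forall>c>0. ((\<lambda>s. g (s + c) / g s) \<longlongrightarrow> 1) at_top)"

definition webster_coeff :: "(real \<Rightarrow> real) \<Rightarrow> nat \<Rightarrow> real" where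
  "webster_coeff g n =
     (vector_derivative g (at_left (real n)) + vector_derivative g (at_right (real n)))
       / (2 * g (real n))"

definition webster_gamma_const :: "(real \<Rightarrow> real) \<Rightarrow> real" where
  "webster_gamma_const g = lim (\<lambda>n. (\<Sum>j=1..n. webster_coeff g j) - ln (g (real n)))"

definition gen_Gamma :: "(real \<Rightarrow> real) \<Rightarrow> real \<Rightarrow> real" where
  "gen_Gamma g s =
     exp (- webster_gamma_const g * s) / g s *
     (\<Prod>n. g (real (Suc n)) / g (real (Suc n) + s) * exp (webster_coeff g (Suc n) * s))"

end

theory Submission
  imports Defs
begin

text \<open>
  All moment formulas come from one recursion. Write \<open>X t = exp (- xi t)\<close> (zero after killing)
  and \<open>J t\<close> for the integral of \<open>X\<close> over \<open>[t, \<infinity>)\<close>, so that \<open>J 0\<close> is the exponential functional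
  \<open>I\<close>. Since \<open>J\<close> has derivative \<open>- X\<close> almost everywhere, one has
  \<open>J t powr s = s * (integral over u \<ge> t of X u * J u powr (s - 1))\<close>. The Levy property says that
  \<open>J t / X t\<close> is a copy of \<open>I\<close> independent of \<open>X t\<close>. Taking expectations gives
  \<open>E (I powr s) = s / phi s * E (I powr (s - 1))\<close> for every real \<open>s > 0\<close>.
  
  Independence is not derived for whole paths. For integer exponents the one-step Levy property
  already evaluates \<open>E (w * J t ^ n)\<close> for every weight \<open>w\<close> that depends on the past
  (\<open>moments\<close>), by induction on \<open>n\<close>. These moments grow like \<open>C ^ n * n!\<close>, so they
  determine the law of \<open>J t / X t\<close> under the measure with density \<open>X t powr s\<close>
  (\<open>moment_determinacy\<close>, \<open>tilted_law\<close>). That is exactly the independence that the recursion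
  at a real exponent needs (\<open>moment_recursion\<close>).
  
  The Mellin transform \<open>E (I powr s)\<close> is log-convex by Hoelder. A log-convex solution of
  \<open>f (s + 1) = g s * f s\<close> with \<open>f 1 = 1\<close> is squeezed to the limit of a Gauss product
  as in the Bohr-Mollerup theorem (\<open>bohr_mollerup_limit\<close>), and the infinite product that defines
  the generalized gamma function of \<open>g\<close> is a rearrangement of the same product
  (\<open>gen_Gamma_eq_gauss_limit\<close>). With \<open>g s = s / phi s\<close> this yields the formula for \<open>I\<close>.
  Gauss products are multiplicative in \<open>g\<close>, so the product of \<open>phi\<close> converges to \<open>Gamma\<close> divided by
  the Mellin transform, which is the quotient identity. If \<open>R\<close> is independent of \<open>I\<close>, then
  \<open>I * R\<close> has the moments \<open>n!\<close>, hence the standard exponential law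
  (\<open>remainder_factorization\<close>), and the moments of \<open>R\<close> follow by division.
  
  The Webster conditions hold for \<open>phi\<close> because \<open>phi\<close> is positive, nondecreasing and concave.
  For \<open>s / phi s\<close> log-concavity amounts to log-convexity of \<open>phi s / s\<close>, which is a limit of
  multiples of \<open>E ((1 - exp (- s * xi h)) / s)\<close> as \<open>h\<close> tends to \<open>0\<close>, and each
  \<open>(1 - exp (- s * x)) / s\<close> is a Laplace transform in \<open>s\<close>.
  
  For the second part, fix \<open>\<mu>\<close> and change the measure by the normalized density
  \<open>exp (- \<mu> * xi e)\<close>. Under the new measure the process \<open>exp (- xi t)\<close> killed at time \<open>e\<close> is
  again multiplicative, with exponent \<open>phi (s + \<mu>) + \<alpha>\<close>, so the abstract recursion applies
  unchanged. A joint law with this transform is unique because integer \<open>s\<close> and \<open>\<mu>\<close> already determine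
  it: first the law of \<open>I\<close> under each density \<open>exp (- k * xi)\<close>, then the law of \<open>exp (- xi)\<close> on each
  event that depends on \<open>I\<close> (\<open>joint_law_determined\<close>).
\<close>

section \<open>Measures determined by their moments\<close>

lemma iexp_taylor_sums: "(\<lambda>k. (\<i> * complex_of_real (d * x)) ^ k /\<^sub>R fact k) sums iexp (d * x)"
  using exp_converges[of "\<i> * complex_of_real (d * x)"] by simp

text \<open>
  The \<open>n\<close>-th derivative of the characteristic function, up to the factor \<open>\<i> ^ n\<close>.
\<close>

definition moment_char :: "real measure \<Rightarrow> nat \<Rightarrow> real \<Rightarrow> complex" where
  "moment_char A n t = (CLINT x|A. of_real (x ^ n) * iexp (t * x))"

text \<open>
  Taylor expansion around \<open>t\<close>. The growth bound on the absolute moments gives a radius of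
  convergence that does not depend on \<open>t\<close>, so knowledge of all derivatives at one point spreads
  along the real line in steps of fixed length.
\<close>

lemma moment_char_step:
  fixes A :: "real measure"
  assumes fin: "finite_measure A" and sets: "sets A = sets borel"
    and int: "\<And>n. integrable A (\<lambda>x. x ^ n)"
    and bd: "\<And>n. (\<integral>x. \<bar>x\<bar> ^ n \<partial>A) \<le> K * C ^ n * fact n"
    and C: "C > 0" and d: "4 * C * \<bar>d\<bar> \<le> 1"
  shows "(\<lambda>k. (\<i> * of_real d) ^ k / fact k * moment_char A (n + k) t) sums moment_char A n (t + d)"
proof -
  have [measurable_cong]: "sets A = sets borel" by fact
  let ?f = "\<lambda>k x. (\<i> * of_real d) ^ k / fact k * (of_real (x ^ (n + k)) * iexp (t * x))"
  have nrm: "norm (?f k x) = \<bar>d\<bar> ^ k / fact k * \<bar>x\<bar> ^ (n + k)" for k x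
    by (simp add: norm_mult norm_divide norm_power power_abs)
  have int_abs: "integrable A (\<lambda>x. \<bar>x\<bar> ^ n)" for n
    using integrable_abs[OF int[of n]] by (simp add: power_abs)
  have int1: "integrable A (?f k)" for k
  proof (rule Bochner_Integration.integrable_bound)
    show "integrable A (\<lambda>x. \<bar>d\<bar> ^ k / fact k * \<bar>x\<bar> ^ (n + k))"
      by (intro integrable_mult_right int_abs)
    show "AE x in A. norm (?f k x) \<le> norm (\<bar>d\<bar> ^ k / fact k * \<bar>x\<bar> ^ (n + k))"
      unfolding nrm by simp
  qed measurable
  have K: "K \<ge> 0"
    using order.trans[OF _ bd[of 0]] by simp
  have sm_norm: "(\<lambda>k. norm (?f k x)) sums (\<bar>x\<bar> ^ n * exp (\<bar>d\<bar> * \<bar>x\<bar>))" for x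
    unfolding nrm
    using sums_mult[OF exp_converges[of "\<bar>d\<bar> * \<bar>x\<bar>"], of "\<bar>x\<bar> ^ n"]
    by (simp add: power_add power_mult_distrib field_simps)
  have sums_f: "(\<lambda>k. ?f k x) sums (of_real (x ^ n) * iexp ((t + d) * x))" for x
  proof -
    have "(\<lambda>k. (of_real (x ^ n) * iexp (t * x)) * ((\<i> * complex_of_real (d * x)) ^ k /\<^sub>R fact k))
        sums ((of_real (x ^ n) * iexp (t * x)) * iexp (d * x))"
      by (intro sums_mult iexp_taylor_sums)
    moreover have "(of_real (x ^ n) * iexp (t * x)) * iexp (d * x) = of_real (x ^ n) * iexp ((t + d) * x)"
      by (simp add: exp_add[symmetric] ring_distribs)
    moreover have "(of_real (x ^ n) * iexp (t * x)) * ((\<i> * complex_of_real (d * x)) ^ k /\<^sub>R fact k) = ?f k x" for k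
      by (simp add: power_add power_mult_distrib scaleR_conv_of_real field_simps)
    ultimately show ?thesis by (simp only:)
  qed
  have fact_le: "fact (n + k) \<le> (fact n * fact k * 2 ^ (n + k) :: real)" for k
  proof -
    have "real ((n + k) choose n) \<le> 2 ^ (n + k)"
      using binomial_le_pow2[of "n + k" n] by (metis of_nat_le_iff of_nat_numeral of_nat_power)
    moreover have "fact (n + k) = (fact n * fact k * real ((n + k) choose n) :: real)"
      using binomial_fact[of n "n + k", where 'a=real] by (simp add: field_simps)
    ultimately show ?thesis by (simp add: mult_left_mono)
  qed
  have summ: "summable (\<lambda>k. \<integral>x. norm (?f k x) \<partial>A)"
  proof (rule summable_comparison_test)
    show "\<exists>N. \<forall>k\<ge>N. norm (\<integral>x. norm (?f k x) \<partial>A) \<le> (K * C ^ n * fact n * 2 ^ n) * (1/2) ^ k"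
    proof (intro exI allI impI)
      fix k :: nat
      have "(\<integral>x. norm (?f k x) \<partial>A) = \<bar>d\<bar> ^ k / fact k * (\<integral>x. \<bar>x\<bar> ^ (n + k) \<partial>A)"
        unfolding nrm by simp
      also have "\<dots> \<le> \<bar>d\<bar> ^ k / fact k * (K * C ^ (n + k) * fact (n + k))"
        by (intro mult_left_mono bd) auto
      also have "\<dots> \<le> \<bar>d\<bar> ^ k / fact k * (K * C ^ (n + k) * (fact n * fact k * 2 ^ (n + k)))"
        using C K by (intro mult_left_mono fact_le) auto
      also have "\<dots> = (K * C ^ n * fact n * 2 ^ n) * (2 * C * \<bar>d\<bar>) ^ k"
        by (simp add: power_add power_mult_distrib)
      also have "\<dots> \<le> (K * C ^ n * fact n * 2 ^ n) * (1/2) ^ k"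
        using C K d by (intro mult_left_mono power_mono) auto
      finally show "norm (\<integral>x. norm (?f k x) \<partial>A) \<le> (K * C ^ n * fact n * 2 ^ n) * (1/2) ^ k"
        by (subst real_norm_def, subst abs_of_nonneg) (auto intro: integral_nonneg_AE)
    qed
  qed (intro summable_mult summable_geometric, simp)
  have "(\<lambda>k. integral\<^sup>L A (?f k)) sums (\<integral>x. (\<Sum>k. ?f k x) \<partial>A)"
    by (intro sums_integral int1 summ) (use sm_norm in \<open>auto dest: sums_summable\<close>)
  moreover have "(\<Sum>k. ?f k x) = of_real (x ^ n) * iexp ((t + d) * x)" for x
    using sums_f[of x] by (rule sums_unique[symmetric])
  moreover have "integral\<^sup>L A (?f k) = (\<i> * of_real d) ^ k / fact k * moment_char A (n + k) t" for k
    unfolding moment_char_def by (rule integral_mult_right_zero)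
  ultimately show ?thesis
    unfolding moment_char_def by simp
qed

text \<open>
  The moments are the derivatives of the characteristic functions at \<open>0\<close>. Finitely many Taylor
  steps carry their agreement to any real \<open>t\<close>, and Levy's uniqueness theorem applies after
  normalization.
\<close>

theorem moment_determinacy:
  fixes A B :: "real measure"
  assumes finA: "finite_measure A" and finB: "finite_measure B"
    and setsA: "sets A = sets borel" and setsB: "sets B = sets borel"
    and intA: "\<And>n. integrable A (\<lambda>x. x ^ n)" and intB: "\<And>n. integrable B (\<lambda>x. x ^ n)"
    and eq: "\<And>n. (\<integral>x. x ^ n \<partial>A) = (\<integral>x. x ^ n \<partial>B)"
    and bdA: "\<And>n. (\<integral>x. \<bar>x\<bar> ^ n \<partial>A) \<le> K * C ^ n * fact n"
    and bdB: "\<And>n. (\<integral>x. \<bar>x\<bar> ^ n \<partial>B) \<le> K * C ^ n * fact n"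
    and C: "C > 0"
  shows "A = B"
proof -
  interpret A: finite_measure A by fact
  interpret B: finite_measure B by fact
  have spA: "space A = UNIV" and spB: "space B = UNIV"
    using setsA setsB by (auto dest: sets_eq_imp_space_eq)
  \<comment> \<open>Half of the step for which the Taylor series converges geometrically after bounding \<open>(n + k)! \<le> n! * k! * 2 ^ (n + k)\<close>.\<close>
  define d where "d = 1 / (4 * C)"
  have step: "moment_char A n (t + e) = moment_char B n (t + e)"
    if "\<And>n. moment_char A n t = moment_char B n t" "\<bar>e\<bar> \<le> d" for n t e
  proof -
    have e: "4 * C * \<bar>e\<bar> \<le> 1" using that(2) C by (simp add: d_def field_simps)
    show ?thesis
      using moment_char_step[OF finA setsA intA bdA C e, of n t]
            moment_char_step[OF finB setsB intB bdB C e, of n t]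
      unfolding that(1) by (rule sums_unique2)
  qed
  have "moment_char A n t = moment_char B n t" if "\<bar>t\<bar> \<le> real m * d" for n t m
    using that
  proof (induction m arbitrary: t n)
    case 0
    have "moment_char A k 0 = moment_char B k 0" for k
      using eq[of k] intA[of k] intB[of k] by (simp add: moment_char_def flip: of_real_power)
    with 0 show ?case by simp
  next
    case (Suc m)
    have m1: "real m + 1 > 0" by simp
    \<comment> \<open>A point within \<open>m + 1\<close> steps is reached from the point at \<open>m / (m + 1)\<close> of the way.\<close>
    have "\<bar>t * (real m / (real m + 1))\<bar> \<le> real m * d"
    proof -
      have "\<bar>t * (real m / (real m + 1))\<bar> = \<bar>t\<bar> * (real m / (real m + 1))"
        by (simp add: abs_mult)
      also have "\<dots> \<le> (real (Suc m) * d) * (real m / (real m + 1))"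
        using Suc.prems by (rule mult_right_mono) simp
      also have "\<dots> = real m * d" using m1 by (simp add: field_simps)
      finally show ?thesis .
    qed
    moreover have "\<bar>t / (real m + 1)\<bar> \<le> d"
      using Suc.prems m1 by (simp add: field_simps)
    ultimately have "moment_char A n (t * (real m / (real m + 1)) + t / (real m + 1))
        = moment_char B n (t * (real m / (real m + 1)) + t / (real m + 1))"
      using Suc.IH by (intro step) auto
    moreover have "t * (real m / (real m + 1)) + t / (real m + 1) = t * ((real m + 1) / (real m + 1))"
      by (simp only: add_divide_distrib distrib_left times_divide_eq_right mult_1_right)
    hence "t * (real m / (real m + 1)) + t / (real m + 1) = t" using m1 by simp
    ultimately show ?case by simp
  qed
  moreover have "\<exists>m. \<bar>t\<bar> \<le> real m * d" for t
    using reals_Archimedean3[of d] C by (metis d_def less_eq_real_def zero_less_divide_1_iff zero_less_mult_iff zero_less_numeral)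
  ultimately have char_eq: "moment_char A 0 t = moment_char B 0 t" for t
    by blast
  have mass: "measure A UNIV = measure B UNIV"
    using eq[of 0] by (simp add: spA spB)
  show ?thesis
  proof (cases "measure A UNIV = 0")
    case True
    have "emeasure A S = emeasure B S" for S
    proof -
      have "emeasure A S \<le> emeasure A (space A)" "emeasure B S \<le> emeasure B (space B)"
        by (rule emeasure_space)+
      then show ?thesis using True mass by (simp add: A.emeasure_eq_measure B.emeasure_eq_measure spA spB measure_le_0_iff)
    qed
    then show ?thesis using setsA setsB by (intro measure_eqI) auto
  next
    case False
    define c where "c = measure A UNIV"
    have c: "c > 0" using False by (simp add: c_def zero_less_measure_iff)
    define P where "P D = density D (\<lambda>_. ennreal (1 / c))" for D :: "real measure"
    have rd: "real_distribution (P D)"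
      if "sets D = sets borel" "measure D UNIV = c" "finite_measure D" for D
    proof -
      interpret finite_measure D by fact
      have sp: "space D = UNIV" using that(1) by (auto dest: sets_eq_imp_space_eq)
      have "emeasure (P D) (space (P D)) = 1"
        using c that(2) sets.top[of D] emeasure_eq_measure[of UNIV] sp
        by (simp add: P_def emeasure_density_const ennreal_mult[symmetric])
      then show ?thesis
        by (intro real_distribution.intro prob_spaceI real_distribution_axioms.intro)
           (auto simp: P_def that sp)
    qed
    have ch: "char (P D) t = (1 / c) *\<^sub>R moment_char D 0 t" if "sets D = sets borel" for D t
    proof -
      have [measurable_cong]: "sets D = sets borel" by fact
      show ?thesis
        unfolding char_def P_def moment_char_def
        using c by (subst integral_density) (auto simp: mult.commute)
    qed
    have "P A = P B"
      using rd[OF setsA _ finA] rd[OF setsB _ finB] mass c_def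
      by (intro Levy_uniqueness) (auto simp: fun_eq_iff ch setsA setsB char_eq)
    then have "emeasure (P A) S = emeasure (P B) S" for S by simp
    then have *: "ennreal (1 / c) * emeasure A S = ennreal (1 / c) * emeasure B S" if "S \<in> sets borel" for S
      using that by (metis P_def emeasure_density_const setsA setsB)
    have "emeasure A S = emeasure B S" if "S \<in> sets borel" for S
      using *[OF that] c by (simp add: A.emeasure_eq_measure B.emeasure_eq_measure ennreal_mult[symmetric])
    then show ?thesis using setsA setsB by (intro measure_eqI) auto
  qed
qed

section \<open>The generalized gamma function as a limit of finite products\<close>

lemma concave_on_slopes:
  fixes L :: "real \<Rightarrow> real"
  assumes "concave_on {0<..} L" "0 < x" "x < y" "y < z"
  shows "(L z - L y) / (z - y) \<le> (L z - L x) / (z - x)"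
    and "(L z - L x) / (z - x) \<le> (L y - L x) / (y - x)"
proof -
  have c: "convex_on {0<..} (\<lambda>x. - L x)" using assms(1) by (simp add: concave_on_def)
  have "(- L x - - L y) / (x - y) \<le> (- L x - - L z) / (x - z)"
       "(- L x - - L z) / (x - z) \<le> (- L y - - L z) / (y - z)"
    using convex_on_slope_le[OF c, of x z y] assms by auto
  thus "(L z - L y) / (z - y) \<le> (L z - L x) / (z - x)" "(L z - L x) / (z - x) \<le> (L y - L x) / (y - x)"
    using assms by (simp_all add: field_simps)
qed

lemma concave_on_right_deriv:
  fixes L :: "real \<Rightarrow> real"
  assumes L: "concave_on {0<..} L" and x: "0 < x"
  obtains D where "(L has_real_derivative D) (at_right x)"
    and "\<And>y. x < y \<Longrightarrow> (L y - L x) / (y - x) \<le> D"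
    and "\<And>w. 0 < w \<Longrightarrow> w < x \<Longrightarrow> D \<le> (L x - L w) / (x - w)"
proof -
  define q where "q = (\<lambda>y. (L y - L x) / (y - x))"
  define D where "D = (SUP y\<in>{x<..}. q y)"
  have ub: "q y \<le> (L x - L w) / (x - w)" if "0 < w" "w < x" "x < y" for w y
    using concave_on_slopes[OF L that] by (auto simp: q_def)
  have bdd: "bdd_above (q ` {x<..})"
    using ub[of "x/2"] x by (auto intro!: bdd_aboveI[where M="(L x - L (x/2)) / (x - x/2)"])
  have le: "q y \<le> D" if "x < y" for y
    unfolding D_def using that bdd by (intro cSUP_upper) auto
  have anti: "q z \<le> q y" if "x < y" "y \<le> z" for y z
    using concave_on_slopes(2)[OF L x, of y z] that by (cases "y = z") (auto simp: q_def)
  have "(q \<longlongrightarrow> D) (at_right x)"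
  proof (rule tendstoI)
    fix e :: real assume e: "e > 0"
    have "\<exists>y\<in>{x<..}. D - e < q y"
      unfolding D_def using e bdd by (subst less_cSUP_iff[symmetric]) (auto intro: exI[of _ "x + 1"])
    then obtain y where y: "x < y" "D - e < q y" by auto
    have "eventually (\<lambda>z. z \<in> {x<..<y}) (at_right x)"
      using y(1) by (rule eventually_at_right_real)
    then show "eventually (\<lambda>z. dist (q z) D < e) (at_right x)"
    proof eventually_elim
      case (elim z)
      have "q y \<le> q z" "q z \<le> D" using anti[of z y] le[of z] elim by auto
      then show ?case using y(2) e by (auto simp: dist_real_def)
    qed
  qed
  then have "(L has_real_derivative D) (at_right x)"
    by (simp add: has_field_derivative_iff q_def)
  moreover have "D \<le> (L x - L w) / (x - w)" if "0 < w" "w < x" for w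
    unfolding D_def by (rule cSUP_least) (use ub that in \<open>auto intro: exI[of _ "x + 1"]\<close>)
  ultimately show thesis using that le unfolding q_def by blast
qed

lemma concave_on_left_deriv:
  fixes L :: "real \<Rightarrow> real"
  assumes L: "concave_on {0<..} L" and x: "0 < x"
  obtains D where "(L has_real_derivative D) (at_left x)"
    and "\<And>y. x < y \<Longrightarrow> (L y - L x) / (y - x) \<le> D"
    and "\<And>w. 0 < w \<Longrightarrow> w < x \<Longrightarrow> D \<le> (L x - L w) / (x - w)"
proof -
  define q where "q = (\<lambda>w. (L w - L x) / (w - x))"
  define D where "D = (INF w\<in>{0<..<x}. q w)"
  have qq: "q w = (L x - L w) / (x - w)" if "w \<noteq> x" for w using that by (simp add: q_def field_simps)
  have lb: "(L y - L x) / (y - x) \<le> q w" if "0 < w" "w < x" "x < y" for w y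
    using concave_on_slopes[OF L that] that by (auto simp: qq)
  have bdd: "bdd_below (q ` {0<..<x})"
    using lb[of _ "x+1"] by (auto intro!: bdd_belowI[where m="L (x+1) - L x"])
  have ne: "{0<..<x} \<noteq> {}" using x dense by auto
  have le: "D \<le> q w" if "0 < w" "w < x" for w
    unfolding D_def using that bdd by (intro cINF_lower) auto
  have anti: "q w \<le> q v" if "0 < v" "v \<le> w" "w < x" for v w
    using concave_on_slopes(1)[OF L, of v w x] that by (cases "v = w") (auto simp: qq)
  have "(q \<longlongrightarrow> D) (at_left x)"
  proof (rule tendstoI)
    fix e :: real assume e: "e > 0"
    have "\<exists>w\<in>{0<..<x}. q w < D + e"
      unfolding D_def using e bdd ne by (subst cINF_less_iff[symmetric]) auto
    then obtain w where w: "0 < w" "w < x" "q w < D + e" by auto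
    have "eventually (\<lambda>z. z \<in> {w<..<x}) (at_left x)"
      using w(2) by (rule eventually_at_left_real)
    then show "eventually (\<lambda>z. dist (q z) D < e) (at_left x)"
    proof eventually_elim
      case (elim z)
      have "q z \<le> q w" "D \<le> q z" using anti[of w z] le[of z] elim w by auto
      then show ?case using w(3) e by (auto simp: dist_real_def)
    qed
  qed
  then have "(L has_real_derivative D) (at_left x)"
    by (simp add: has_field_derivative_iff q_def)
  moreover have "(L y - L x) / (y - x) \<le> D" if "x < y" for y
    unfolding D_def using lb that by (intro cINF_greatest[OF ne]) auto
  moreover have "D \<le> (L x - L w) / (x - w)" if "0 < w" "w < x" for w
    using le[OF that] that qq[of w] by simp
  ultimately show thesis using that by blast
qed

text \<open>
  For concave \<open>ln g\<close> the averaged logarithmic derivative at \<open>n\<close> lies between the slopes over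
  \<open>[n, n + 1]\<close> and \<open>[n - 1, n]\<close>. This is the only property of the coefficients that is
  used.
\<close>

lemma webster_coeff_bounds:
  assumes g: "webster_conditions g" and n: "n \<ge> 2"
  shows "ln (g (real (Suc n))) - ln (g (real n)) \<le> webster_coeff g n"
    and "webster_coeff g n \<le> ln (g (real n)) - ln (g (real n - 1))"
proof -
  define L where "L = (\<lambda>s. ln (g s))"
  have pos: "g s > 0" if "s > 0" for s using g that by (simp add: webster_conditions_def)
  have L: "concave_on {0<..} L" using g by (simp add: webster_conditions_def L_def)
  have n0: "real n > 0" using n by simp
  have vd: "vector_derivative g (at (real n) within S) = g (real n) * D"
    if "(L has_real_derivative D) (at (real n) within S)" "at (real n) within S \<noteq> bot"
       "eventually (\<lambda>s. s > 0) (at (real n) within S)" for D S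
  proof -
    have "((\<lambda>s. exp (L s)) has_real_derivative exp (L (real n)) * D) (at (real n) within S)"
      using that(1) by (auto intro!: derivative_eq_intros)
    moreover have "eventually (\<lambda>s. exp (L s) = g s) (at (real n) within S)"
      using that(3) by eventually_elim (use pos in \<open>auto simp: L_def\<close>)
    ultimately have "(g has_real_derivative exp (L (real n)) * D) (at (real n) within S)"
      using has_field_derivative_cong_eventually[of "\<lambda>s. exp (L s)" g "real n" S] pos[OF n0]
      by (simp add: L_def)
    then have "(g has_vector_derivative g (real n) * D) (at (real n) within S)"
      using pos[OF n0] by (simp add: L_def has_real_derivative_iff_has_vector_derivative)
    then show ?thesis
      by (rule vector_derivative_within[OF that(2)])
  qed
  obtain D1 where D1: "(L has_real_derivative D1) (at_right (real n))"
    "\<And>y. real n < y \<Longrightarrow> (L y - L (real n)) / (y - real n) \<le> D1"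
    "\<And>w. 0 < w \<Longrightarrow> w < real n \<Longrightarrow> D1 \<le> (L (real n) - L w) / (real n - w)"
    using concave_on_right_deriv[OF L n0] by blast
  obtain D2 where D2: "(L has_real_derivative D2) (at_left (real n))"
    "\<And>y. real n < y \<Longrightarrow> (L y - L (real n)) / (y - real n) \<le> D2"
    "\<And>w. 0 < w \<Longrightarrow> w < real n \<Longrightarrow> D2 \<le> (L (real n) - L w) / (real n - w)"
    using concave_on_left_deriv[OF L n0] by blast
  have ev: "eventually (\<lambda>s. s > 0) (at (real n) within S)" for S
    using order_tendstoD(1)[OF tendsto_ident_at n0] .
  have "webster_coeff g n = (D1 + D2) / 2"
    using vd[OF D1(1)] vd[OF D2(1)] pos[OF n0]
    by (simp add: webster_coeff_def ev trivial_limit_at_left_real trivial_limit_at_right_real field_simps)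
  then show "ln (g (real (Suc n))) - ln (g (real n)) \<le> webster_coeff g n"
    "webster_coeff g n \<le> ln (g (real n)) - ln (g (real n - 1))"
    using D1(2)[of "real n + 1"] D2(2)[of "real n + 1"] D1(3)[of "real n - 1"] D2(3)[of "real n - 1"] n
    by (simp_all add: L_def add.commute)
qed

lemma webster_ln_diff_tendsto:
  assumes pos: "\<And>s. s > 0 \<Longrightarrow> g s > (0::real)"
    and lim: "\<And>c. c > 0 \<Longrightarrow> ((\<lambda>s. g (s + c) / g s) \<longlongrightarrow> 1) at_top" and c: "c \<ge> 0"
  shows "(\<lambda>n. ln (g (real n + c)) - ln (g (real n))) \<longlonglongrightarrow> 0"
proof (cases "c = 0")
  case False
  with c have "((\<lambda>s. g (s + c) / g s) \<longlongrightarrow> 1) at_top" by (intro lim) auto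
  then have "(\<lambda>n. g (real n + c) / g (real n)) \<longlonglongrightarrow> 1"
    by (rule filterlim_compose[OF _ filterlim_real_sequentially])
  then have "(\<lambda>n. ln (g (real n + c) / g (real n))) \<longlonglongrightarrow> ln 1"
    by (intro tendsto_ln) auto
  moreover have "eventually (\<lambda>n. ln (g (real n + c) / g (real n)) = ln (g (real n + c)) - ln (g (real n))) sequentially"
    using eventually_gt_at_top[of 0]
  proof eventually_elim
    case (elim n)
    then show ?case using pos[of "real n"] pos[of "real n + c"] c by (simp add: ln_div)
  qed
  ultimately show ?thesis using tendsto_cong by fastforce
qed simp

text \<open>
  As for the Euler-Mascheroni constant: by the slope bounds the sequence decreases, while the same
  sequence with \<open>ln (g (n + 1))\<close> in place of \<open>ln (g n)\<close> increases, and the two differ by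
  \<open>ln (g (n + 1) / g n)\<close>, which tends to \<open>0\<close>.
\<close>

lemma webster_gamma_const_converges:
  assumes g: "webster_conditions g"
  shows "(\<lambda>n. (\<Sum>j=1..n. webster_coeff g j) - ln (g (real n))) \<longlonglongrightarrow> webster_gamma_const g"
proof -
  define D where "D = (\<lambda>n. (\<Sum>j=1..n. webster_coeff g j) - ln (g (real n)))"
  define E where "E = (\<lambda>n. (\<Sum>j=1..n. webster_coeff g j) - ln (g (real n + 1)))"
  have Dstep: "D (Suc n) \<le> D n" if "n \<ge> 1" for n
    using webster_coeff_bounds(2)[OF g, of "Suc n"] that by (simp add: D_def)
  have Estep: "E n \<le> E (Suc n)" if "n \<ge> 1" for n
    using webster_coeff_bounds(1)[OF g, of "Suc n"] that by (simp add: E_def add.commute)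
  have dec: "decseq (\<lambda>n. D (Suc n))" by (intro decseq_SucI Dstep) simp
  have inc: "incseq (\<lambda>n. E (Suc n))" by (intro incseq_SucI Estep) simp
  have diff: "(\<lambda>n. D n - E n) \<longlonglongrightarrow> 0"
    using webster_ln_diff_tendsto[of g 1] g by (simp add: D_def E_def webster_conditions_def)
  have "Bseq (\<lambda>n. D n - E n)" using diff by (intro convergent_imp_Bseq convergentI)
  then obtain K where K: "\<And>n. \<bar>D n - E n\<bar> \<le> K" by (auto simp: Bseq_def)
  have "D (Suc n) \<ge> E (Suc 0) - K" for n
    using K[of "Suc n"] incseqD[OF inc, of 0 n] by (simp add: abs_le_iff)
  then obtain l where "(\<lambda>n. D (Suc n)) \<longlonglongrightarrow> l"
    using decseq_convergent[OF dec] by blast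
  then have "D \<longlonglongrightarrow> l" by (simp add: filterlim_sequentially_Suc)
  then show ?thesis
    unfolding webster_gamma_const_def D_def[symmetric] by (simp add: limI)
qed

text \<open>
  For \<open>g\<close> the identity this is Gauss's product \<open>N powr s * N! / (s * (s + 1) * ... * (s + N))\<close>
  for \<open>Gamma s\<close>.
\<close>

definition gauss_product :: "(real \<Rightarrow> real) \<Rightarrow> real \<Rightarrow> nat \<Rightarrow> real" where
  "gauss_product g s N = g (real N) powr s / g s * (\<Prod>n<N. g (real (Suc n)) / g (real (Suc n) + s))"

text \<open>
  A partial product of the defining infinite product differs from the Gauss product by \<open>g s\<close> and
  by the exponential of \<open>s\<close> times the sequence whose limit is the constant
  \<open>webster_gamma_const g\<close>.
\<close>

lemma gen_Gamma_eq_gauss_limit: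
  assumes g: "webster_conditions g" and s: "s > 0"
    and lim: "gauss_product g s \<longlonglongrightarrow> v" and v: "v > 0"
  shows "gen_Gamma g s = v"
proof -
  have pos: "g x > 0" if "x > 0" for x using g that by (simp add: webster_conditions_def)
  define p where "p = (\<lambda>n. g (real (Suc n)) / g (real (Suc n) + s) * exp (webster_coeff g (Suc n) * s))"
  define D where "D = (\<lambda>n. (\<Sum>j=1..n. webster_coeff g j) - ln (g (real n)))"
  have p: "p n > 0" for n using pos s by (auto simp: p_def)
  have eq: "(\<Prod>n<N. p n) = gauss_product g s N * g s * exp (s * D N)" if "N > 0" for N
  proof -
    have "(\<Prod>n<N. p n) = (\<Prod>n<N. g (real (Suc n)) / g (real (Suc n) + s)) * exp (\<Sum>n<N. webster_coeff g (Suc n) * s)"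
      by (simp only: p_def prod.distrib exp_sum[OF finite_lessThan])
    also have "(\<Sum>n<N. webster_coeff g (Suc n) * s) = s * (\<Sum>j=1..N. webster_coeff g j)"
      by (simp add: sum_distrib_left[symmetric] sum_distrib_right[symmetric] mult.commute sum.atLeast1_atMost_eq)
    also have "exp (s * (\<Sum>j=1..N. webster_coeff g j)) = g (real N) powr s * exp (s * D N)"
      using pos[of "real N"] that by (simp add: D_def powr_def exp_add[symmetric] ring_distribs)
    finally show ?thesis using pos[OF s] by (simp add: gauss_product_def)
  qed
  have "D \<longlonglongrightarrow> webster_gamma_const g"
    using webster_gamma_const_converges[OF g] by (simp add: D_def)
  then have "(\<lambda>N. gauss_product g s N * g s * exp (s * D N)) \<longlonglongrightarrow> v * g s * exp (s * webster_gamma_const g)"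
    by (intro tendsto_intros lim)
  then have "(\<lambda>N. \<Prod>n<N. p n) \<longlonglongrightarrow> v * g s * exp (s * webster_gamma_const g)"
    by (rule Lim_transform_eventually)
       (intro eventually_mono[OF eventually_gt_at_top[of 0]] eq[symmetric])
  then have "(\<lambda>N. \<Prod>n\<le>N. p n) \<longlonglongrightarrow> v * g s * exp (s * webster_gamma_const g)"
    by (subst (asm) filterlim_sequentially_Suc[symmetric]) (simp add: lessThan_Suc_atMost)
  then have "p has_prod (v * g s * exp (s * webster_gamma_const g))"
    using v pos[OF s] p by (simp add: has_prod_def raw_has_prod_def)
  then have "prodinf p = v * g s * exp (s * webster_gamma_const g)"
    by (rule has_prod_unique[symmetric])
  then show ?thesis
    using pos[OF s] by (simp add: gen_Gamma_def p_def exp_minus field_simps)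
qed

lemma convex_on_unit_increment_squeeze:
  fixes F :: "real \<Rightarrow> real"
  assumes F: "convex_on {0<..} F" and x: "x > 1" and s: "s > 0"
  shows "s * (F x - F (x - 1)) \<le> F (x + s) - F x"
    and "F (x + s) - F x \<le> s * (F (x + s + 1) - F (x + s))"
proof -
  have c: "concave_on {0<..} (\<lambda>x. - F x)" using F by (simp add: concave_on_def)
  have "(- F (x + s) - - F x) / s \<le> - F x - - F (x - 1)"
    using concave_on_slopes[OF c, of "x - 1" x "x + s"] x s by auto
  then show "s * (F x - F (x - 1)) \<le> F (x + s) - F x"
    using s by (simp add: field_simps)
  have "- F (x + s + 1) - - F (x + s) \<le> (- F (x + s) - - F x) / s"
    using concave_on_slopes[OF c, of "x" "x + s" "x + s + 1"] x s by auto
  then show "F (x + s) - F x \<le> s * (F (x + s + 1) - F (x + s))"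
    using s by (simp add: field_simps)
qed

text \<open>
  Let \<open>F = ln f\<close>. The functional equation turns the Gauss product into
  \<open>f s * exp (- (F (N + 1 + s) - F (N + 1) - s * ln (g N)))\<close>. Convexity of \<open>F\<close> traps its
  increment over \<open>[N + 1, N + 1 + s]\<close> between \<open>s\<close> times the unit increments before and after,
  which are values of \<open>ln g\<close>, and these are asymptotically equal.
\<close>

theorem bohr_mollerup_limit:
  fixes f g :: "real \<Rightarrow> real"
  assumes gpos: "\<And>s. s > 0 \<Longrightarrow> g s > 0"
    and glim: "\<And>c. c > 0 \<Longrightarrow> ((\<lambda>s. g (s + c) / g s) \<longlongrightarrow> 1) at_top"
    and fpos: "\<And>s. s > 0 \<Longrightarrow> f s > 0"
    and f1: "f 1 = 1" and feq: "\<And>s. s > 0 \<Longrightarrow> f (s + 1) = g s * f s"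
    and fconv: "convex_on {0<..} (\<lambda>s. ln (f s))"
    and s: "s > 0"
  shows "gauss_product g s \<longlonglongrightarrow> f s"
proof -
  define F where "F = (\<lambda>s. ln (f s))"
  define L where "L = (\<lambda>s. ln (g s))"
  have F: "convex_on {0<..} F" using fconv by (simp add: F_def)
  have Feq: "F (x + 1) = L x + F x" if "x > 0" for x
    using feq[OF that] gpos[OF that] fpos[OF that] by (simp add: F_def L_def ln_mult)
  have prod1: "(\<Prod>n<N. g (real (Suc n))) = f (real N + 1)" for N
  proof (induction N)
    case (Suc N)
    then show ?case using feq[of "real N + 1"] by (simp add: mult_ac add_ac)
  qed (simp add: f1)
  have prod2: "(\<Prod>n<N. g (real (Suc n) + s)) * (g s * f s) = f (real N + s + 1)" for N
  proof (induction N)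
    case 0 show ?case using feq[OF s] by simp
  next
    case (Suc N)
    have "(\<Prod>n<Suc N. g (real (Suc n) + s)) * (g s * f s) = f (real N + s + 1) * g (real (Suc N) + s)"
      unfolding Suc.IH[symmetric] by (simp add: mult_ac)
    also have "\<dots> = f (real (Suc N) + s + 1)"
      using feq[of "real (Suc N) + s"] s by (simp add: algebra_simps)
    finally show ?case .
  qed
  have P: "gauss_product g s N = f s * exp (- (F (real N + 1 + s) - F (real N + 1) - s * L (real N)))"
    if "N > 0" for N
  proof -
    have nz: "(\<Prod>n<N. g (real (Suc n) + s)) > 0" using gpos s by (auto intro!: prod_pos)
    have "gauss_product g s N = g (real N) powr s * f (real N + 1) / (g s * (\<Prod>n<N. g (real (Suc n) + s)))"
      by (simp add: gauss_product_def prod_dividef prod1[symmetric])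
    also have "\<dots> = f s * (g (real N) powr s * f (real N + 1) / f (real N + s + 1))"
      by (subst prod2[of N, symmetric]) (use nz gpos[OF s] fpos[OF s] in simp)
    also have "g (real N) powr s = exp (s * L (real N))"
      using gpos[of "real N"] that by (simp add: L_def powr_def)
    also have "f (real N + 1) = exp (F (real N + 1))" using fpos[of "real N + 1"] by (simp add: F_def)
    also have "f (real N + s + 1) = exp (F (real N + 1 + s))" using fpos[of "real N + s + 1"] s
      by (simp add: F_def add_ac)
    finally have "gauss_product g s N = f s * exp (s * L (real N) + F (real N + 1) - F (real N + 1 + s))"
      by (simp only: exp_add exp_diff)
    then show ?thesis by (simp add: algebra_simps)
  qed
  have "(\<lambda>N. F (real N + 1 + s) - F (real N + 1) - s * L (real N)) \<longlonglongrightarrow> 0"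
  proof (rule tendsto_sandwich)
    show "eventually (\<lambda>N. 0 \<le> F (real N + 1 + s) - F (real N + 1) - s * L (real N)) sequentially"
      using eventually_gt_at_top[of 0]
    proof eventually_elim
      case (elim N)
      then show ?case using convex_on_unit_increment_squeeze(1)[OF F _ s, of "real N + 1"] Feq[of "real N"] by simp
    qed
    show "eventually (\<lambda>N. F (real N + 1 + s) - F (real N + 1) - s * L (real N) \<le>
        s * (L (real N + (1 + s)) - L (real N))) sequentially"
      using eventually_gt_at_top[of 0]
    proof eventually_elim
      case (elim N)
      then show ?case using convex_on_unit_increment_squeeze(2)[OF F _ s, of "real N + 1"]
          Feq[of "real N + 1 + s"] s by (simp add: algebra_simps)
    qed
    have "(\<lambda>N. s * (L (real N + (1 + s)) - L (real N))) \<longlonglongrightarrow> s * 0"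
      unfolding L_def using s by (intro tendsto_intros webster_ln_diff_tendsto gpos glim) auto
    then show "(\<lambda>N. s * (L (real N + (1 + s)) - L (real N))) \<longlonglongrightarrow> 0" by simp
  qed simp
  then have "(\<lambda>N. f s * exp (- (F (real N + 1 + s) - F (real N + 1) - s * L (real N)))) \<longlonglongrightarrow> f s * exp (- 0)"
    by (intro tendsto_intros)
  then have "(\<lambda>N. f s * exp (- (F (real N + 1 + s) - F (real N + 1) - s * L (real N)))) \<longlonglongrightarrow> f s"
    by simp
  then show ?thesis
    by (rule Lim_transform_eventually)
       (intro eventually_mono[OF eventually_gt_at_top[of 0]] P[symmetric])
qed

lemma ratio_shift_tendsto: "c > 0 \<Longrightarrow> ((\<lambda>s::real. (s + c) / s) \<longlongrightarrow> 1) at_top"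
  by real_asymp

lemma gauss_product_id: "s > 0 \<Longrightarrow> gauss_product (\<lambda>x. x) s \<longlonglongrightarrow> Gamma s"
  using log_convex_Gamma_real
  by (intro bohr_mollerup_limit ratio_shift_tendsto)
     (auto simp: o_def intro!: Gamma_plus1 elim!: nonpos_Ints_cases)

lemma gauss_product_conjugate:
  assumes pos: "\<And>s. s > 0 \<Longrightarrow> g s > 0" and s: "s > 0" and N: "N > 0"
  shows "gauss_product (conjugate_exponent g) s N = gauss_product (\<lambda>x. x) s N / gauss_product g s N"
proof -
  define a where "a = (\<Prod>n<N. real (Suc n) / (real (Suc n) + s))"
  define b where "b = (\<Prod>n<N. g (real (Suc n)) / g (real (Suc n) + s))"
  have "(\<Prod>n<N. conjugate_exponent g (real (Suc n)) / conjugate_exponent g (real (Suc n) + s))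
    = (\<Prod>n<N. (real (Suc n) / (real (Suc n) + s)) / (g (real (Suc n)) / g (real (Suc n) + s)))"
    by (intro prod.cong refl) (simp add: conjugate_exponent_def mult.commute)
  also have "\<dots> = a / b"
    unfolding a_def b_def by (rule prod_dividef)
  finally have eq: "(\<Prod>n<N. conjugate_exponent g (real (Suc n)) / conjugate_exponent g (real (Suc n) + s)) = a / b" .
  have gN: "g (real N) > 0" using pos N by simp
  have "conjugate_exponent g (real N) powr s = real N powr s / g (real N) powr s"
    unfolding conjugate_exponent_def by (rule powr_divide)
  then show ?thesis
    unfolding gauss_product_def eq unfolding a_def[symmetric] b_def[symmetric]
    by (simp add: conjugate_exponent_def mult_ac)
qed

section \<open>Tail integrals of a decreasing path\<close>

text \<open>
  The paths of interest are \<open>exp (- xi u)\<close>, possibly set to zero after a random time. Setting the path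
  to zero at negative times lets integrals over the half-line be written over all of \<open>lborel\<close>.
\<close>

locale decreasing_path =
  fixes x :: "real \<Rightarrow> real"
  assumes meas [measurable]: "x \<in> borel_measurable borel"
    and nonneg: "\<And>u. 0 \<le> x u"
    and zero: "\<And>u. u < 0 \<Longrightarrow> x u = 0"
    and anti: "\<And>u v. 0 \<le> u \<Longrightarrow> u \<le> v \<Longrightarrow> x v \<le> x u"
    and rc: "\<And>u. 0 \<le> u \<Longrightarrow> continuous (at_right u) x"
    and fin: "(\<integral>\<^sup>+u. x u \<partial>lborel) < \<infinity>"
begin

definition mu :: "real measure" where "mu = density lborel (\<lambda>u. ennreal (x u))"

definition tail :: "real \<Rightarrow> real" where "tail t = measure mu {t..}"

lemma sets_mu [simp, measurable_cong]: "sets mu = sets borel"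
  by (simp add: mu_def)

lemma space_mu [simp]: "space mu = UNIV"
  by (simp add: mu_def)

sublocale finite_measure mu
  using fin by (intro finite_measureI) (simp add: mu_def emeasure_density)

lemma emeasure_atLeast: "emeasure mu {t..} = ennreal (tail t)"
  by (simp add: tail_def emeasure_eq_measure)

lemma tail_nonneg: "0 \<le> tail t" by (simp add: tail_def)

lemma tail_diff: "t \<le> m \<Longrightarrow> tail t - tail m = measure mu {t..<m}"
proof -
  assume "t \<le> m"
  have "measure mu ({t..<m} \<union> {m..}) = measure mu {t..<m} + measure mu {m..}"
    by (intro finite_measure_Union) auto
  moreover have "{t..<m} \<union> {m..} = {t..}" using \<open>t \<le> m\<close> by auto
  ultimately show ?thesis by (simp add: tail_def)
qed

lemma tail_anti: "t \<le> m \<Longrightarrow> tail m \<le> tail t"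
  using tail_diff[of t m] measure_nonneg[of mu "{t..<m}"] by linarith

lemma tail_diff_le:
  assumes "0 \<le> t" "t \<le> m" shows "tail t - tail m \<le> x t * (m - t)"
proof -
  have "emeasure mu {t..<m} = (\<integral>\<^sup>+u. ennreal (x u) * indicator {t..<m} u \<partial>lborel)"
    by (simp add: mu_def emeasure_density)
  also have "\<dots> \<le> (\<integral>\<^sup>+u. ennreal (x t) * indicator {t..<m} u \<partial>lborel)"
    using assms by (intro nn_integral_mono) (auto split: split_indicator intro!: ennreal_leI anti)
  also have "\<dots> = ennreal (x t * (m - t))"
    using assms nonneg[of t] by (simp add: nn_integral_cmult_indicator ennreal_mult)
  finally show ?thesis
    using assms nonneg[of t] by (simp add: tail_diff emeasure_eq_measure)
qed

lemma tail_diff_ge: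
  assumes "0 \<le> t" "t \<le> m" shows "x m * (m - t) \<le> tail t - tail m"
proof -
  have "ennreal (x m * (m - t)) = (\<integral>\<^sup>+u. ennreal (x m) * indicator {t..<m} u \<partial>lborel)"
    using assms nonneg[of m] by (simp add: nn_integral_cmult_indicator ennreal_mult)
  also have "\<dots> \<le> (\<integral>\<^sup>+u. ennreal (x u) * indicator {t..<m} u \<partial>lborel)"
    using assms by (intro nn_integral_mono) (auto split: split_indicator intro!: ennreal_leI anti)
  also have "\<dots> = emeasure mu {t..<m}"
    by (simp add: mu_def emeasure_density)
  finally show ?thesis
    using assms nonneg[of m] by (simp add: tail_diff emeasure_eq_measure)
qed

lemma tail_continuous: "continuous_on {0..} tail"
proof (rule lipschitz_on_continuous_on)
  show "(x 0)-lipschitz_on {0..} tail"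
  proof (rule lipschitz_onI)
    fix t m :: real assume tm: "t \<in> {0..}" "m \<in> {0..}"
    have *: "\<bar>tail a - tail b\<bar> \<le> x 0 * \<bar>a - b\<bar>" if "0 \<le> a" "a \<le> b" for a b
    proof -
      have "tail a - tail b \<le> x a * (b - a)" by (rule tail_diff_le[OF that])
      also have "\<dots> \<le> x 0 * (b - a)" using that by (intro mult_right_mono anti) auto
      finally show ?thesis using that tail_anti[of a b] by simp
    qed
    show "dist (tail t) (tail m) \<le> x 0 * dist t m"
      using *[of t m] *[of m t] tm by (cases "t \<le> m") (auto simp: dist_real_def abs_minus_commute)
  qed (rule nonneg)
qed

lemma tail_tendsto_0: "(\<lambda>n. tail (real n)) \<longlonglongrightarrow> 0"
proof -
  have "(\<lambda>n. measure mu {real n..}) \<longlonglongrightarrow> measure mu (\<Inter>n. {real n..})"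
    by (rule finite_Lim_measure_decseq) (auto simp: decseq_def)
  moreover have "(\<Inter>n. {real n..}) = {}"
    by (auto simp: not_le) (metis reals_Archimedean2 not_le)
  ultimately show ?thesis by (simp add: tail_def)
qed

text \<open>
  Right-continuity keeps the path positive on a whole interval to the right of \<open>u\<close>.
\<close>

lemma x_pos_imp_tail_pos:
  assumes u: "0 \<le> u" and x: "0 < x u" shows "0 < tail u"
proof -
  have "(x \<longlongrightarrow> x u) (at_right u)" using rc[OF u] by (simp add: continuous_within)
  then have "eventually (\<lambda>v. 0 < x v) (at_right u)" using x by (rule order_tendstoD)
  then obtain b where "b > u" "\<And>y. u < y \<Longrightarrow> y < b \<Longrightarrow> 0 < x y"
    by (auto simp: eventually_at_right_field)
  then obtain v where v: "u < v" "0 < x v" by (meson dense)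
  have "0 < x v * (v - u)" using v by simp
  also have "\<dots> \<le> tail u - tail v" using u v by (intro tail_diff_ge) auto
  also have "\<dots> \<le> tail u" using tail_nonneg[of v] by simp
  finally show ?thesis .
qed

lemma tail_pos_imp_x_pos:
  assumes u: "0 \<le> u" and tail: "0 < tail u" shows "0 < x u"
proof (rule ccontr)
  assume "\<not> 0 < x u"
  then have "x v = 0" if "v \<ge> u" for v using anti[OF u that] nonneg[of v] by simp
  then have "emeasure mu {u..} = 0"
    by (simp add: mu_def emeasure_density nn_integral_0_iff_AE) (auto split: split_indicator)
  with tail show False by (simp add: emeasure_atLeast)
qed

lemma tail_measurable [measurable]: "tail \<in> borel_measurable borel"
proof -
  have "mono (\<lambda>t. - tail t)" using tail_anti by (auto simp: mono_def)
  then have "(\<lambda>t. - tail t) \<in> borel_measurable borel" by (rule borel_measurable_mono)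
  then have "(\<lambda>t. - (- tail t)) \<in> borel_measurable borel" by measurable
  then show ?thesis by simp
qed

text \<open>
  The tail integral is continuous and, as long as it is positive, strictly decreasing. Hence, for
  \<open>0 < y < tail t\<close>, the set is an interval \<open>[t, m)\<close> with \<open>tail m = y\<close>, whose mass is
  \<open>tail t - tail m\<close>. For \<open>y = 0\<close> it misses only points at which the path vanishes.
\<close>

lemma emeasure_tail_greater:
  assumes t: "0 \<le> t"
  shows "emeasure mu {u. t \<le> u \<and> y < tail u} = ennreal (if y < 0 then tail t else tail t - y)"
proof -
  have [measurable]: "{u. t \<le> u \<and> y < tail u} \<in> sets borel" by measurable
  consider "y < 0" | "y = 0" | "0 < y" "y < tail t" | "0 < y" "tail t \<le> y" by linarith
  then show ?thesis
  proof cases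
    case 1
    then have "{u. t \<le> u \<and> y < tail u} = {t..}" using tail_nonneg by (auto intro: less_le_trans)
    with 1 show ?thesis by (simp add: emeasure_atLeast)
  next
    case 2
    have "AE u in mu. (u \<in> {u. t \<le> u \<and> y < tail u}) = (u \<in> {t..})"
      unfolding mu_def by (subst AE_density) (use 2 t x_pos_imp_tail_pos in \<open>auto intro!: AE_I2\<close>)
    then have "emeasure mu {u. t \<le> u \<and> y < tail u} = emeasure mu {t..}"
      by (intro emeasure_eq_AE) auto
    with 2 show ?thesis by (simp add: emeasure_atLeast)
  next
    case 3
    have "eventually (\<lambda>n. tail (real n) < y) sequentially"
      using order_tendstoD(2)[OF tail_tendsto_0] 3 by auto
    moreover have "eventually (\<lambda>n. t \<le> real n) sequentially"
      using eventually_ge_at_top[of "nat \<lceil>t\<rceil>"] by eventually_elim linarith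
    ultimately obtain n where n: "tail (real n) < y" "t \<le> real n"
      using eventually_happens'[OF sequentially_bot eventually_conj] by blast
    have "continuous_on {t..real n} tail" by (rule continuous_on_subset[OF tail_continuous]) (use t in auto)
    then obtain m where m: "t \<le> m" "tail m = y"
      using IVT2'[of tail "real n" y t] n 3 by auto
    have "tail u > y \<longleftrightarrow> u < m" if "t \<le> u" for u
    proof
      assume "u < m"
      moreover have "x m > 0" using tail_pos_imp_x_pos[of m] m 3 t by simp
      ultimately have "0 < x m * (m - u)" by simp
      also have "\<dots> \<le> tail u - tail m" using that t \<open>u < m\<close> by (intro tail_diff_ge) auto
      finally show "tail u > y" using m by simp
    next
      assume "tail u > y" then show "u < m" using tail_anti[of m u] m by (auto simp: not_less[symmetric])
    qed
    then have "{u. t \<le> u \<and> y < tail u} = {t..<m}" by auto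
    then show ?thesis using tail_diff[OF m(1)] m 3 by (simp add: emeasure_eq_measure)
  next
    case 4
    have E: "{u. t \<le> u \<and> y < tail u} = {}" using 4 tail_anti[of t] by (auto simp: not_less intro: order.trans)
    show ?thesis unfolding E using 4 by (simp add: ennreal_neg)
  qed
qed

text \<open>
  The substitution \<open>y = tail u\<close> as an identity of measures, which copes with the jumps of the path.
\<close>

lemma distr_tail:
  assumes t: "0 \<le> t"
  shows "distr (density mu (indicator {t..})) borel tail = density lborel (indicator {0<..tail t})"
proof (rule measure_eqI_lessThan)
  fix y :: real
  have "{t..} \<inter> tail -` {y<..} = {u. t \<le> u \<and> y < tail u}" by auto
  moreover have "emeasure (distr (density mu (indicator {t..})) borel tail) {y<..}
     = emeasure mu ({t..} \<inter> tail -` {y<..})"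
    using measurable_sets_borel[OF tail_measurable, of "{y<..}"]
    by (subst emeasure_distr) (auto simp: emeasure_restricted)
  ultimately have 1: "emeasure (distr (density mu (indicator {t..})) borel tail) {y<..}
     = ennreal (if y < 0 then tail t else tail t - y)" using emeasure_tail_greater[OF t] by simp
  have "emeasure (density lborel (indicator {0<..tail t})) {y<..} = emeasure lborel ({0<..tail t} \<inter> {y<..})"
    by (rule emeasure_restricted) auto
  also have "{0<..tail t} \<inter> {y<..} = {max 0 y<..tail t}" by auto
  also have "emeasure lborel \<dots> = ennreal (if y < 0 then tail t else tail t - y)"
    using tail_nonneg[of t] by (cases "max 0 y \<le> tail t") (auto simp: max_def ennreal_neg split: if_splits)
  finally show "emeasure (distr (density mu (indicator {t..})) borel tail) {y<..}
     = emeasure (density lborel (indicator {0<..tail t})) {y<..}" using 1 by simp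
  show "emeasure (distr (density mu (indicator {t..})) borel tail) {y<..} < \<infinity>" using 1 by simp
qed auto

theorem tail_powr:
  assumes t: "0 \<le> t" and s: "0 < s"
  shows "ennreal (tail t powr s) = (\<integral>\<^sup>+u. ennreal s * (ennreal (x u) * ennreal (tail u powr (s - 1))) * indicator {t..} u \<partial>lborel)"
proof -
  have "(\<integral>\<^sup>+u. ennreal s * (ennreal (x u) * ennreal (tail u powr (s - 1))) * indicator {t..} u \<partial>lborel)
    = (\<integral>\<^sup>+u. ennreal s * ennreal (tail u powr (s - 1)) \<partial>density mu (indicator {t..}))"
    unfolding mu_def
    by (subst nn_integral_density, simp, measurable)
       (subst nn_integral_density, auto simp: mult_ac)
  also have "\<dots> = (\<integral>\<^sup>+y. ennreal s * ennreal (y powr (s - 1)) \<partial>distr (density mu (indicator {t..})) borel tail)"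
    by (subst nn_integral_distr) auto
  also have "\<dots> = (\<integral>\<^sup>+y. ennreal (s * y powr (s - 1)) * indicator {0<..tail t} y \<partial>lborel)"
    unfolding distr_tail[OF t] using s
    by (subst nn_integral_density) (auto simp: mult_ac ennreal_mult)
  also have "\<dots> = (\<integral>\<^sup>+y. ennreal (s * y powr (s - 1)) * indicator {0..tail t} y \<partial>lborel)"
    by (intro nn_integral_cong) (auto split: split_indicator)
  also have "\<dots> = ennreal (s * (tail t powr (s - 1 + 1) / (s - 1 + 1)))"
    using s tail_nonneg[of t]
    by (intro nn_integral_has_integral_lebesgue' has_integral_mult_right has_integral_powr_from_0) auto
  finally show ?thesis using s by simp
qed

end

section \<open>Logarithmic convexity of integrals\<close>

text \<open>
  Hoelder's inequality, in the form that mixtures of log-convex functions are log-convex. It follows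
  from Young's inequality after normalizing both integrals to \<open>1\<close>.
\<close>

lemma log_convex_integral:
  fixes u :: "real \<Rightarrow> 'a \<Rightarrow> real"
  assumes int: "\<And>s. s > 0 \<Longrightarrow> integrable K (u s)"
    and pos: "\<And>s. s > 0 \<Longrightarrow> 0 < (\<integral>\<omega>. u s \<omega> \<partial>K)"
    and nonneg: "\<And>s. s > 0 \<Longrightarrow> AE \<omega> in K. 0 \<le> u s \<omega>"
    and log_convex: "\<And>a b \<theta>. 0 < a \<Longrightarrow> 0 < b \<Longrightarrow> 0 < \<theta> \<Longrightarrow> \<theta> < 1 \<Longrightarrow>
       AE \<omega> in K. u ((1 - \<theta>) * a + \<theta> * b) \<omega> \<le> u a \<omega> powr (1 - \<theta>) * u b \<omega> powr \<theta>"
  shows "convex_on {0<..} (\<lambda>s. ln (\<integral>\<omega>. u s \<omega> \<partial>K))"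
proof (rule convex_onI)
  fix \<theta> a b :: real
  assume \<theta>: "0 < \<theta>" "\<theta> < 1" and ab: "a \<in> {0<..}" "b \<in> {0<..}"
  define A where "A = (\<integral>\<omega>. u a \<omega> \<partial>K)"
  define B where "B = (\<integral>\<omega>. u b \<omega> \<partial>K)"
  have A: "A > 0" and B: "B > 0" using pos ab by (auto simp: A_def B_def)
  define c where "c = (1 - \<theta>) * a + \<theta> * b"
  have c: "c > 0" using \<theta> ab by (auto simp: c_def intro!: add_pos_pos)
  have "(\<integral>\<omega>. u c \<omega> \<partial>K) \<le> (\<integral>\<omega>. A powr (1 - \<theta>) * B powr \<theta> * ((1 - \<theta>) / A * u a \<omega> + \<theta> / B * u b \<omega>) \<partial>K)"
  proof (rule integral_mono_AE)
    have "AE \<omega> in K. u c \<omega> \<le> u a \<omega> powr (1 - \<theta>) * u b \<omega> powr \<theta>"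
      unfolding c_def using ab \<theta> by (intro log_convex) auto
    moreover have "AE \<omega> in K. 0 \<le> u a \<omega>" "AE \<omega> in K. 0 \<le> u b \<omega>" using nonneg ab by auto
    ultimately show "AE \<omega> in K. u c \<omega> \<le> A powr (1 - \<theta>) * B powr \<theta> * ((1 - \<theta>) / A * u a \<omega> + \<theta> / B * u b \<omega>)"
    proof eventually_elim
      case (elim \<omega>)
      have "u a \<omega> powr (1 - \<theta>) * u b \<omega> powr \<theta>
          = A powr (1 - \<theta>) * B powr \<theta> * ((u a \<omega> / A) powr (1 - \<theta>) * (u b \<omega> / B) powr \<theta>)"
        using A B by (simp add: powr_divide)
      also have "\<dots> \<le> A powr (1 - \<theta>) * B powr \<theta> * ((1 - \<theta>) * (u a \<omega> / A) + \<theta> * (u b \<omega> / B))"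
      proof (rule mult_left_mono)
        show "(u a \<omega> / A) powr (1 - \<theta>) * (u b \<omega> / B) powr \<theta> \<le> (1 - \<theta>) * (u a \<omega> / A) + \<theta> * (u b \<omega> / B)"
        proof (cases "u a \<omega> = 0 \<or> u b \<omega> = 0")
          case True
          then show ?thesis using elim A B \<theta> by auto
        next
          case False
          then show ?thesis using elim A B \<theta> by (intro Youngs_inequality_0) auto
        qed
      qed simp
      finally show ?case using elim by simp
    qed
  qed (use ab c int in auto)
  also have "\<dots> = A powr (1 - \<theta>) * B powr \<theta> * ((1 - \<theta>) / A * A + \<theta> / B * B)"
    using ab int by (simp add: A_def B_def)
  also have "\<dots> = A powr (1 - \<theta>) * B powr \<theta>" using A B by simp
  finally have "ln (\<integral>\<omega>. u c \<omega> \<partial>K) \<le> ln (A powr (1 - \<theta>) * B powr \<theta>)"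
    using pos[OF c] by (intro ln_mono) auto
  also have "\<dots> = (1 - \<theta>) * ln A + \<theta> * ln B" using A B by (simp add: ln_mult ln_powr)
  finally show "ln (\<integral>\<omega>. u ((1 - \<theta>) *\<^sub>R a + \<theta> *\<^sub>R b) \<omega> \<partial>K)
      \<le> (1 - \<theta>) * ln (\<integral>\<omega>. u a \<omega> \<partial>K) + \<theta> * ln (\<integral>\<omega>. u b \<omega> \<partial>K)"
    by (simp add: A_def B_def c_def)
qed simp

section \<open>Moments of the integral of a multiplicative process\<close>

lemma moment_determinacy_nonneg:
  fixes A B :: "real measure"
  assumes setsA: "sets A = sets borel" and setsB: "sets B = sets borel"
    and posA: "AE x in A. 0 \<le> x" and posB: "AE x in B. 0 \<le> x"
    and mA: "\<And>n. (\<integral>\<^sup>+x. ennreal (x ^ n) \<partial>A) = ennreal (m n)"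
    and mB: "\<And>n. (\<integral>\<^sup>+x. ennreal (x ^ n) \<partial>B) = ennreal (m n)"
    and m: "\<And>n. 0 \<le> m n" and bd: "\<And>n. m n \<le> K * C ^ n * fact n" and C: "C > 0"
  shows "A = B"
proof -
  have *: "finite_measure D \<and> integrable D (\<lambda>x. x ^ n) \<and> (\<integral>x. x ^ n \<partial>D) = m n \<and> (\<integral>x. \<bar>x\<bar> ^ n \<partial>D) = m n"
    if sets: "sets D = sets borel" and pos: "AE x in D. 0 \<le> x"
      and mD: "\<And>n. (\<integral>\<^sup>+x. ennreal (x ^ n) \<partial>D) = ennreal (m n)" for D :: "real measure" and n
  proof -
    have [measurable_cong]: "sets D = sets borel" by fact
    have fin: "finite_measure D"
      using mD[of 0] by (intro finite_measureI) simp
    have pos': "AE x in D. 0 \<le> x ^ n" using pos by eventually_elim simp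
    have int: "integrable D (\<lambda>x. x ^ n)"
      using pos' mD[of n] by (intro integrableI_nonneg) auto
    have eq: "(\<integral>x. x ^ n \<partial>D) = m n"
      using pos' mD[of n] m[of n] by (subst integral_eq_nn_integral) auto
    have "(\<integral>x. \<bar>x\<bar> ^ n \<partial>D) = (\<integral>x. x ^ n \<partial>D)"
      using pos by (intro integral_cong_AE) auto
    with fin int eq show ?thesis by simp
  qed
  show ?thesis
    using *[OF setsA posA mA] *[OF setsB posB mB] bd
    by (intro moment_determinacy[of A B K C] setsA setsB C) auto
qed

lemma nn_integral_exp_tail:
  fixes a t :: real assumes "a > 0"
  shows "(\<integral>\<^sup>+u. ennreal (exp (- ((u - t) * a))) * indicator {t..} u \<partial>lborel) = ennreal (1 / a)"
proof -
  have "((\<lambda>u. exp (a * t) * exp (- a * u)) has_integral exp (a * t) * (exp (- a * t) / a)) {t..}"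
    by (intro has_integral_mult_right has_integral_exp_minus_to_infinity assms)
  moreover have "exp (a * t) * exp (- a * u) = exp (- ((u - t) * a))" for u
    by (simp add: exp_add[symmetric] algebra_simps)
  moreover have "exp (a * t) * (exp (- a * t) / a) = 1 / a"
    by (simp add: exp_minus)
  ultimately have "((\<lambda>u. exp (- ((u - t) * a))) has_integral 1 / a) {t..}" by simp
  then show ?thesis by (intro nn_integral_has_integral_lebesgue') auto
qed

lemma tilt_power:
  fixes x y s :: real
  assumes "0 \<le> x" "0 \<le> y"
  shows "ennreal (x powr s) * ennreal ((y / x) ^ n) = ennreal (x powr (s - real n)) * ennreal (y ^ n)"
proof (cases "x = 0")
  case False
  then have "x powr (s - real n) = x powr s / x ^ n" using assms by (simp add: powr_diff powr_realpow)
  then have "x powr s * (y / x) ^ n = x powr (s - real n) * y ^ n" by (simp add: power_divide)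
  then show ?thesis using assms by (subst (1 2) ennreal_mult[symmetric]) auto
qed simp

lemma tilt_powr:
  fixes x y s :: real
  assumes "0 \<le> x" "0 \<le> y"
  shows "ennreal (x powr s) * ennreal ((y / x) powr (s - 1)) = ennreal x * ennreal (y powr (s - 1))"
proof (cases "x = 0")
  case False
  then have x: "0 < x" using assms by simp
  have "x powr s * (y / x) powr (s - 1) = x powr s * (y powr (s - 1) / x powr (s - 1))"
    by (simp only: powr_divide)
  also have "\<dots> = (x powr s / x powr (s - 1)) * y powr (s - 1)" by simp
  also have "x powr s / x powr (s - 1) = x powr (s - (s - 1))" by (rule powr_diff[symmetric])
  also have "\<dots> = x" using x by simp
  finally show ?thesis using assms by (subst (1 2) ennreal_mult[symmetric]) auto
qed simp

text \<open>
  The abstract setting covers both the exponential of a subordinator and its version stopped at an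
  independent time under a changed measure. \<open>W t\<close> is a class of nonnegative weights that are known
  at time \<open>t\<close>. It is abstract because for the stopped process the natural weights carry the indicator
  of survival up to \<open>t\<close> and do not form all measurable functions of a sigma-algebra. Since
  \<open>0 powr r = 0\<close>, the weight \<open>X t powr r\<close> with \<open>r \<le> 0\<close> includes the
  indicator of survival, so negative powers are harmless.
\<close>

locale multiplicative_process = prob_space Q
  for Q :: "'a measure" and X :: "real \<Rightarrow> 'a \<Rightarrow> real"
    and W :: "real \<Rightarrow> ('a \<Rightarrow> ennreal) set" and psi :: "real \<Rightarrow> real" +
  assumes X_joint [measurable]: "(\<lambda>p. X (fst p) (snd p)) \<in> borel_measurable (borel \<Otimes>\<^sub>M Q)"
    and X_nonneg: "\<And>t \<omega>. \<omega> \<in> space Q \<Longrightarrow> 0 \<le> X t \<omega>"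
    and X_zero: "\<And>t \<omega>. \<omega> \<in> space Q \<Longrightarrow> t < 0 \<Longrightarrow> X t \<omega> = 0"
    and X_anti: "\<And>t u \<omega>. \<omega> \<in> space Q \<Longrightarrow> 0 \<le> t \<Longrightarrow> t \<le> u \<Longrightarrow> X u \<omega> \<le> X t \<omega>"
    and X_rc: "\<And>t \<omega>. \<omega> \<in> space Q \<Longrightarrow> 0 \<le> t \<Longrightarrow> continuous (at_right t) (\<lambda>u. X u \<omega>)"
    and X_start: "AE \<omega> in Q. X 0 \<omega> = 1"
    and W_measurable: "\<And>t w. 0 \<le> t \<Longrightarrow> w \<in> W t \<Longrightarrow> w \<in> borel_measurable Q"
    and W_mult: "\<And>t u w. 0 \<le> t \<Longrightarrow> t \<le> u \<Longrightarrow> w \<in> W t \<Longrightarrow> (\<lambda>\<omega>. w \<omega> * ennreal (X u \<omega>)) \<in> W u"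
    and W_powr: "\<And>t r. 0 \<le> t \<Longrightarrow> (\<lambda>\<omega>. ennreal (X t \<omega> powr r)) \<in> W t"
    and X_evolution: "\<And>t h p w. 0 \<le> t \<Longrightarrow> 0 \<le> h \<Longrightarrow> 0 < p \<Longrightarrow> w \<in> W t \<Longrightarrow>
      (\<integral>\<^sup>+\<omega>. w \<omega> * ennreal (X (t + h) \<omega> powr p) \<partial>Q)
      = ennreal (exp (- (h * psi p))) * (\<integral>\<^sup>+\<omega>. w \<omega> * ennreal (X t \<omega> powr p) \<partial>Q)"
    and psi_pos: "\<And>p. 0 < p \<Longrightarrow> 0 < psi p"
    and psi_ge: "\<And>p. 1 \<le> p \<Longrightarrow> psi 1 \<le> psi p"
begin

definition J :: "real \<Rightarrow> 'a \<Rightarrow> real" where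
  "J t \<omega> = enn2real (\<integral>\<^sup>+u. ennreal (X u \<omega>) * indicator {t..} u \<partial>lborel)"

lemma X_measurable [measurable]: "X t \<in> borel_measurable Q"
proof -
  have "(\<lambda>\<omega>. X (fst (t, \<omega>)) (snd (t, \<omega>))) \<in> borel_measurable Q"
    by measurable
  then show ?thesis by simp
qed

lemma X_measurable_path [measurable]: "\<omega> \<in> space Q \<Longrightarrow> (\<lambda>u. X u \<omega>) \<in> borel_measurable borel"
proof -
  assume "\<omega> \<in> space Q"
  then have "(\<lambda>u. X (fst (u, \<omega>)) (snd (u, \<omega>))) \<in> borel_measurable borel"
    by measurable
  then show ?thesis by simp
qed

lemma J_joint [measurable]: "(\<lambda>p. J (fst p) (snd p)) \<in> borel_measurable (borel \<Otimes>\<^sub>M Q)"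
proof -
  have *: "(\<lambda>p. ennreal (X (snd p) (snd (fst p))) * (if fst (fst p) \<le> snd p then 1 else 0))
      \<in> borel_measurable ((borel \<Otimes>\<^sub>M Q) \<Otimes>\<^sub>M lborel)"
  proof -
    have "(\<lambda>p. X (fst (snd p, snd (fst p))) (snd (snd p, snd (fst p)))) \<in> borel_measurable ((borel \<Otimes>\<^sub>M Q) \<Otimes>\<^sub>M lborel)"
      by (rule measurable_compose[OF _ X_joint]) measurable
    then have [measurable]: "(\<lambda>p. X (snd p) (snd (fst p))) \<in> borel_measurable ((borel \<Otimes>\<^sub>M Q) \<Otimes>\<^sub>M lborel)"
      by simp
    show ?thesis by measurable
  qed
  have "J (fst p) (snd p) = enn2real (\<integral>\<^sup>+u. ennreal (X u (snd p)) * (if fst p \<le> u then 1 else 0) \<partial>lborel)" for p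
    unfolding J_def by (intro arg_cong[where f=enn2real] nn_integral_cong) (auto split: split_indicator)
  moreover have "(\<lambda>p. \<integral>\<^sup>+u. ennreal (X u (snd p)) * (if fst p \<le> u then 1 else 0) \<partial>lborel) \<in> borel_measurable (borel \<Otimes>\<^sub>M Q)"
    using lborel.borel_measurable_nn_integral_fst[OF *] by simp
  ultimately show ?thesis by simp
qed

lemma J_measurable [measurable]: "J t \<in> borel_measurable Q"
proof -
  have "(\<lambda>\<omega>. J (fst (t, \<omega>)) (snd (t, \<omega>))) \<in> borel_measurable Q"
    by measurable
  then show ?thesis by simp
qed

lemma J_nonneg [simp]: "0 \<le> J t \<omega>" by (simp add: J_def)

lemma nn_integral_X:
  assumes u: "0 \<le> u" and p: "0 < p"
  shows "(\<integral>\<^sup>+\<omega>. ennreal (X u \<omega> powr p) \<partial>Q) = ennreal (exp (- (u * psi p)))"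
proof -
  \<comment> \<open>The weight \<open>X 0 powr 0\<close> is almost surely \<open>1\<close> and, unlike the constant \<open>1\<close>, known to belong to \<open>W 0\<close>.\<close>
  have "(\<integral>\<^sup>+\<omega>. ennreal (X u \<omega> powr p) \<partial>Q) = (\<integral>\<^sup>+\<omega>. ennreal (X 0 \<omega> powr 0) * ennreal (X (0 + u) \<omega> powr p) \<partial>Q)"
    using X_start by (intro nn_integral_cong_AE) auto
  also have "\<dots> = ennreal (exp (- (u * psi p))) * (\<integral>\<^sup>+\<omega>. ennreal (X 0 \<omega> powr 0) * ennreal (X 0 \<omega> powr p) \<partial>Q)"
    using u p by (intro X_evolution W_powr) auto
  also have "(\<integral>\<^sup>+\<omega>. ennreal (X 0 \<omega> powr 0) * ennreal (X 0 \<omega> powr p) \<partial>Q) = (\<integral>\<^sup>+\<omega>. 1 \<partial>Q)"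
    using X_start by (intro nn_integral_cong_AE) auto
  finally show ?thesis by (simp add: emeasure_space_1)
qed

text \<open>
  The expected integral is \<open>1 / psi 1\<close>.
\<close>

lemma path_integrable: "AE \<omega> in Q. (\<integral>\<^sup>+u. ennreal (X u \<omega>) \<partial>lborel) < \<infinity>"
proof -
  interpret pair_sigma_finite lborel Q ..
  have [measurable]: "(\<lambda>p. ennreal (X (fst p) (snd p))) \<in> borel_measurable (lborel \<Otimes>\<^sub>M Q)"
    using X_joint by simp
  have "(\<integral>\<^sup>+\<omega>. \<integral>\<^sup>+u. ennreal (X u \<omega>) \<partial>lborel \<partial>Q) = (\<integral>\<^sup>+u. \<integral>\<^sup>+\<omega>. ennreal (X u \<omega>) \<partial>Q \<partial>lborel)"
    by (rule Fubini') (simp only: split_beta', measurable)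
  also have "\<dots> = (\<integral>\<^sup>+u. ennreal (exp (- ((u - 0) * psi 1))) * indicator {0..} u \<partial>lborel)"
  proof (intro nn_integral_cong)
    fix u :: real
    show "(\<integral>\<^sup>+\<omega>. ennreal (X u \<omega>) \<partial>Q) = ennreal (exp (- ((u - 0) * psi 1))) * indicator {0..} u"
    proof (cases "0 \<le> u")
      case True
      then have "(\<integral>\<^sup>+\<omega>. ennreal (X u \<omega>) \<partial>Q) = (\<integral>\<^sup>+\<omega>. ennreal (X u \<omega> powr 1) \<partial>Q)"
        by (intro nn_integral_cong) (simp add: X_nonneg)
      also have "\<dots> = ennreal (exp (- (u * psi 1)))"
        using True by (rule nn_integral_X) simp
      finally show ?thesis using True by simp
    next
      case False
      then have "(\<integral>\<^sup>+\<omega>. ennreal (X u \<omega>) \<partial>Q) = (\<integral>\<^sup>+\<omega>. 0 \<partial>Q)"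
        by (intro nn_integral_cong) (simp add: X_zero)
      with False show ?thesis by simp
    qed
  qed
  also have "\<dots> = ennreal (1 / psi 1)"
    by (rule nn_integral_exp_tail) (simp add: psi_pos)
  finally have fin: "(\<integral>\<^sup>+\<omega>. \<integral>\<^sup>+u. ennreal (X u \<omega>) \<partial>lborel \<partial>Q) \<noteq> \<infinity>" by simp
  have "(\<lambda>p. X (fst (snd p, fst p)) (snd (snd p, fst p))) \<in> borel_measurable (Q \<Otimes>\<^sub>M lborel)"
    by (rule measurable_compose[OF _ X_joint]) measurable
  then have "(\<lambda>(\<omega>, u). ennreal (X u \<omega>)) \<in> borel_measurable (Q \<Otimes>\<^sub>M lborel)"
    by (simp add: split_beta')
  then have "(\<lambda>\<omega>. \<integral>\<^sup>+u. ennreal (X u \<omega>) \<partial>lborel) \<in> borel_measurable Q"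
    by (rule lborel.borel_measurable_nn_integral)
  from nn_integral_PInf_AE[OF this fin] show ?thesis
    by eventually_elim (simp add: less_top)
qed

lemma path_J:
  assumes \<omega>: "\<omega> \<in> space Q" and fin: "(\<integral>\<^sup>+u. ennreal (X u \<omega>) \<partial>lborel) < \<infinity>"
  shows "decreasing_path (\<lambda>u. X u \<omega>)" and "J t \<omega> = decreasing_path.tail (\<lambda>u. X u \<omega>) t"
proof -
  interpret decreasing_path "\<lambda>u. X u \<omega>"
    using \<omega> fin by unfold_locales (auto simp: X_nonneg X_zero X_anti X_rc)
  show "decreasing_path (\<lambda>u. X u \<omega>)" ..
  show "J t \<omega> = decreasing_path.tail (\<lambda>u. X u \<omega>) t"
    using \<omega> by (simp add: J_def tail_def measure_def mu_def emeasure_density)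
qed

lemma AE_J:
  "AE \<omega> in Q. (\<forall>t\<ge>0. 0 < X t \<omega> \<longrightarrow> 0 < J t \<omega>) \<and> (\<forall>t\<ge>0. X t \<omega> = 0 \<longrightarrow> J t \<omega> = 0) \<and>
    (\<forall>t\<ge>0. \<forall>s>0. ennreal (J t \<omega> powr s) =
      (\<integral>\<^sup>+u. ennreal s * (ennreal (X u \<omega>) * ennreal (J u \<omega> powr (s - 1))) * indicator {t..} u \<partial>lborel))"
  using path_integrable AE_space
proof eventually_elim
  case (elim \<omega>)
  interpret P: decreasing_path "\<lambda>u. X u \<omega>" using path_J[OF elim(2,1)] by simp
  have J: "J t \<omega> = P.tail t" for t using path_J[OF elim(2,1)] by simp
  show ?case
    unfolding J
  proof (intro conjI allI impI)
    show "0 < P.tail t" if "0 \<le> t" "0 < X t \<omega>" for t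
      using that by (rule P.x_pos_imp_tail_pos)
    show "P.tail t = 0" if "0 \<le> t" "X t \<omega> = 0" for t
      using P.tail_pos_imp_x_pos[OF that(1)] P.tail_nonneg[of t] that(2) by (cases "P.tail t = 0") auto
    show "ennreal (P.tail t powr s) =
      (\<integral>\<^sup>+u. ennreal s * (ennreal (X u \<omega>) * ennreal (P.tail u powr (s - 1))) * indicator {t..} u \<partial>lborel)"
      if "0 \<le> t" "0 < s" for t s
      using that by (rule P.tail_powr)
  qed
qed

lemma nn_integral_J_powr:
  assumes t: "0 \<le> t" and s: "0 < s" and w [measurable]: "w \<in> borel_measurable Q"
  shows "(\<integral>\<^sup>+\<omega>. w \<omega> * ennreal (J t \<omega> powr s) \<partial>Q)
    = (\<integral>\<^sup>+u. ennreal s * (\<integral>\<^sup>+\<omega>. w \<omega> * (ennreal (X u \<omega>) * ennreal (J u \<omega> powr (s - 1))) \<partial>Q) * indicator {t..} u \<partial>lborel)"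
proof -
  interpret pair_sigma_finite lborel Q ..
  let ?f = "\<lambda>u \<omega>. ennreal s * (w \<omega> * (ennreal (X u \<omega>) * ennreal (J u \<omega> powr (s - 1)))) * indicator {t..} u"
  have [measurable]: "(\<lambda>p. X (fst p) (snd p)) \<in> borel_measurable (lborel \<Otimes>\<^sub>M Q)"
    "(\<lambda>p. J (fst p) (snd p)) \<in> borel_measurable (lborel \<Otimes>\<^sub>M Q)"
    using X_joint J_joint by simp_all
  have [measurable]: "\<omega> \<in> space Q \<Longrightarrow> (\<lambda>u. J u \<omega>) \<in> borel_measurable borel" for \<omega>
    using measurable_compose[OF measurable_Pair2'[of \<omega> Q borel] J_joint] by (simp add: comp_def)
  have "(\<integral>\<^sup>+\<omega>. w \<omega> * ennreal (J t \<omega> powr s) \<partial>Q) = (\<integral>\<^sup>+\<omega>. \<integral>\<^sup>+u. ?f u \<omega> \<partial>lborel \<partial>Q)"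
  proof (rule nn_integral_cong_AE)
    show "AE \<omega> in Q. w \<omega> * ennreal (J t \<omega> powr s) = (\<integral>\<^sup>+u. ?f u \<omega> \<partial>lborel)"
      using AE_J AE_space
    proof eventually_elim
      case (elim \<omega>)
      have [measurable]: "\<omega> \<in> space Q" by fact
      have "ennreal (J t \<omega> powr s) = (\<integral>\<^sup>+u. ennreal s * (ennreal (X u \<omega>) * ennreal (J u \<omega> powr (s - 1))) * indicator {t..} u \<partial>lborel)"
        using elim(1) t s by blast
      then have "w \<omega> * ennreal (J t \<omega> powr s) =
        w \<omega> * (\<integral>\<^sup>+u. ennreal s * (ennreal (X u \<omega>) * ennreal (J u \<omega> powr (s - 1))) * indicator {t..} u \<partial>lborel)"
        by (rule arg_cong)
      also have "\<dots> = (\<integral>\<^sup>+u. w \<omega> * (ennreal s * (ennreal (X u \<omega>) * ennreal (J u \<omega> powr (s - 1))) * indicator {t..} u) \<partial>lborel)"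
        by (rule nn_integral_cmult[symmetric]) measurable
      finally show ?case by (simp add: mult_ac)
    qed
  qed
  also have "\<dots> = (\<integral>\<^sup>+u. \<integral>\<^sup>+\<omega>. ?f u \<omega> \<partial>Q \<partial>lborel)"
    by (rule Fubini') (simp only: split_beta', measurable)
  also have "\<dots> = (\<integral>\<^sup>+u. ennreal s * (\<integral>\<^sup>+\<omega>. w \<omega> * (ennreal (X u \<omega>) * ennreal (J u \<omega> powr (s - 1))) \<partial>Q) * indicator {t..} u \<partial>lborel)"
    by (intro nn_integral_cong) (simp add: nn_integral_cmult nn_integral_multc)
  finally show ?thesis .
qed

definition moment :: "nat \<Rightarrow> real" where "moment n = fact n / (\<Prod>i=1..n. psi (real i))"

lemma moment_nonneg: "0 \<le> moment n"
  unfolding moment_def using psi_pos by (auto intro!: divide_nonneg_pos prod_pos)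

lemma moment_Suc: "moment (Suc n) = real (Suc n) / psi (real (Suc n)) * moment n"
  by (simp add: moment_def)

lemma moment_le: "moment n \<le> 1 * (1 / psi 1) ^ n * fact n"
proof -
  have "psi 1 ^ n = (\<Prod>i=1..n. psi 1)" by simp
  also have "\<dots> \<le> (\<Prod>i=1..n. psi (real i))"
    using psi_pos[of 1] psi_ge by (intro prod_mono) auto
  finally have le: "psi 1 ^ n \<le> (\<Prod>i=1..n. psi (real i))" .
  have "moment n \<le> fact n / psi 1 ^ n"
    unfolding moment_def using psi_pos[of 1] le by (intro frac_le) auto
  then show ?thesis by (simp add: power_divide)
qed

text \<open>
  Expand one factor of \<open>J t ^ (n + 1)\<close> by the tail identity, apply the induction hypothesis at the
  later time \<open>u\<close> to the enlarged weight \<open>w * X u\<close>, and integrate the exponential decay of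
  \<open>E (w * X u ^ (n + 1))\<close> over \<open>u \<ge> t\<close>. Natural powers with \<open>0 ^ 0 = 1\<close> make the base case
  trivial.
\<close>

lemma moments:
  assumes "0 \<le> t" "w \<in> W t"
  shows "(\<integral>\<^sup>+\<omega>. w \<omega> * ennreal (J t \<omega> ^ n) \<partial>Q) = ennreal (moment n) * (\<integral>\<^sup>+\<omega>. w \<omega> * ennreal (X t \<omega> ^ n) \<partial>Q)"
  using assms
proof (induction n arbitrary: t w)
  case 0
  then show ?case by (simp add: moment_def)
next
  case (Suc n)
  note t = Suc.prems(1)
  note [measurable] = W_measurable[OF Suc.prems]
  define E where "E = (\<integral>\<^sup>+\<omega>. w \<omega> * ennreal (X t \<omega> ^ Suc n) \<partial>Q)"
  have E_powr: "(\<integral>\<^sup>+\<omega>. w \<omega> * ennreal (X u \<omega> ^ Suc n) \<partial>Q) = (\<integral>\<^sup>+\<omega>. w \<omega> * ennreal (X u \<omega> powr real (Suc n)) \<partial>Q)" for u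
    by (intro nn_integral_cong) (simp add: powr_realpow' X_nonneg del: of_nat_Suc power_Suc)
  have "(\<integral>\<^sup>+\<omega>. w \<omega> * ennreal (J t \<omega> ^ Suc n) \<partial>Q) = (\<integral>\<^sup>+\<omega>. w \<omega> * ennreal (J t \<omega> powr real (Suc n)) \<partial>Q)"
    by (intro nn_integral_cong) (simp add: powr_realpow' del: of_nat_Suc power_Suc)
  also have "\<dots> = (\<integral>\<^sup>+u. ennreal (real (Suc n)) * (\<integral>\<^sup>+\<omega>. w \<omega> * (ennreal (X u \<omega>) * ennreal (J u \<omega> powr (real (Suc n) - 1))) \<partial>Q) * indicator {t..} u \<partial>lborel)"
    using t by (intro nn_integral_J_powr) auto
  also have "\<dots> = (\<integral>\<^sup>+u. ennreal (real (Suc n)) * ennreal (moment n) * E * (ennreal (exp (- ((u - t) * psi (real (Suc n))))) * indicator {t..} u) \<partial>lborel)"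
  proof (intro nn_integral_cong)
    fix u :: real
    show "ennreal (real (Suc n)) * (\<integral>\<^sup>+\<omega>. w \<omega> * (ennreal (X u \<omega>) * ennreal (J u \<omega> powr (real (Suc n) - 1))) \<partial>Q) * indicator {t..} u
      = ennreal (real (Suc n)) * ennreal (moment n) * E * (ennreal (exp (- ((u - t) * psi (real (Suc n))))) * indicator {t..} u)"
    proof (cases "t \<le> u")
      case True
      have "(\<integral>\<^sup>+\<omega>. w \<omega> * (ennreal (X u \<omega>) * ennreal (J u \<omega> powr (real (Suc n) - 1))) \<partial>Q)
        = (\<integral>\<^sup>+\<omega>. (w \<omega> * ennreal (X u \<omega>)) * ennreal (J u \<omega> ^ n) \<partial>Q)"
      proof (rule nn_integral_cong_AE)
        show "AE \<omega> in Q. w \<omega> * (ennreal (X u \<omega>) * ennreal (J u \<omega> powr (real (Suc n) - 1)))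
            = (w \<omega> * ennreal (X u \<omega>)) * ennreal (J u \<omega> ^ n)"
          using AE_J AE_space
        proof eventually_elim
          case (elim \<omega>)
          show ?case
          proof (cases "X u \<omega> = 0")
            case False
            then have "0 < X u \<omega>" "0 \<le> u" using elim(2) t True X_nonneg[of \<omega> u] by auto
            then have "0 < J u \<omega>" using elim(1) by blast
            then show ?thesis by (simp add: powr_realpow mult_ac)
          qed simp
        qed
      qed
      also have "\<dots> = ennreal (moment n) * (\<integral>\<^sup>+\<omega>. (w \<omega> * ennreal (X u \<omega>)) * ennreal (X u \<omega> ^ n) \<partial>Q)"
        using Suc.prems True by (intro Suc.IH W_mult[of t]) auto
      also have "(\<integral>\<^sup>+\<omega>. (w \<omega> * ennreal (X u \<omega>)) * ennreal (X u \<omega> ^ n) \<partial>Q) = (\<integral>\<^sup>+\<omega>. w \<omega> * ennreal (X u \<omega> ^ Suc n) \<partial>Q)"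
        by (intro nn_integral_cong) (simp add: ennreal_mult X_nonneg mult_ac)
      also have "\<dots> = (\<integral>\<^sup>+\<omega>. w \<omega> * ennreal (X (t + (u - t)) \<omega> powr real (Suc n)) \<partial>Q)"
        using E_powr[of u] by simp
      also have "\<dots> = ennreal (exp (- ((u - t) * psi (real (Suc n))))) * E"
        unfolding E_def E_powr using Suc.prems True by (intro X_evolution) auto
      finally show ?thesis using True by (simp add: mult_ac)
    qed simp
  qed
  also have "\<dots> = ennreal (real (Suc n)) * ennreal (moment n) * E * ennreal (1 / psi (real (Suc n)))"
    by (subst nn_integral_cmult) (simp_all add: nn_integral_exp_tail psi_pos del: of_nat_Suc)
  also have "\<dots> = ennreal (moment (Suc n)) * E"
    using psi_pos[of "real (Suc n)"] moment_nonneg[of n]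
    by (simp add: moment_Suc ennreal_mult[symmetric] mult_ac del: of_nat_Suc)
  finally show ?case unfolding E_def .
qed

lemma J_0_moments: "(\<integral>\<^sup>+\<omega>. ennreal (J 0 \<omega> ^ n) \<partial>Q) = ennreal (moment n)"
proof -
  have "(\<integral>\<^sup>+\<omega>. ennreal (J 0 \<omega> ^ n) \<partial>Q) = (\<integral>\<^sup>+\<omega>. ennreal (X 0 \<omega> powr 0) * ennreal (J 0 \<omega> ^ n) \<partial>Q)"
    using X_start by (intro nn_integral_cong_AE) auto
  also have "\<dots> = ennreal (moment n) * (\<integral>\<^sup>+\<omega>. ennreal (X 0 \<omega> powr 0) * ennreal (X 0 \<omega> ^ n) \<partial>Q)"
    by (intro moments W_powr) auto
  also have "(\<integral>\<^sup>+\<omega>. ennreal (X 0 \<omega> powr 0) * ennreal (X 0 \<omega> ^ n) \<partial>Q) = (\<integral>\<^sup>+\<omega>. 1 \<partial>Q)"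
    using X_start by (intro nn_integral_cong_AE) auto
  finally show ?thesis by (simp add: emeasure_space_1)
qed

text \<open>
  The independence of \<open>J t / X t\<close> and \<open>X t\<close> in the only form that is needed: changing the measure by
  a power of \<open>X t\<close> leaves the law of \<open>J t / X t\<close> equal to that of \<open>J 0\<close>, up to the mass. Both
  measures have the moments \<open>moment n\<close> times that mass.
\<close>

lemma tilted_law:
  assumes t: "0 \<le> t" and s: "0 < s"
  shows "distr (density Q (\<lambda>\<omega>. ennreal (X t \<omega> powr s))) borel (\<lambda>\<omega>. J t \<omega> / X t \<omega>)
       = distr (density Q (\<lambda>\<omega>. ennreal (exp (- (t * psi s))))) borel (J 0)" (is "?A = ?B")
proof (rule moment_determinacy_nonneg)
  fix n
  let ?e = "ennreal (exp (- (t * psi s)))"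
  have "(\<integral>\<^sup>+x. ennreal (x ^ n) \<partial>?A) = (\<integral>\<^sup>+\<omega>. ennreal (X t \<omega> powr s) * ennreal ((J t \<omega> / X t \<omega>) ^ n) \<partial>Q)"
    by (simp add: nn_integral_distr nn_integral_density)
  also have "\<dots> = (\<integral>\<^sup>+\<omega>. ennreal (X t \<omega> powr (s - n)) * ennreal (J t \<omega> ^ n) \<partial>Q)"
    by (intro nn_integral_cong tilt_power X_nonneg J_nonneg)
  also have "\<dots> = ennreal (moment n) * (\<integral>\<^sup>+\<omega>. ennreal (X t \<omega> powr (s - n)) * ennreal (X t \<omega> ^ n) \<partial>Q)"
    using t by (intro moments W_powr)
  also have "(\<integral>\<^sup>+\<omega>. ennreal (X t \<omega> powr (s - n)) * ennreal (X t \<omega> ^ n) \<partial>Q) = (\<integral>\<^sup>+\<omega>. ennreal (X t \<omega> powr s) \<partial>Q)"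
  proof (rule nn_integral_cong)
    fix \<omega> assume "\<omega> \<in> space Q"
    then have X: "0 \<le> X t \<omega>" by (rule X_nonneg)
    show "ennreal (X t \<omega> powr (s - n)) * ennreal (X t \<omega> ^ n) = ennreal (X t \<omega> powr s)"
      unfolding tilt_power[OF X X, symmetric] by (cases "X t \<omega> = 0") simp_all
  qed
  also have "\<dots> = ?e" using t s by (rule nn_integral_X)
  finally show "(\<integral>\<^sup>+x. ennreal (x ^ n) \<partial>?A) = ennreal (moment n * exp (- (t * psi s)))"
    by (simp add: ennreal_mult moment_nonneg)
  show "(\<integral>\<^sup>+x. ennreal (x ^ n) \<partial>?B) = ennreal (moment n * exp (- (t * psi s)))"
    by (simp add: nn_integral_distr nn_integral_density nn_integral_cmult J_0_moments)
       (simp add: ennreal_mult moment_nonneg mult.commute)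
  show "0 \<le> moment n * exp (- (t * psi s))" by (simp add: moment_nonneg)
  show "moment n * exp (- (t * psi s)) \<le> exp (- (t * psi s)) * (1 / psi 1) ^ n * fact n"
    using mult_right_mono[OF moment_le[of n], of "exp (- (t * psi s))"] by (simp add: mult_ac)
  show "0 < 1 / psi 1" using psi_pos[of 1] by simp
  show "AE x in ?A. 0 \<le> x"
    by (subst AE_distr_iff) (auto simp: AE_density intro!: AE_I2 X_nonneg divide_nonneg_nonneg)
  show "AE x in ?B. 0 \<le> x"
    by (subst AE_distr_iff) (auto simp: AE_density)
qed auto

text \<open>
  The integrand \<open>X u * J u powr (s - 1)\<close> equals
  \<open>X u powr s * (J u / X u) powr (s - 1)\<close>, whose expectation is given by \<open>tilted_law\<close>.
\<close>

lemma moment_recursion: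
  assumes s: "0 < s"
  shows "(\<integral>\<^sup>+\<omega>. ennreal (J 0 \<omega> powr s) \<partial>Q) = ennreal (s / psi s) * (\<integral>\<^sup>+\<omega>. ennreal (J 0 \<omega> powr (s - 1)) \<partial>Q)"
proof -
  define h where "h = (\<integral>\<^sup>+\<omega>. ennreal (J 0 \<omega> powr (s - 1)) \<partial>Q)"
  have "(\<integral>\<^sup>+\<omega>. ennreal (J 0 \<omega> powr s) \<partial>Q) = (\<integral>\<^sup>+\<omega>. 1 * ennreal (J 0 \<omega> powr s) \<partial>Q)" by simp
  also have "\<dots> = (\<integral>\<^sup>+u. ennreal s * (\<integral>\<^sup>+\<omega>. 1 * (ennreal (X u \<omega>) * ennreal (J u \<omega> powr (s - 1))) \<partial>Q) * indicator {0..} u \<partial>lborel)"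
    using s by (intro nn_integral_J_powr) auto
  also have "\<dots> = (\<integral>\<^sup>+u. ennreal s * h * (ennreal (exp (- ((u - 0) * psi s))) * indicator {0..} u) \<partial>lborel)"
  proof (intro nn_integral_cong)
    fix u :: real
    show "ennreal s * (\<integral>\<^sup>+\<omega>. 1 * (ennreal (X u \<omega>) * ennreal (J u \<omega> powr (s - 1))) \<partial>Q) * indicator {0..} u
      = ennreal s * h * (ennreal (exp (- ((u - 0) * psi s))) * indicator {0..} u)"
    proof (cases "0 \<le> u")
      case True
      have "(\<integral>\<^sup>+\<omega>. 1 * (ennreal (X u \<omega>) * ennreal (J u \<omega> powr (s - 1))) \<partial>Q)
        = (\<integral>\<^sup>+\<omega>. ennreal (X u \<omega> powr s) * ennreal ((J u \<omega> / X u \<omega>) powr (s - 1)) \<partial>Q)"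
        unfolding mult_1 by (intro nn_integral_cong tilt_powr[symmetric] X_nonneg J_nonneg)
      also have "\<dots> = (\<integral>\<^sup>+x. ennreal (x powr (s - 1)) \<partial>distr (density Q (\<lambda>\<omega>. ennreal (X u \<omega> powr s))) borel (\<lambda>\<omega>. J u \<omega> / X u \<omega>))"
        by (simp add: nn_integral_distr nn_integral_density)
      also have "\<dots> = ennreal (exp (- (u * psi s))) * h"
        unfolding tilted_law[OF True s]
        by (simp add: nn_integral_distr nn_integral_density nn_integral_cmult h_def)
      finally show ?thesis using True by (simp add: mult_ac)
    qed simp
  qed
  also have "\<dots> = ennreal s * h * ennreal (1 / psi s)"
    by (subst nn_integral_cmult) (simp_all only: nn_integral_exp_tail psi_pos s, measurable)
  also have "\<dots> = ennreal (s / psi s) * h"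
    using s psi_pos[OF s] ennreal_mult[of s "1 / psi s"] by (simp add: mult_ac)
  finally show ?thesis unfolding h_def .
qed

end

context multiplicative_process
begin

lemma J_0_pos: "AE \<omega> in Q. 0 < J 0 \<omega>"
  using AE_J X_start by eventually_elim auto

text \<open>
  Exponents \<open>s \<ge> 0\<close> are dominated by integer moments. For \<open>-1 < s < 0\<close> the recursion expresses the
  moment of order \<open>s\<close> through the one of order \<open>s + 1\<close>.
\<close>

lemma J_moment_finite:
  assumes s: "-1 < s"
  shows "(\<integral>\<^sup>+\<omega>. ennreal (J 0 \<omega> powr s) \<partial>Q) < \<infinity>"
proof -
  have *: "(\<integral>\<^sup>+\<omega>. ennreal (J 0 \<omega> powr r) \<partial>Q) < \<infinity>" if r: "0 \<le> r" for r
  proof -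
    obtain n where n: "r \<le> real n" using real_arch_simple by blast
    have "(\<integral>\<^sup>+\<omega>. ennreal (J 0 \<omega> powr r) \<partial>Q) \<le> (\<integral>\<^sup>+\<omega>. 1 + ennreal (J 0 \<omega> ^ n) \<partial>Q)"
    proof (rule nn_integral_mono)
      fix \<omega>
      have "J 0 \<omega> powr r \<le> 1 + J 0 \<omega> ^ n"
      proof (cases "J 0 \<omega> \<le> 1")
        case True
        then have "J 0 \<omega> powr r \<le> 1" using r by (intro powr_le1) auto
        moreover have "0 \<le> J 0 \<omega> ^ n" by (intro zero_le_power) simp
        ultimately show ?thesis by linarith
      next
        case False
        then have "J 0 \<omega> powr r \<le> J 0 \<omega> powr real n" using n by (intro powr_mono) auto
        then show ?thesis using False by (simp add: powr_realpow)
      qed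
      then have "ennreal (J 0 \<omega> powr r) \<le> ennreal (1 + J 0 \<omega> ^ n)" by (rule ennreal_leI)
      then show "ennreal (J 0 \<omega> powr r) \<le> 1 + ennreal (J 0 \<omega> ^ n)" by simp
    qed
    also have "\<dots> = 1 + ennreal (moment n)"
      by (simp add: nn_integral_add J_0_moments emeasure_space_1)
    also have "\<dots> < \<infinity>" by simp
    finally show ?thesis .
  qed
  have "0 < s + 1" using s by simp
  then have "ennreal ((s + 1) / psi (s + 1)) * (\<integral>\<^sup>+\<omega>. ennreal (J 0 \<omega> powr (s + 1 - 1)) \<partial>Q) < \<infinity>"
    using *[of "s + 1"] s by (subst moment_recursion[symmetric]) auto
  moreover have "0 < ennreal ((s + 1) / psi (s + 1))"
    using \<open>0 < s + 1\<close> psi_pos[OF \<open>0 < s + 1\<close>] by simp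
  ultimately show ?thesis by (auto simp: ennreal_mult_eq_top_iff less_top[symmetric])
qed

definition mellin :: "real \<Rightarrow> real" where "mellin s = (\<integral>\<omega>. J 0 \<omega> powr s \<partial>Q)"

lemma J_powr_integrable: "-1 < s \<Longrightarrow> integrable Q (\<lambda>\<omega>. J 0 \<omega> powr s)"
  using J_moment_finite by (intro integrableI_nonneg) auto

lemma mellin_nn: "-1 < s \<Longrightarrow> (\<integral>\<^sup>+\<omega>. ennreal (J 0 \<omega> powr s) \<partial>Q) = ennreal (mellin s)"
  unfolding mellin_def using J_powr_integrable by (intro nn_integral_eq_integral) auto

lemma mellin_pos: "-1 < s \<Longrightarrow> 0 < mellin s"
proof -
  assume s: "-1 < s"
  have "AE \<omega> in Q. 0 < J 0 \<omega> powr s" using J_0_pos by eventually_elim simp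
  with J_powr_integrable[OF s] show ?thesis
    unfolding mellin_def by (intro expectation_greater) auto
qed

lemma mellin_0: "mellin 0 = 1"
proof -
  have "(\<integral>\<omega>. J 0 \<omega> powr 0 \<partial>Q) = (\<integral>\<omega>. 1 \<partial>Q)"
    using J_0_pos by (intro integral_cong_AE) auto
  then show ?thesis by (simp add: mellin_def prob_space)
qed

lemma mellin_rec: "0 < s \<Longrightarrow> mellin s = s / psi s * mellin (s - 1)"
  using moment_recursion[of s] mellin_nn[of s] mellin_nn[of "s - 1"] mellin_pos[of s] mellin_pos[of "s - 1"] psi_pos[of s]
  by (simp add: ennreal_mult[symmetric])

lemma mellin_log_convex: "convex_on {0<..} (\<lambda>s. ln (mellin (s - 1)))"
  unfolding mellin_def
proof (rule log_convex_integral)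
  fix a b \<theta> :: real
  show "AE \<omega> in Q. J 0 \<omega> powr ((1 - \<theta>) * a + \<theta> * b - 1) \<le> (J 0 \<omega> powr (a - 1)) powr (1 - \<theta>) * (J 0 \<omega> powr (b - 1)) powr \<theta>"
    by (intro AE_I2) (simp add: powr_powr powr_add[symmetric] algebra_simps)
qed (use mellin_pos J_powr_integrable in \<open>auto simp: mellin_def\<close>)

theorem gauss_product_mellin:
  assumes lim: "\<And>c. c > 0 \<Longrightarrow> ((\<lambda>s. psi (s + c) / psi s) \<longlongrightarrow> 1) at_top" and s: "-1 < s"
  shows "gauss_product (conjugate_exponent psi) (s + 1) \<longlonglongrightarrow> mellin s"
proof -
  have "gauss_product (conjugate_exponent psi) (s + 1) \<longlonglongrightarrow> mellin (s + 1 - 1)"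
  proof (rule bohr_mollerup_limit[where f = "\<lambda>s. mellin (s - 1)"])
    fix c :: real assume c: "c > 0"
    have "((\<lambda>s. ((s + c) / s) / (psi (s + c) / psi s)) \<longlongrightarrow> 1 / 1) at_top"
      using c by (intro tendsto_divide lim ratio_shift_tendsto) auto
    then show "((\<lambda>s. conjugate_exponent psi (s + c) / conjugate_exponent psi s) \<longlongrightarrow> 1) at_top"
      by (simp add: conjugate_exponent_def mult.commute)
  next
    show "mellin (r + 1 - 1) = conjugate_exponent psi r * mellin (r - 1)" if "r > 0" for r
      using mellin_rec[OF that] by (simp add: conjugate_exponent_def)
  qed (use s in \<open>auto simp: conjugate_exponent_def psi_pos mellin_pos mellin_0 mellin_log_convex\<close>)
  then show ?thesis by simp
qed

theorem mellin_eq_gen_Gamma: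
  assumes "webster_conditions psi" "webster_conditions (conjugate_exponent psi)" "-1 < s"
  shows "gen_Gamma (conjugate_exponent psi) (s + 1) = mellin s"
  using assms by (intro gen_Gamma_eq_gauss_limit gauss_product_mellin mellin_pos) (auto simp: webster_conditions_def)

text \<open>
  Log-convexity of \<open>Gamma (s + 1) / mellin s\<close> is not clear a priori, so \<open>bohr_mollerup_limit\<close> is not
  applied to \<open>psi\<close>. Its Gauss product is instead the quotient of those of the identity and of
  \<open>conjugate_exponent psi\<close>.
\<close>

theorem Gamma_divide_mellin_eq_gen_Gamma:
  assumes psi: "webster_conditions psi" and s: "-1 < s"
  shows "gen_Gamma psi (s + 1) = Gamma (s + 1) / mellin s"
proof (rule gen_Gamma_eq_gauss_limit[OF psi])
  have "(\<lambda>N. gauss_product (\<lambda>x. x) (s + 1) N / gauss_product (conjugate_exponent psi) (s + 1) N) \<longlonglongrightarrow> Gamma (s + 1) / mellin s"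
    using s psi mellin_pos[OF s]
    by (intro tendsto_divide gauss_product_id gauss_product_mellin) (auto simp: webster_conditions_def)
  moreover have "eventually (\<lambda>N. gauss_product (\<lambda>x. x) (s + 1) N / gauss_product (conjugate_exponent psi) (s + 1) N = gauss_product psi (s + 1) N) sequentially"
    using eventually_gt_at_top[of 0]
  proof eventually_elim
    case (elim N)
    have "(\<Prod>n<N. real (Suc n) / (real (Suc n) + (s + 1))) > 0"
      using s by (intro prod_pos) (auto intro!: divide_pos_pos)
    then have "gauss_product (\<lambda>x. x) (s + 1) N \<noteq> 0" using s elim by (simp add: gauss_product_def)
    then show ?case
      using gauss_product_conjugate[of psi "s + 1" N] psi_pos s elim by simp
  qed
  ultimately show "gauss_product psi (s + 1) \<longlonglongrightarrow> Gamma (s + 1) / mellin s"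
    using tendsto_cong by fastforce
qed (use s in \<open>auto intro!: divide_pos_pos Gamma_real_pos mellin_pos\<close>)

end

section \<open>Webster conditions, exponentials and measurability in time\<close>

text \<open>
  A positive concave function grows at most linearly: the slope beyond \<open>s\<close> is at most the slope over
  \<open>[s / 2, s]\<close>, hence at most \<open>2 * g s / s\<close>.
\<close>

lemma concave_on_imp_webster:
  assumes pos: "\<And>s. 0 < s \<Longrightarrow> 0 < g s" and mono: "\<And>s t. 0 < s \<Longrightarrow> s \<le> t \<Longrightarrow> g s \<le> g t"
    and conc: "concave_on {0<..} (g :: real \<Rightarrow> real)"
  shows "webster_conditions g"
  unfolding webster_conditions_def
proof (intro conjI allI impI)
  show "concave_on {0<..} (\<lambda>s. ln (g s))"
    unfolding concave_on_iff
  proof (intro conjI ballI allI impI)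
    fix x y u v :: real assume xy: "x \<in> {0<..}" "y \<in> {0<..}" and uv: "0 \<le> u" "0 \<le> v" "u + v = 1"
    have "u * ln (g x) + v * ln (g y) \<le> ln (u * g x + v * g y)"
      using ln_concave xy uv pos by (simp add: concave_on_iff)
    also have "\<dots> \<le> ln (g (u * x + v * y))"
    proof (rule ln_mono)
      show "0 < u * g x + v * g y"
        using xy uv pos[of x] pos[of y]
        by (metis add_nonneg_pos add_pos_nonneg greaterThan_iff less_eq_real_def mult_nonneg_nonneg mult_pos_pos zero_less_one add.right_neutral order_less_irrefl)
      show "u * g x + v * g y \<le> g (u * x + v * y)"
        using conc xy uv by (simp add: concave_on_iff)
    qed
    finally show "u * ln (g x) + v * ln (g y) \<le> ln (g (u *\<^sub>R x + v *\<^sub>R y))" by simp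
  qed simp
next
  fix c :: real assume c: "0 < c"
  show "((\<lambda>s. g (s + c) / g s) \<longlongrightarrow> 1) at_top"
  proof (rule tendsto_sandwich)
    show "eventually (\<lambda>s. 1 \<le> g (s + c) / g s) at_top"
      using eventually_gt_at_top[of 0] by eventually_elim (use pos mono c in simp)
    show "eventually (\<lambda>s. g (s + c) / g s \<le> 1 + 2 * c / s) at_top"
      using eventually_gt_at_top[of 0]
    proof eventually_elim
      case (elim s)
      have "(g (s + c) - g s) / c \<le> (g (s + c) - g (s / 2)) / (s + c - s / 2)"
           "(g (s + c) - g (s / 2)) / (s + c - s / 2) \<le> (g s - g (s / 2)) / (s - s / 2)"
        using concave_on_slopes[OF conc, of "s / 2" s "s + c"] elim c by auto
      then have "(g (s + c) - g s) / c \<le> (g s - g (s / 2)) / (s - s / 2)" by linarith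
      also have "\<dots> \<le> g s / (s - s / 2)" using pos[of "s / 2"] elim by (intro divide_right_mono) auto
      finally have "g (s + c) - g s \<le> g s * (2 * c / s)" using c elim by (simp add: field_simps)
      then show ?case using pos[OF elim] elim by (simp add: pos_divide_le_eq ring_distribs mult.commute)
    qed
    show "((\<lambda>s. 1 + 2 * c / s) \<longlongrightarrow> 1) at_top" by real_asymp
  qed simp
qed (use pos in auto)

text \<open>
  The monotone solutions of Cauchy's functional equation are linear: compare \<open>n * t\<close> with its
  integer part and let \<open>n\<close> grow.
\<close>

lemma multiplicative_antimono_eq_powr:
  fixes m :: "real \<Rightarrow> real"
  assumes mult: "\<And>s t. 0 \<le> s \<Longrightarrow> 0 \<le> t \<Longrightarrow> m (s + t) = m s * m t"
    and anti: "\<And>s t. 0 \<le> s \<Longrightarrow> s \<le> t \<Longrightarrow> m t \<le> m s"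
    and pos: "\<And>t. 0 \<le> t \<Longrightarrow> 0 < m t" and t: "0 \<le> t"
  shows "m t = m 1 powr t"
proof -
  define g where "g = (\<lambda>t. - ln (m t))"
  have add: "g (s + t) = g s + g t" if "0 \<le> s" "0 \<le> t" for s t
    using mult[OF that] pos[OF that(1)] pos[OF that(2)] by (simp add: g_def ln_mult)
  have mono: "g s \<le> g t" if "0 \<le> s" "s \<le> t" for s t
    using anti[OF that] pos[of s] pos[of t] that by (simp add: g_def)
  have g0: "g 0 = 0" using add[of 0 0] by simp
  have nat: "g (real n * s) = real n * g s" if "0 \<le> s" for n s
  proof (induction n)
    case (Suc n)
    have "g (real (Suc n) * s) = g (real n * s + s)" by (simp add: ring_distribs add.commute)
    also have "\<dots> = real (Suc n) * g s" using add[of "real n * s" s] that Suc by (simp add: ring_distribs)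
    finally show ?case .
  qed (simp add: g0)
  have bound: "real n * \<bar>g t - t * g 1\<bar> \<le> g 1" for n
  proof -
    define k where "k = nat \<lfloor>real n * t\<rfloor>"
    have k: "real k \<le> real n * t" "real n * t \<le> real (Suc k)"
      using t by (auto simp: k_def) linarith
    have g1: "0 \<le> g 1" using mono[of 0 1] g0 by simp
    have "real k * g 1 \<le> real n * g t"
      using mono[of "real k * 1" "real n * t"] k nat[of 1 k] nat[of t n] t by simp
    moreover have "real n * g t \<le> real (Suc k) * g 1"
      using mono[of "real n * t" "real (Suc k) * 1"] k nat[of 1 "Suc k"] nat[of t n] t by simp
    moreover have "real k * g 1 \<le> real n * t * g 1" "real n * t * g 1 \<le> real (Suc k) * g 1"
      using k g1 by (auto intro: mult_right_mono)
    ultimately have "\<bar>real n * g t - real n * t * g 1\<bar> \<le> g 1"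
      by (simp add: abs_le_iff ring_distribs)
    also have "\<bar>real n * g t - real n * t * g 1\<bar> = real n * \<bar>g t - t * g 1\<bar>"
      by (simp add: abs_mult[of "real n", simplified, symmetric] right_diff_distrib mult.assoc)
    finally show ?thesis .
  qed
  have "g t - t * g 1 = 0"
  proof (rule ccontr)
    assume "g t - t * g 1 \<noteq> 0"
    then obtain n where "g 1 < real n * \<bar>g t - t * g 1\<bar>"
      using reals_Archimedean3[of "\<bar>g t - t * g 1\<bar>"] by auto
    with bound[of n] show False by simp
  qed
  then have "ln (m t) = t * ln (m 1)" by (simp add: g_def)
  then have "exp (ln (m t)) = exp (t * ln (m 1))" by simp
  then show ?thesis using pos[OF t] pos[of 1] by (simp add: powr_def)
qed

text \<open>
  For finite \<open>x > 0\<close> the quotient \<open>(1 - exp (- s * x)) / s\<close> is the integral of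
  \<open>exp (- s * y)\<close> over \<open>y\<close> in \<open>[0, x]\<close>, a mixture of log-linear functions of \<open>s\<close>. For \<open>x = \<infinity>\<close> it is
  \<open>1 / s\<close>.
\<close>

lemma log_convex_exp_quotient:
  fixes x :: ennreal
  assumes ab: "0 < a" "0 < b" and \<theta>: "0 < \<theta>" "\<theta> < 1"
  shows "(1 - exp_neg ((1 - \<theta>) * a + \<theta> * b) x) / ((1 - \<theta>) * a + \<theta> * b)
    \<le> ((1 - exp_neg a x) / a) powr (1 - \<theta>) * ((1 - exp_neg b x) / b) powr \<theta>"
proof -
  define c where "c = (1 - \<theta>) * a + \<theta> * b"
  have c: "0 < c" using ab \<theta> by (auto simp: c_def intro!: add_pos_pos)
  have amgm: "a powr (1 - \<theta>) * b powr \<theta> \<le> c"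
    unfolding c_def using ab \<theta> by (intro Youngs_inequality_0) auto
  have gen: "C \<le> A powr (1 - \<theta>) * B powr \<theta>"
    if le: "ln C \<le> (1 - \<theta>) * ln A + \<theta> * ln B" and pos: "0 < C" "0 < A" "0 < B" for A B C :: real
  proof -
    have "C = exp (ln C)" using pos by simp
    also have "\<dots> \<le> exp ((1 - \<theta>) * ln A + \<theta> * ln B)" using le by simp
    finally show ?thesis using pos by (simp add: powr_def exp_add)
  qed
  consider "x = \<infinity>" | "x = 0" | r where "x = ennreal r" "0 < r"
    by (cases x) (auto simp: less_le)
  then have "(1 - exp_neg c x) / c \<le> ((1 - exp_neg a x) / a) powr (1 - \<theta>) * ((1 - exp_neg b x) / b) powr \<theta>"
  proof cases
    case 1
    have "1 / c \<le> 1 / (a powr (1 - \<theta>) * b powr \<theta>)"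
      using amgm ab by (intro frac_le) auto
    with 1 show ?thesis by (simp add: exp_neg_def powr_divide)
  next
    case 2
    then show ?thesis by (simp add: exp_neg_def)
  next
    case 3
    define u where "u = (\<lambda>s y. exp (- (s * y)) * indicator {0..r} y :: real)"
    have I: "has_bochner_integral lborel (u s) ((1 - exp (- (s * r))) / s)" if s: "0 < s" for s
    proof -
      have "has_bochner_integral lborel (\<lambda>y. exp (- (s * y)) * indicator {0..r} y) (- exp (- (s * r)) / s - - exp (- (s * 0)) / s)"
        using 3 s by (intro has_bochner_integral_FTC_Icc_nonneg) (auto intro!: derivative_eq_intros)
      then show ?thesis using s by (simp add: u_def diff_divide_distrib)
    qed
    have pos: "0 < (1 - exp (- (s * r))) / s" if "0 < s" for s using that 3 by simp
    have "convex_on {0<..} (\<lambda>s. ln (\<integral>y. u s y \<partial>lborel))"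
    proof (rule log_convex_integral)
      fix a b \<theta> :: real
      have "u ((1 - \<theta>) * a + \<theta> * b) y \<le> u a y powr (1 - \<theta>) * u b y powr \<theta>" for y
        by (auto simp: u_def powr_def exp_add[symmetric] algebra_simps split: split_indicator)
      then show "AE y in lborel. u ((1 - \<theta>) * a + \<theta> * b) y \<le> u a y powr (1 - \<theta>) * u b y powr \<theta>" by simp
    qed (use I pos in \<open>auto simp: has_bochner_integral_iff u_def split: split_indicator\<close>)
    from convex_onD[OF this, of \<theta> a b] ab \<theta>
    have "ln (\<integral>y. u c y \<partial>lborel) \<le> (1 - \<theta>) * ln (\<integral>y. u a y \<partial>lborel) + \<theta> * ln (\<integral>y. u b y \<partial>lborel)"
      by (simp add: c_def)
    then have "ln ((1 - exp (- (c * r))) / c) \<le> (1 - \<theta>) * ln ((1 - exp (- (a * r))) / a) + \<theta> * ln ((1 - exp (- (b * r))) / b)"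
      using I[OF ab(1)] I[OF ab(2)] I[OF c] by (simp only: has_bochner_integral_iff)
    then have "(1 - exp (- (c * r))) / c \<le> ((1 - exp (- (a * r))) / a) powr (1 - \<theta>) * ((1 - exp (- (b * r))) / b) powr \<theta>"
      by (rule gen) (intro pos ab c)+
    with 3 show ?thesis by (simp add: exp_neg_def)
  qed
  then show ?thesis by (simp add: c_def)
qed

text \<open>
  Approximate \<open>t\<close> strictly from the right by multiples of \<open>1 / (n + 1)\<close>: the approximating
  functions are countable gluings of measurable functions and converge by right-continuity.
\<close>

lemma right_continuous_jointly_measurable:
  fixes X :: "real \<Rightarrow> 'a \<Rightarrow> real"
  assumes meas: "\<And>t. 0 \<le> t \<Longrightarrow> X t \<in> borel_measurable S"
    and rc: "\<And>t \<omega>. 0 \<le> t \<Longrightarrow> \<omega> \<in> space S \<Longrightarrow> continuous (at_right t) (\<lambda>u. X u \<omega>)"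
  shows "(\<lambda>p. if 0 \<le> fst p then X (fst p) (snd p) else 0) \<in> borel_measurable (borel \<Otimes>\<^sub>M S)"
proof -
  define q where "q = (\<lambda>(n::nat) (t::real). (of_int \<lfloor>real (Suc n) * t\<rfloor> + 1) / real (Suc n))"
  have q_gt: "t < q n t" for n t
  proof -
    have "real (Suc n) * t < of_int \<lfloor>real (Suc n) * t\<rfloor> + 1" by linarith
    then show ?thesis by (simp add: q_def field_simps)
  qed
  have q_le: "q n t \<le> t + 1 / real (Suc n)" for n t
  proof -
    have "of_int \<lfloor>real (Suc n) * t\<rfloor> + 1 \<le> real (Suc n) * t + 1" by linarith
    then have "q n t \<le> (real (Suc n) * t + 1) / real (Suc n)" unfolding q_def by (intro divide_right_mono) auto
    also have "\<dots> = t + 1 / real (Suc n)" by (simp add: field_simps)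
    finally show ?thesis .
  qed
  have q_lim: "filterlim (\<lambda>n. q n t) (at_right t) sequentially" for t
  proof -
    have "(\<lambda>n. t + 1 / real (Suc n)) \<longlonglongrightarrow> t + 0"
      by (intro tendsto_add tendsto_const LIMSEQ_Suc[OF lim_1_over_n])
    then have "(\<lambda>n. q n t) \<longlonglongrightarrow> t"
      using q_gt q_le by (intro tendsto_sandwich[of "\<lambda>_. t" "\<lambda>n. q n t" sequentially "\<lambda>n. t + 1 / real (Suc n)"])
        (auto intro!: always_eventually less_imp_le)
    then show ?thesis using q_gt[of t] by (auto simp: filterlim_at less_imp_neq[THEN not_sym] intro!: always_eventually)
  qed
  define Y where "Y = (\<lambda>n p. if 0 \<le> fst p then X (max 0 (q n (fst p))) (snd p) else 0)"
  have "Y n \<in> borel_measurable (borel \<Otimes>\<^sub>M S)" for n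
  proof -
    have "(\<lambda>p. (\<lambda>(k::int) p. X (max 0 ((of_int k + 1) / real (Suc n))) (snd p)) \<lfloor>real (Suc n) * fst p\<rfloor> p) \<in> borel_measurable (borel \<Otimes>\<^sub>M S)"
      by (rule measurable_compose_countable) (auto intro!: measurable_compose[OF measurable_snd] meas)
    then show ?thesis unfolding Y_def q_def by measurable
  qed
  then show ?thesis
  proof (rule borel_measurable_LIMSEQ_real[rotated])
    fix p :: "real \<times> 'a" assume "p \<in> space (borel \<Otimes>\<^sub>M S)"
    then have p: "snd p \<in> space S" by (auto simp: space_pair_measure)
    show "(\<lambda>n. Y n p) \<longlonglongrightarrow> (if 0 \<le> fst p then X (fst p) (snd p) else 0)"
    proof (cases "0 \<le> fst p")
      case True
      have "((\<lambda>u. X u (snd p)) \<longlongrightarrow> X (fst p) (snd p)) (at_right (fst p))"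
        using rc[OF True p] by (simp add: continuous_within)
      then have "(\<lambda>n. X (q n (fst p)) (snd p)) \<longlonglongrightarrow> X (fst p) (snd p)"
        by (rule filterlim_compose) (rule q_lim)
      moreover have "max 0 (q n (fst p)) = q n (fst p)" for n using True q_gt[of "fst p" n] by simp
      ultimately show ?thesis using True by (simp add: Y_def)
    qed (simp add: Y_def)
  qed
qed

section \<open>Killed subordinators and their Laplace exponents\<close>

lemma exp_neg_measurable [measurable]: "exp_neg l \<in> borel_measurable borel"
  unfolding exp_neg_def[abs_def] by measurable

lemma exp_neg_nonneg [simp]: "0 \<le> exp_neg l x" by (simp add: exp_neg_def)
lemma exp_neg_top [simp]: "exp_neg l \<infinity> = 0" "exp_neg l top = 0" by (simp_all add: exp_neg_def)
lemma exp_neg_zero [simp]: "exp_neg l 0 = 1" by (simp add: exp_neg_def)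

lemma exp_neg_le_1: "0 \<le> l \<Longrightarrow> exp_neg l x \<le> 1"
  by (auto simp: exp_neg_def)

lemma exp_neg_antimono: "0 \<le> l \<Longrightarrow> x \<le> y \<Longrightarrow> exp_neg l y \<le> exp_neg l x"
  by (auto simp: exp_neg_def top_unique less_top intro!: mult_left_mono enn2real_mono)

lemma exp_neg_add: "exp_neg p x * exp_neg q x = exp_neg (p + q) x"
  by (auto simp: exp_neg_def exp_add[symmetric] ring_distribs)

lemma exp_neg_powr: "exp_neg p x = exp_neg 1 x powr p"
  by (auto simp: exp_neg_def powr_def mult.commute)

lemma exp_neg_plus: "x \<noteq> \<infinity> \<Longrightarrow> exp_neg p (x + y) = exp_neg p x * exp_neg p y"
  by (cases y; cases x) (auto simp: exp_neg_def exp_add[symmetric] ring_distribs ennreal_plus[symmetric] simp del: ennreal_plus)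

lemma tendsto_exp_neg:
  assumes f: "(f \<longlongrightarrow> x) G" and x: "x \<noteq> \<infinity>"
  shows "((\<lambda>u. exp_neg p (f u)) \<longlongrightarrow> exp_neg p x) G"
proof -
  obtain r where r: "x = ennreal r" "0 \<le> r" using x by (cases x) auto
  have "((\<lambda>u. enn2real (f u)) \<longlongrightarrow> r) G" by (rule tendsto_enn2real[OF f[unfolded r(1)] r(2)])
  then have "((\<lambda>u. exp (- (p * enn2real (f u)))) \<longlongrightarrow> exp (- (p * r))) G" by (intro tendsto_exp tendsto_minus tendsto_mult tendsto_const)
  moreover have "eventually (\<lambda>u. f u < \<infinity>) G" using f x by (intro order_tendstoD(2)[OF f]) (auto simp: less_top)
  then have "eventually (\<lambda>u. exp (- (p * enn2real (f u))) = exp_neg p (f u)) G"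
    by eventually_elim (auto simp: exp_neg_def)
  ultimately have "((\<lambda>u. exp_neg p (f u)) \<longlongrightarrow> exp (- (p * r))) G" by (rule Lim_transform_eventually)
  then show ?thesis using r by (simp add: exp_neg_def)
qed

lemma space_process_sigma [simp]: "space (process_sigma M X T) = space M"
  by (simp add: process_sigma_def space_measure_of_conv)

lemma process_sigma_measurable: "u \<in> T \<Longrightarrow> X u \<in> borel_measurable (process_sigma M X T)"
proof (rule measurableI)
  fix B :: "ennreal set" assume u: "u \<in> T" and B: "B \<in> sets borel"
  have "X u -` B \<inter> space M \<in> sigma_sets (space M) (\<Union>u\<in>T. {X u -` B \<inter> space M | B. B \<in> sets borel})"
    using u B by (intro sigma_sets.Basic) blast
  then show "X u -` B \<inter> space (process_sigma M X T) \<in> sets (process_sigma M X T)"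
    unfolding space_process_sigma unfolding process_sigma_def by (subst sets_measure_of) auto
qed simp

lemma sets_process_sigma: "sets (process_sigma M X T) = sigma_sets (space M) (\<Union>u\<in>T. {X u -` B \<inter> space M | B. B \<in> sets borel})"
  unfolding process_sigma_def by (rule sets_measure_of) auto

lemma process_sigma_mono: "S \<subseteq> T \<Longrightarrow> sets (process_sigma M X S) \<subseteq> sets (process_sigma M X T)"
  unfolding sets_process_sigma by (rule sigma_sets_mono') auto

lemma process_sigma_subset:
  assumes "\<And>u. u \<in> T \<Longrightarrow> X u \<in> borel_measurable M"
  shows "sets (process_sigma M X T) \<subseteq> sets M"
  unfolding sets_process_sigma using assms by (intro sets.sigma_sets_subset) (auto intro: measurable_sets)

locale subordinator = prob_space M for M :: "'a measure" +
  fixes xi :: "real \<Rightarrow> 'a \<Rightarrow> ennreal"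
  assumes killed: "killed_subordinator M xi"
begin

definition F :: "real \<Rightarrow> 'a measure" where "F t = process_sigma M xi {0..t}"

abbreviation phi :: "real \<Rightarrow> real" where "phi \<equiv> laplace_exponent M xi"

definition laplace :: "real \<Rightarrow> real \<Rightarrow> real" where "laplace p t = (\<integral>\<omega>. exp_neg p (xi t \<omega>) \<partial>M)"

lemma xi_measurable [measurable]: "0 \<le> t \<Longrightarrow> xi t \<in> borel_measurable M"
  using killed by (simp add: killed_subordinator_def)

lemma xi_0: "\<omega> \<in> space M \<Longrightarrow> xi 0 \<omega> = 0"
  using killed by (simp add: killed_subordinator_def)

lemma xi_mono: "\<omega> \<in> space M \<Longrightarrow> 0 \<le> s \<Longrightarrow> s \<le> t \<Longrightarrow> xi s \<omega> \<le> xi t \<omega>"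
  using killed by (auto simp: killed_subordinator_def intro: mono_onD)

lemma xi_rc: "\<omega> \<in> space M \<Longrightarrow> 0 \<le> t \<Longrightarrow> continuous (at_right t) (\<lambda>u. xi u \<omega>)"
  using killed by (simp add: killed_subordinator_def)

lemma space_F [simp]: "space (F t) = space M" by (simp add: F_def)

lemma xi_F: "0 \<le> u \<Longrightarrow> u \<le> t \<Longrightarrow> xi u \<in> borel_measurable (F t)"
  unfolding F_def by (rule process_sigma_measurable) auto

lemma F_mono: "s \<le> t \<Longrightarrow> sets (F s) \<subseteq> sets (F t)"
  unfolding F_def by (rule process_sigma_mono) auto

lemma F_subset: "sets (F t) \<subseteq> sets M"
  unfolding F_def by (rule process_sigma_subset) auto

lemma F_measurable_M: "w \<in> borel_measurable (F t) \<Longrightarrow> w \<in> borel_measurable M"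
  by (rule measurable_from_subalg[rotated]) (auto simp: subalgebra_def F_subset[THEN subsetD])

lemma F_measurable_mono: "s \<le> t \<Longrightarrow> w \<in> borel_measurable (F s) \<Longrightarrow> w \<in> borel_measurable (F t)"
  by (rule measurable_from_subalg[rotated]) (auto simp: subalgebra_def F_mono[THEN subsetD])

lemma levy: "0 \<le> t \<Longrightarrow> 0 \<le> h \<Longrightarrow> A \<in> sets (F t) \<Longrightarrow> B \<in> sets borel \<Longrightarrow>
  measure M {\<omega>\<in>A. xi t \<omega> < \<infinity> \<and> xi (t + h) \<omega> - xi t \<omega> \<in> B}
        = measure M {\<omega>\<in>A. xi t \<omega> < \<infinity>} * measure M {\<omega>\<in>space M. xi h \<omega> \<in> B}"
  using killed unfolding killed_subordinator_def F_def by blast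

text \<open>
  On survival up to \<open>t\<close> and a past event \<open>A\<close>, the law of the increment is a multiple of the law
  of \<open>xi h\<close>: the Levy property says so on Borel sets, and \<open>f\<close> is integrated against both.
\<close>

lemma levy_indicator:
  assumes t: "0 \<le> t" and h: "0 \<le> h" and A: "A \<in> sets (F t)" and f [measurable]: "f \<in> borel_measurable borel"
  shows "(\<integral>\<^sup>+\<omega>. indicator A \<omega> * (indicator {\<omega>. xi t \<omega> < \<infinity>} \<omega> * f (xi (t + h) \<omega> - xi t \<omega>)) \<partial>M)
    = (\<integral>\<^sup>+\<omega>. indicator A \<omega> * indicator {\<omega>. xi t \<omega> < \<infinity>} \<omega> \<partial>M) * (\<integral>\<^sup>+\<omega>. f (xi h \<omega>) \<partial>M)"
proof -
  have A' [measurable]: "A \<in> sets M" using A F_subset by auto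
  have Asp: "A \<subseteq> space M" using A' by (rule sets.sets_into_space)
  have [measurable]: "xi t \<in> borel_measurable M" "xi h \<in> borel_measurable M" "xi (t + h) \<in> borel_measurable M"
    using t h by auto
  define S where "S = {\<omega>\<in>A. xi t \<omega> < \<infinity>}"
  have S_eq: "S = A \<inter> {\<omega>\<in>space M. xi t \<omega> < \<infinity>}" using Asp by (auto simp: S_def)
  have S [measurable]: "S \<in> sets M" unfolding S_eq by measurable
  have "distr (density M (indicator S)) borel (\<lambda>\<omega>. xi (t + h) \<omega> - xi t \<omega>)
      = distr (density M (\<lambda>_. emeasure M S)) borel (xi h)" (is "?L = ?R")
  proof (rule measure_eqI)
    fix B assume "B \<in> sets ?L"
    then have B [measurable]: "B \<in> sets borel" by simp
    have "emeasure ?L B = emeasure M (S \<inter> ((\<lambda>\<omega>. xi (t + h) \<omega> - xi t \<omega>) -` B \<inter> space M))"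
      by (subst emeasure_distr) (auto simp: emeasure_restricted)
    also have "S \<inter> ((\<lambda>\<omega>. xi (t + h) \<omega> - xi t \<omega>) -` B \<inter> space M) = {\<omega>\<in>A. xi t \<omega> < \<infinity> \<and> xi (t + h) \<omega> - xi t \<omega> \<in> B}"
      using Asp by (auto simp: S_def)
    also have "emeasure M \<dots> = ennreal (measure M S * measure M {\<omega>\<in>space M. xi h \<omega> \<in> B})"
      unfolding emeasure_eq_measure levy[OF t h A B] S_def ..
    also have "\<dots> = emeasure M S * emeasure M (xi h -` B \<inter> space M)"
      by (simp add: emeasure_eq_measure ennreal_mult vimage_def Int_def conj_commute)
    also have "\<dots> = emeasure ?R B"
      by (subst emeasure_distr) (auto simp: emeasure_density nn_integral_cmult_indicator)
    finally show "emeasure ?L B = emeasure ?R B" .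
  qed simp
  then have "(\<integral>\<^sup>+x. f x \<partial>?L) = (\<integral>\<^sup>+x. f x \<partial>?R)" by simp
  moreover have "(\<integral>\<^sup>+x. f x \<partial>?L) = (\<integral>\<^sup>+\<omega>. indicator S \<omega> * f (xi (t + h) \<omega> - xi t \<omega>) \<partial>M)"
    by (simp add: nn_integral_distr nn_integral_density)
  moreover have "(\<integral>\<^sup>+x. f x \<partial>?R) = emeasure M S * (\<integral>\<^sup>+\<omega>. f (xi h \<omega>) \<partial>M)"
    by (simp add: nn_integral_distr nn_integral_density nn_integral_cmult)
  moreover have "(\<integral>\<^sup>+\<omega>. indicator S \<omega> * f (xi (t + h) \<omega> - xi t \<omega>) \<partial>M)
    = (\<integral>\<^sup>+\<omega>. indicator A \<omega> * (indicator {\<omega>. xi t \<omega> < \<infinity>} \<omega> * f (xi (t + h) \<omega> - xi t \<omega>)) \<partial>M)"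
    by (intro nn_integral_cong) (auto simp: S_def split: split_indicator)
  moreover have "emeasure M S = (\<integral>\<^sup>+\<omega>. indicator A \<omega> * indicator {\<omega>. xi t \<omega> < \<infinity>} \<omega> \<partial>M)"
    by (subst nn_integral_indicator[symmetric], rule S, intro nn_integral_cong) (auto simp: S_def split: split_indicator)
  ultimately show ?thesis by simp
qed

lemma markov:
  assumes t: "0 \<le> t" and h: "0 \<le> h" and w: "w \<in> borel_measurable (F t)" and f [measurable]: "f \<in> borel_measurable borel"
  shows "(\<integral>\<^sup>+\<omega>. w \<omega> * (indicator {\<omega>. xi t \<omega> < \<infinity>} \<omega> * f (xi (t + h) \<omega> - xi t \<omega>)) \<partial>M)
    = (\<integral>\<^sup>+\<omega>. w \<omega> * indicator {\<omega>. xi t \<omega> < \<infinity>} \<omega> \<partial>M) * (\<integral>\<^sup>+\<omega>. f (xi h \<omega>) \<partial>M)"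
proof -
  have [measurable]: "xi t \<in> borel_measurable M" "xi h \<in> borel_measurable M" "xi (t + h) \<in> borel_measurable M"
    using t h by auto
  have [measurable]: "(\<lambda>\<omega>. indicator {\<omega>. xi t \<omega> < \<infinity>} \<omega> :: ennreal) \<in> borel_measurable M"
  proof -
    have "(\<lambda>\<omega>. if xi t \<omega> < \<infinity> then 1 else 0 :: ennreal) \<in> borel_measurable M" by measurable
    then show ?thesis by (simp add: indicator_def)
  qed
  note M = F_measurable_M[where t=t]
  show ?thesis using w
  proof (induction w rule: borel_measurable_induct)
    case (cong g k)
    then show ?case by (simp cong: nn_integral_cong_simp)
  next
    case (set A)
    then show ?case using t h by (intro levy_indicator) auto
  next
    case (mult k c)
    note [measurable] = M[OF \<open>k \<in> borel_measurable (F t)\<close>]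
    show ?case using mult
      by (simp add: mult.assoc nn_integral_cmult)
  next
    case (add k g)
    note [measurable] = M[OF \<open>k \<in> borel_measurable (F t)\<close>] M[OF \<open>g \<in> borel_measurable (F t)\<close>]
    show ?case using add by (simp add: distrib_right nn_integral_add)
  next
    case (seq U)
    note [measurable] = M[OF \<open>U _ \<in> borel_measurable (F t)\<close>]
    have inc: "incseq (\<lambda>i \<omega>. U i \<omega> * k \<omega>)" for k :: "'a \<Rightarrow> ennreal"
      using seq by (auto simp: incseq_def le_fun_def intro!: mult_right_mono)
    have *: "(\<integral>\<^sup>+\<omega>. (SUP i. U i) \<omega> * k \<omega> \<partial>M) = (SUP i. \<integral>\<^sup>+\<omega>. U i \<omega> * k \<omega> \<partial>M)"
      if [measurable]: "k \<in> borel_measurable M" for k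
      by (subst nn_integral_monotone_convergence_SUP[symmetric, OF inc])
         (auto simp: SUP_mult_right_ennreal image_comp)
    show ?case
      by (subst (1 2) *) (use seq in \<open>simp_all add: SUP_mult_right_ennreal\<close>)
  qed
qed

end

lemma convex_on_eqI:
  assumes "convex_on S f" "\<And>x. x \<in> S \<Longrightarrow> f x = g x"
  shows "convex_on S g"
  using assms by (auto simp: convex_on_def convex_def)

context subordinator begin

lemma exp_neg_xi_measurable [measurable]: "0 \<le> t \<Longrightarrow> (\<lambda>\<omega>. exp_neg p (xi t \<omega>)) \<in> borel_measurable M"
  by measurable

lemma exp_neg_xi_F: "0 \<le> u \<Longrightarrow> u \<le> t \<Longrightarrow> (\<lambda>\<omega>. exp_neg p (xi u \<omega>)) \<in> borel_measurable (F t)"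
  by (rule measurable_compose[OF xi_F exp_neg_measurable])

lemma exp_neg_xi_integrable: "0 \<le> p \<Longrightarrow> 0 \<le> t \<Longrightarrow> integrable M (\<lambda>\<omega>. exp_neg p (xi t \<omega>))"
  by (rule integrable_const_bound[where B = 1]) (auto intro: exp_neg_le_1)

lemma laplace_nn: "0 \<le> p \<Longrightarrow> 0 \<le> t \<Longrightarrow> (\<integral>\<^sup>+\<omega>. ennreal (exp_neg p (xi t \<omega>)) \<partial>M) = ennreal (laplace p t)"
  unfolding laplace_def by (intro nn_integral_eq_integral exp_neg_xi_integrable) auto

lemma laplace_nonneg: "0 \<le> laplace p t"
  unfolding laplace_def by (intro integral_nonneg_AE) auto

lemma exp_neg_markov_laplace:
  assumes t: "0 \<le> t" and h: "0 \<le> h" and p: "0 \<le> p" and w: "w \<in> borel_measurable (F t)"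
  shows "(\<integral>\<^sup>+\<omega>. w \<omega> * ennreal (exp_neg p (xi (t + h) \<omega>)) \<partial>M)
    = ennreal (laplace p h) * (\<integral>\<^sup>+\<omega>. w \<omega> * ennreal (exp_neg p (xi t \<omega>)) \<partial>M)"
proof -
  define v where "v = (\<lambda>\<omega>. w \<omega> * ennreal (exp_neg p (xi t \<omega>)))"
  have v: "v \<in> borel_measurable (F t)"
    unfolding v_def using w exp_neg_xi_F[OF t order.refl] by measurable
  have "(\<integral>\<^sup>+\<omega>. w \<omega> * ennreal (exp_neg p (xi (t + h) \<omega>)) \<partial>M)
    = (\<integral>\<^sup>+\<omega>. v \<omega> * (indicator {\<omega>. xi t \<omega> < \<infinity>} \<omega> * ennreal (exp_neg p (xi (t + h) \<omega> - xi t \<omega>))) \<partial>M)"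
  proof (rule nn_integral_cong)
    fix \<omega> assume \<omega>: "\<omega> \<in> space M"
    have le: "xi t \<omega> \<le> xi (t + h) \<omega>" using \<omega> t h by (intro xi_mono) auto
    show "w \<omega> * ennreal (exp_neg p (xi (t + h) \<omega>))
      = v \<omega> * (indicator {\<omega>. xi t \<omega> < \<infinity>} \<omega> * ennreal (exp_neg p (xi (t + h) \<omega> - xi t \<omega>)))"
    proof (cases "xi t \<omega> = \<infinity>")
      case True
      then have "xi (t + h) \<omega> = \<infinity>" using le by (simp add: top_unique)
      with True show ?thesis by simp
    next
      case False
      have "exp_neg p (xi t \<omega> + (xi (t + h) \<omega> - xi t \<omega>)) = exp_neg p (xi t \<omega>) * exp_neg p (xi (t + h) \<omega> - xi t \<omega>)"
        using False by (rule exp_neg_plus)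
      moreover have "xi t \<omega> + (xi (t + h) \<omega> - xi t \<omega>) = xi (t + h) \<omega>"
        using le by (rule add_diff_inverse_ennreal)
      ultimately show ?thesis using False
        by (simp add: v_def ennreal_mult less_top mult.assoc)
    qed
  qed
  also have "\<dots> = (\<integral>\<^sup>+\<omega>. v \<omega> * indicator {\<omega>. xi t \<omega> < \<infinity>} \<omega> \<partial>M) * (\<integral>\<^sup>+\<omega>. ennreal (exp_neg p (xi h \<omega>)) \<partial>M)"
    by (rule markov[OF t h v]) measurable
  also have "(\<integral>\<^sup>+\<omega>. v \<omega> * indicator {\<omega>. xi t \<omega> < \<infinity>} \<omega> \<partial>M) = (\<integral>\<^sup>+\<omega>. v \<omega> \<partial>M)"
    by (intro nn_integral_cong) (auto simp: v_def less_top[symmetric] split: split_indicator)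
  finally show ?thesis using p h by (simp add: laplace_nn v_def mult.commute)
qed

lemma laplace_0: "laplace p 0 = 1"
proof -
  have "laplace p 0 = (\<integral>\<omega>. 1 \<partial>M)" unfolding laplace_def by (intro Bochner_Integration.integral_cong) (auto simp: xi_0)
  then show ?thesis by (simp add: prob_space)
qed

lemma laplace_mult:
  assumes "0 \<le> p" "0 \<le> s" "0 \<le> t"
  shows "laplace p (s + t) = laplace p s * laplace p t"
proof -
  have "(\<integral>\<^sup>+\<omega>. 1 * ennreal (exp_neg p (xi (s + t) \<omega>)) \<partial>M) = ennreal (laplace p t) * (\<integral>\<^sup>+\<omega>. 1 * ennreal (exp_neg p (xi s \<omega>)) \<partial>M)"
    using assms by (intro exp_neg_markov_laplace) auto
  then show ?thesis using assms by (simp add: laplace_nn ennreal_mult[symmetric] laplace_nonneg mult.commute)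
qed

lemma laplace_antimono:
  assumes "0 \<le> p" "0 \<le> s" "s \<le> t"
  shows "laplace p t \<le> laplace p s"
  unfolding laplace_def using assms
  by (intro integral_mono exp_neg_xi_integrable exp_neg_antimono xi_mono) auto

text \<open>
  Right-continuity at \<open>0\<close> makes the transform positive for some small time, and
  multiplicativity carries this to all times. So for \<open>p \<ge> 0\<close> the logarithm in the Laplace
  exponent is not evaluated at \<open>0\<close>.
\<close>

lemma laplace_pos:
  assumes p: "0 \<le> p" and t: "0 \<le> t"
  shows "0 < laplace p t"
proof -
  have "(\<lambda>n. laplace p (1 / real (Suc n))) \<longlonglongrightarrow> (\<integral>\<omega>. exp_neg p (xi 0 \<omega>) \<partial>M)"
    unfolding laplace_def
  proof (rule integral_dominated_convergence)
    show "AE \<omega> in M. (\<lambda>n. exp_neg p (xi (1 / real (Suc n)) \<omega>)) \<longlonglongrightarrow> exp_neg p (xi 0 \<omega>)"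
    proof (rule AE_I2)
      fix \<omega> assume \<omega>: "\<omega> \<in> space M"
      have lim: "filterlim (\<lambda>n. 1 / real (Suc n)) (at_right 0) sequentially"
        using LIMSEQ_Suc[OF lim_1_over_n[where 'a=real]] by (auto simp: filterlim_at intro!: always_eventually)
      have "((\<lambda>u. xi u \<omega>) \<longlongrightarrow> xi 0 \<omega>) (at_right 0)" using xi_rc[OF \<omega>, of 0] by (simp add: continuous_within)
      then have "(\<lambda>n. xi (1 / real (Suc n)) \<omega>) \<longlonglongrightarrow> xi 0 \<omega>" using lim by (rule filterlim_compose)
      then show "(\<lambda>n. exp_neg p (xi (1 / real (Suc n)) \<omega>)) \<longlonglongrightarrow> exp_neg p (xi 0 \<omega>)"
        by (rule tendsto_exp_neg) (simp add: xi_0 \<omega>)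
    qed
    show "AE \<omega> in M. norm (exp_neg p (xi (1 / real (Suc n)) \<omega>)) \<le> 1" for n
      using p by (auto intro!: AE_I2 exp_neg_le_1)
  qed auto
  then have "(\<lambda>n. laplace p (1 / real (Suc n))) \<longlonglongrightarrow> 1" using laplace_0[of p] by (simp add: laplace_def)
  then have "eventually (\<lambda>n. 0 < laplace p (1 / real (Suc n))) sequentially" by (rule order_tendstoD) simp
  then obtain n where n: "0 < laplace p (1 / real (Suc n))" using eventually_happens'[OF sequentially_bot] by blast
  define d where "d = 1 / real (Suc n)"
  have d: "0 < d" "0 < laplace p d" using n by (auto simp: d_def)
  have pow: "laplace p (real k * d) = laplace p d ^ k" for k
  proof (induction k)
    case (Suc k)
    have "laplace p (real (Suc k) * d) = laplace p (real k * d + d)" by (simp add: ring_distribs add.commute)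
    also have "\<dots> = laplace p (real k * d) * laplace p d" using d p by (intro laplace_mult) auto
    finally show ?case using Suc by simp
  qed (simp add: laplace_0)
  obtain k where k: "t < real k * d" using reals_Archimedean3[OF d(1)] by blast
  have "0 < laplace p (real k * d)" using d by (simp add: pow)
  also have "\<dots> \<le> laplace p t" using p t k by (intro laplace_antimono) auto
  finally show ?thesis .
qed

lemma phi_eq: "phi p = - ln (laplace p 1)" by (simp add: laplace_exponent_def laplace_def)

lemma laplace_eq:
  assumes p: "0 \<le> p" and t: "0 \<le> t"
  shows "laplace p t = exp (- (t * phi p))"
proof -
  have "laplace p t = laplace p 1 powr t"
    using laplace_mult[OF p] laplace_antimono[OF p] laplace_pos[OF p] t by (rule multiplicative_antimono_eq_powr)
  then show ?thesis using laplace_pos[OF p, of 1] by (simp add: powr_def phi_eq)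
qed

lemma exp_neg_markov:
  assumes "0 \<le> t" "0 \<le> h" "0 \<le> p" "w \<in> borel_measurable (F t)"
  shows "(\<integral>\<^sup>+\<omega>. w \<omega> * ennreal (exp_neg p (xi (t + h) \<omega>)) \<partial>M)
    = ennreal (exp (- (h * phi p))) * (\<integral>\<^sup>+\<omega>. w \<omega> * ennreal (exp_neg p (xi t \<omega>)) \<partial>M)"
  using exp_neg_markov_laplace[OF assms] assms by (simp add: laplace_eq)

lemma phi_nonneg: "0 \<le> p \<Longrightarrow> 0 \<le> phi p"
  using laplace_antimono[of p 0 1] laplace_pos[of p 1] by (simp add: phi_eq laplace_0)

lemma phi_mono: "0 \<le> p \<Longrightarrow> p \<le> q \<Longrightarrow> phi p \<le> phi q"
proof -
  assume pq: "0 \<le> p" "p \<le> q"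
  have "laplace q 1 \<le> laplace p 1"
    unfolding laplace_def using pq
    by (intro integral_mono exp_neg_xi_integrable) (auto simp: exp_neg_def mult_right_mono)
  then show ?thesis using laplace_pos[of q 1] pq by (simp add: phi_eq)
qed

lemma phi_concave: "concave_on {0<..} phi"
proof -
  have "convex_on {0<..} (\<lambda>s. ln (\<integral>\<omega>. exp_neg s (xi 1 \<omega>) \<partial>M))"
  proof (rule log_convex_integral)
    fix a b \<theta> :: real
    show "AE \<omega> in M. exp_neg ((1 - \<theta>) * a + \<theta> * b) (xi 1 \<omega>) \<le> exp_neg a (xi 1 \<omega>) powr (1 - \<theta>) * exp_neg b (xi 1 \<omega>) powr \<theta>"
      by (auto simp: exp_neg_def powr_def exp_add[symmetric] algebra_simps intro!: AE_I2)
  qed (use laplace_pos[of _ 1] in \<open>auto simp: laplace_def intro: exp_neg_xi_integrable\<close>)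
  then show ?thesis by (simp add: concave_on_def laplace_exponent_def)
qed

text \<open>
  \<open>phi s / s\<close> is the limit of \<open>n * (1 - exp (- phi s / n)) / s\<close>, and the numerator is the expectation
  of \<open>1 - exp_neg s (xi (1 / n))\<close>. Each approximant is log-convex, and convex inequalities pass to
  the limit.
\<close>

lemma phi_quotient_log_convex:
  assumes pos: "\<And>s. 0 < s \<Longrightarrow> 0 < phi s"
  shows "convex_on {0<..} (\<lambda>s. ln (phi s / s))"
proof -
  define q where "q = (\<lambda>n s. (1 - exp (- (phi s / real (Suc n)))) / s)"
  have q_pos: "0 < q n s" if "0 < s" for n s using pos[OF that] that by (simp add: q_def)
  have cvx: "convex_on {0<..} (\<lambda>s. ln (q n s))" for n
  proof -
    let ?u = "\<lambda>s \<omega>. (1 - exp_neg s (xi (1 / real (Suc n)) \<omega>)) / s"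
    have int: "(\<integral>\<omega>. ?u s \<omega> \<partial>M) = q n s" if "0 < s" for s
    proof -
      have "(\<integral>\<omega>. ?u s \<omega> \<partial>M) = (1 - laplace s (1 / real (Suc n))) / s"
        using that by (simp add: laplace_def exp_neg_xi_integrable prob_space)
      then show ?thesis using that by (simp add: q_def laplace_eq)
    qed
    have "convex_on {0<..} (\<lambda>s. ln (\<integral>\<omega>. ?u s \<omega> \<partial>M))"
    proof (rule log_convex_integral)
      fix a b \<theta> :: real assume "0 < a" "0 < b" "0 < \<theta>" "\<theta> < 1"
      then show "AE \<omega> in M. ?u ((1 - \<theta>) * a + \<theta> * b) \<omega> \<le> ?u a \<omega> powr (1 - \<theta>) * ?u b \<omega> powr \<theta>"
        by (intro AE_I2 log_convex_exp_quotient)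
    next
      show "0 < (\<integral>\<omega>. ?u s \<omega> \<partial>M)" if s: "0 < s" for s unfolding int[OF s] using s by (rule q_pos)
      show "0 < s \<Longrightarrow> integrable M (?u s)" for s by (simp add: exp_neg_xi_integrable)
      show "0 < s \<Longrightarrow> AE \<omega> in M. 0 \<le> ?u s \<omega>" for s by (auto intro!: AE_I2 exp_neg_le_1 divide_nonneg_pos)
    qed
    moreover have "ln (\<integral>\<omega>. ?u s \<omega> \<partial>M) = ln (q n s)" if "s \<in> {0<..}" for s
      using that by (simp only: greaterThan_iff int)
    ultimately show ?thesis by (rule convex_on_eqI)
  qed
  \<comment> \<open>The factor \<open>n + 1\<close> only adds a constant to the logarithm, so it does not affect convexity.\<close>
  have lim: "(\<lambda>n. ln (real (Suc n)) + ln (q n s)) \<longlonglongrightarrow> ln (phi s / s)" if s: "0 < s" for s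
  proof -
    have "((\<lambda>x::real. (1 - exp (- (c / x))) * x) \<longlongrightarrow> c) at_top" if "0 < c" for c :: real
      using that by real_asymp
    from tendsto_divide[OF this[OF pos[OF s]] tendsto_const[of s]] s have "((\<lambda>x. (1 - exp (- (phi s / x))) * x / s) \<longlongrightarrow> phi s / s) at_top" by simp
    then have "(\<lambda>n. (1 - exp (- (phi s / real (Suc n)))) * real (Suc n) / s) \<longlonglongrightarrow> phi s / s"
      by (rule filterlim_compose) (rule filterlim_compose[OF filterlim_real_sequentially filterlim_Suc])
    then have "(\<lambda>n. real (Suc n) * q n s) \<longlonglongrightarrow> phi s / s" by (simp add: q_def mult.commute)
    then have "(\<lambda>n. ln (real (Suc n) * q n s)) \<longlonglongrightarrow> ln (phi s / s)" using s pos[OF s] by (intro tendsto_ln) auto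
    moreover have "ln (real (Suc n) * q n s) = ln (real (Suc n)) + ln (q n s)" for n
      using q_pos[OF s, of n] by (subst ln_mult_pos) auto
    ultimately show ?thesis by simp
  qed
  show ?thesis
  proof (rule convex_onI)
    fix \<theta> a b :: real assume \<theta>: "0 < \<theta>" "\<theta> < 1" and ab: "a \<in> {0<..}" "b \<in> {0<..}"
    define c where "c = (1 - \<theta>) * a + \<theta> * b"
    have c: "0 < c" using \<theta> ab by (auto simp: c_def intro!: add_pos_pos)
    have "ln (phi c / c) \<le> (1 - \<theta>) * ln (phi a / a) + \<theta> * ln (phi b / b)"
    proof (rule LIMSEQ_le)
      show "(\<lambda>n. ln (real (Suc n)) + ln (q n c)) \<longlonglongrightarrow> ln (phi c / c)" by (rule lim[OF c])
      show "(\<lambda>n. (1 - \<theta>) * (ln (real (Suc n)) + ln (q n a)) + \<theta> * (ln (real (Suc n)) + ln (q n b)))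
          \<longlonglongrightarrow> (1 - \<theta>) * ln (phi a / a) + \<theta> * ln (phi b / b)"
        using ab by (intro tendsto_add tendsto_mult tendsto_const lim) auto
      have "ln (q n c) \<le> (1 - \<theta>) * ln (q n a) + \<theta> * ln (q n b)" for n
        using convex_onD[OF cvx, of \<theta> a b n] \<theta> ab by (simp add: c_def)
      then show "\<exists>N. \<forall>n\<ge>N. ln (real (Suc n)) + ln (q n c)
          \<le> (1 - \<theta>) * (ln (real (Suc n)) + ln (q n a)) + \<theta> * (ln (real (Suc n)) + ln (q n b))"
        by (auto simp: algebra_simps)
    qed
    then show "ln (phi ((1 - \<theta>) *\<^sub>R a + \<theta> *\<^sub>R b) / ((1 - \<theta>) *\<^sub>R a + \<theta> *\<^sub>R b))
        \<le> (1 - \<theta>) * ln (phi a / a) + \<theta> * ln (phi b / b)"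
      by (simp add: c_def)
  qed simp
qed

text \<open>
  If \<open>phi\<close> vanishes at a single \<open>s > 0\<close>, then \<open>xi 1 = 0\<close> almost surely and \<open>phi\<close> vanishes
  identically.
\<close>

lemma phi_pos:
  assumes ex: "\<exists>l\<ge>0. phi l \<noteq> 0" and s: "0 < s"
  shows "0 < phi s"
proof (rule ccontr)
  assume "\<not> 0 < phi s"
  then have "phi s = 0" using phi_nonneg[of s] s by simp
  then have "laplace s 1 = 1" using s by (simp add: laplace_eq)
  then have "(\<integral>\<omega>. 1 - exp_neg s (xi 1 \<omega>) \<partial>M) = 0"
    using s exp_neg_xi_integrable[of s 1] by (simp add: laplace_def prob_space)
  then have "AE \<omega> in M. 1 - exp_neg s (xi 1 \<omega>) = 0"
    using s exp_neg_xi_integrable[of s 1] exp_neg_le_1[of s]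
    by (subst (asm) integral_nonneg_eq_0_iff_AE) auto
  then have "AE \<omega> in M. xi 1 \<omega> = 0"
    by eventually_elim (use s in \<open>auto simp: exp_neg_def enn2real_eq_0_iff split: if_splits\<close>)
  then have "laplace l 1 = (\<integral>\<omega>. 1 \<partial>M)" for l
    unfolding laplace_def by (intro integral_cong_AE) auto
  then have "phi l = 0" for l by (simp add: phi_eq prob_space)
  with ex show False by simp
qed

theorem webster_phi:
  assumes "\<exists>l\<ge>0. phi l \<noteq> 0"
  shows "webster_conditions phi"
  using phi_pos[OF assms] phi_mono phi_concave by (intro concave_on_imp_webster) auto

theorem webster_conjugate_phi:
  assumes ex: "\<exists>l\<ge>0. phi l \<noteq> 0"
  shows "webster_conditions (conjugate_exponent phi)"
  unfolding webster_conditions_def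
proof (intro conjI allI impI)
  note pos = phi_pos[OF ex]
  show "0 < conjugate_exponent phi s" if "0 < s" for s using pos[OF that] that by (simp add: conjugate_exponent_def)
  have "convex_on {0<..} (\<lambda>s. - ln (conjugate_exponent phi s))"
    using phi_quotient_log_convex[OF pos]
  proof (rule convex_on_eqI)
    show "ln (phi s / s) = - ln (conjugate_exponent phi s)" if "s \<in> {0<..}" for s
      using that pos[of s] by (simp add: conjugate_exponent_def ln_div)
  qed
  then show "concave_on {0<..} (\<lambda>s. ln (conjugate_exponent phi s))" by (simp add: concave_on_def)
  fix c :: real assume c: "0 < c"
  have "((\<lambda>s. ((s + c) / s) / (phi (s + c) / phi s)) \<longlongrightarrow> 1 / 1) at_top"
    using c webster_phi[OF ex] by (intro tendsto_divide ratio_shift_tendsto) (auto simp: webster_conditions_def)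
  then show "((\<lambda>s. conjugate_exponent phi (s + c) / conjugate_exponent phi s) \<longlongrightarrow> 1) at_top"
    by (simp add: conjugate_exponent_def mult.commute)
qed

definition X :: "real \<Rightarrow> 'a \<Rightarrow> real" where "X t \<omega> = (if 0 \<le> t then exp_neg 1 (xi t \<omega>) else 0)"

lemma exp_neg_xi_rc:
  assumes \<omega>: "\<omega> \<in> space M" and t: "0 \<le> t"
  shows "continuous (at_right t) (\<lambda>u. exp_neg p (xi u \<omega>))"
proof -
  have lim: "((\<lambda>u. xi u \<omega>) \<longlongrightarrow> xi t \<omega>) (at_right t)" using xi_rc[OF \<omega> t] by (simp add: continuous_within)
  have "((\<lambda>u. exp_neg p (xi u \<omega>)) \<longlongrightarrow> exp_neg p (xi t \<omega>)) (at_right t)"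
  proof (cases "xi t \<omega> = \<infinity>")
    case True
    have "eventually (\<lambda>u. exp_neg p (xi u \<omega>) = exp_neg p (xi t \<omega>)) (at_right t)"
      using eventually_at_right_less[of t]
    proof eventually_elim
      case (elim u)
      have "xi t \<omega> \<le> xi u \<omega>" using \<omega> t elim by (intro xi_mono) auto
      with True show ?case by (simp add: top_unique)
    qed
    then show ?thesis by (rule tendsto_eventually)
  next
    case False
    with lim show ?thesis by (rule tendsto_exp_neg)
  qed
  then show ?thesis by (simp add: continuous_within)
qed

lemma X_rc: "\<omega> \<in> space M \<Longrightarrow> 0 \<le> t \<Longrightarrow> continuous (at_right t) (\<lambda>u. X u \<omega>)"
proof -
  assume \<omega>: "\<omega> \<in> space M" and t: "0 \<le> t"
  have "((\<lambda>u. exp_neg 1 (xi u \<omega>)) \<longlongrightarrow> exp_neg 1 (xi t \<omega>)) (at_right t)"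
    using exp_neg_xi_rc[OF \<omega> t] by (simp add: continuous_within)
  moreover have "eventually (\<lambda>u. exp_neg 1 (xi u \<omega>) = X u \<omega>) (at_right t)"
    using eventually_at_right_less[of t] by eventually_elim (use t in \<open>simp add: X_def\<close>)
  ultimately have "((\<lambda>u. X u \<omega>) \<longlongrightarrow> exp_neg 1 (xi t \<omega>)) (at_right t)"
    by (rule Lim_transform_eventually)
  then show ?thesis using t by (simp add: continuous_within X_def)
qed

lemma X_joint [measurable]: "(\<lambda>p. X (fst p) (snd p)) \<in> borel_measurable (borel \<Otimes>\<^sub>M M)"
  using right_continuous_jointly_measurable[of "\<lambda>t \<omega>. exp_neg 1 (xi t \<omega>)" M] exp_neg_xi_rc
  by (simp add: X_def)

lemma multiplicative_process_X:
  assumes ex: "\<exists>l\<ge>0. phi l \<noteq> 0"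
  shows "multiplicative_process M X (\<lambda>t. borel_measurable (F t)) phi"
proof
  fix t u h p r :: real and w :: "'a \<Rightarrow> ennreal" and \<omega>
  show "(\<lambda>p. X (fst p) (snd p)) \<in> borel_measurable (borel \<Otimes>\<^sub>M M)" by (rule X_joint)
  show "0 \<le> X t \<omega>" "t < 0 \<Longrightarrow> X t \<omega> = 0" by (auto simp: X_def)
  show "X u \<omega> \<le> X t \<omega>" if "\<omega> \<in> space M" "0 \<le> t" "t \<le> u"
    using that by (auto simp: X_def intro!: exp_neg_antimono xi_mono)
  show "continuous (at_right t) (\<lambda>u. X u \<omega>)" if "\<omega> \<in> space M" "0 \<le> t"
    using that by (rule X_rc)
  show "AE \<omega> in M. X 0 \<omega> = 1" by (auto simp: X_def xi_0)
  show "w \<in> borel_measurable M" if "w \<in> borel_measurable (F t)" using that by (rule F_measurable_M)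
  have XF: "X v \<in> borel_measurable (F u)" if "0 \<le> v" "v \<le> u" for u v
    using exp_neg_xi_F[OF that, of 1] that by (simp add: X_def[abs_def])
  show "(\<lambda>\<omega>. w \<omega> * ennreal (X u \<omega>)) \<in> borel_measurable (F u)" if "0 \<le> t" "t \<le> u" "w \<in> borel_measurable (F t)"
  proof -
    have [measurable]: "X u \<in> borel_measurable (F u)" using that by (intro XF) auto
    have [measurable]: "w \<in> borel_measurable (F u)" by (rule F_measurable_mono[OF that(2,3)])
    show ?thesis by measurable
  qed
  show "(\<lambda>\<omega>. ennreal (X t \<omega> powr r)) \<in> borel_measurable (F t)" if "0 \<le> t"
  proof -
    have [measurable]: "X t \<in> borel_measurable (F t)" using that by (intro XF) auto
    show ?thesis by measurable
  qed
  show "(\<integral>\<^sup>+\<omega>. w \<omega> * ennreal (X (t + h) \<omega> powr p) \<partial>M)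
      = ennreal (exp (- (h * phi p))) * (\<integral>\<^sup>+\<omega>. w \<omega> * ennreal (X t \<omega> powr p) \<partial>M)"
    if "0 \<le> t" "0 \<le> h" "0 < p" "w \<in> borel_measurable (F t)"
    using exp_neg_markov[of t h p w] that by (simp add: X_def exp_neg_powr[symmetric])
  show "0 < phi p" if "0 < p" using ex that by (rule phi_pos)
  show "phi 1 \<le> phi p" if "1 \<le> p" using that by (intro phi_mono) auto
qed

end

section \<open>The exponential functional and the remainder\<close>

lemma standard_exponential_moments:
  assumes s: "-1 < s"
  shows "(\<integral>\<^sup>+x. ennreal (x powr s) \<partial>density lborel (exponential_density 1)) = ennreal (Gamma (s + 1))"
proof -
  have "(\<integral>\<^sup>+x. ennreal (x powr s) \<partial>density lborel (exponential_density 1))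
      = (\<integral>\<^sup>+x. ennreal (exponential_density 1 x) * ennreal (x powr s) \<partial>lborel)"
    by (subst nn_integral_density) auto
  also have "\<dots> = (\<integral>\<^sup>+x. ennreal (indicator {0..} x * x powr (s + 1 - 1) / exp x) \<partial>lborel)"
    by (intro nn_integral_cong)
       (auto simp: exponential_density_def ennreal_mult[symmetric] exp_minus field_simps split: split_indicator)
  also have "\<dots> = ennreal (Gamma (s + 1))"
    using s by (subst Gamma_conv_nn_integral_real) auto
  finally show ?thesis .
qed

lemma nn_integral_times:
  assumes "prob_space M" "prob_space N" and [measurable]: "f \<in> borel_measurable M" "g \<in> borel_measurable N"
  shows "(\<integral>\<^sup>+p. f (fst p) * g (snd p) \<partial>(M \<Otimes>\<^sub>M N)) = (\<integral>\<^sup>+x. f x \<partial>M) * (\<integral>\<^sup>+y. g y \<partial>N)"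
proof -
  interpret M: prob_space M by fact
  interpret N: prob_space N by fact
  have "(\<integral>\<^sup>+p. f (fst p) * g (snd p) \<partial>(M \<Otimes>\<^sub>M N)) = (\<integral>\<^sup>+x. \<integral>\<^sup>+y. f x * g y \<partial>N \<partial>M)"
    by (subst N.nn_integral_fst[symmetric]) auto
  also have "\<dots> = (\<integral>\<^sup>+x. f x * (\<integral>\<^sup>+y. g y \<partial>N) \<partial>M)"
    by (intro nn_integral_cong nn_integral_cmult) auto
  also have "\<dots> = (\<integral>\<^sup>+x. f x \<partial>M) * (\<integral>\<^sup>+y. g y \<partial>N)"
    by (rule nn_integral_multc) auto
  finally show ?thesis .
qed

context multiplicative_process
begin

text \<open>
  Independence is realized on the product space. The positive part of \<open>R\<close> replaces \<open>R\<close> so that powers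
  of the product factor everywhere.
\<close>

lemma remainder_factorization:
  assumes R: "remainder_variable psi N R"
  shows "distr (Q \<Otimes>\<^sub>M N) borel (\<lambda>p. J 0 (fst p) * max 0 (R (snd p))) = density lborel (exponential_density 1)"
    (is "?A = ?B")
proof -
  have N: "prob_space N" and [measurable]: "R \<in> borel_measurable N" and pos: "AE x in N. 0 < R x"
    using R by (auto simp: remainder_variable_def)
  interpret N: prob_space N by (rule N)
  have mom: "(\<integral>\<^sup>+x. ennreal (max 0 (R x) ^ n) \<partial>N) = ennreal (\<Prod>i=1..n. psi (real i))" for n
  proof (cases "n = 0")
    case True
    then show ?thesis by (simp add: N.emeasure_space_1)
  next
    case False
    have int: "integrable N (\<lambda>x. R x ^ n)" and eq: "(\<integral>x. R x ^ n \<partial>N) = (\<Prod>i=1..n. psi (real i))"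
      using R False by (auto simp: remainder_variable_def)
    have "(\<integral>\<^sup>+x. ennreal (max 0 (R x) ^ n) \<partial>N) = (\<integral>\<^sup>+x. ennreal (R x ^ n) \<partial>N)"
      using pos by (intro nn_integral_cong_AE) (auto elim: eventually_mono)
    also have "\<dots> = ennreal (\<integral>x. R x ^ n \<partial>N)"
      using pos by (intro nn_integral_eq_integral int) (auto elim: eventually_mono)
    finally show ?thesis by (simp add: eq)
  qed
  show ?thesis
  proof (rule moment_determinacy_nonneg[where m = fact and K = 1 and C = 1])
    fix n
    have "(\<integral>\<^sup>+x. ennreal (x ^ n) \<partial>?A) = (\<integral>\<^sup>+p. ennreal (J 0 (fst p) ^ n) * ennreal (max 0 (R (snd p)) ^ n) \<partial>(Q \<Otimes>\<^sub>M N))"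
      by (subst nn_integral_distr) (auto simp: power_mult_distrib ennreal_mult)
    also have "\<dots> = (\<integral>\<^sup>+\<omega>. ennreal (J 0 \<omega> ^ n) \<partial>Q) * (\<integral>\<^sup>+x. ennreal (max 0 (R x) ^ n) \<partial>N)"
      by (rule nn_integral_times) (auto intro: prob_space_axioms N)
    also have "\<dots> = ennreal (moment n * (\<Prod>i=1..n. psi (real i)))"
      unfolding J_0_moments mom by (rule ennreal_mult[symmetric]) (auto intro!: prod_nonneg moment_nonneg less_imp_le[OF psi_pos])
    also have "moment n * (\<Prod>i=1..n. psi (real i)) = fact n"
    proof -
      define P where "P = (\<Prod>i=1..n. psi (real i))"
      have "0 < P" unfolding P_def by (intro prod_pos psi_pos) auto
      then show ?thesis unfolding moment_def P_def[symmetric] by simp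
    qed
    finally show "(\<integral>\<^sup>+x. ennreal (x ^ n) \<partial>?A) = ennreal (fact n)" .
    have "AE x in ?B. x ^ n = x powr real n"
    proof -
      have "AE x in lborel. x \<noteq> (0::real)" by (rule AE_lborel_singleton)
      then show ?thesis by (subst AE_density) (auto simp: exponential_density_def powr_realpow elim: eventually_mono)
    qed
    then have "(\<integral>\<^sup>+x. ennreal (x ^ n) \<partial>?B) = (\<integral>\<^sup>+x. ennreal (x powr real n) \<partial>?B)"
      by (intro nn_integral_cong_AE) auto
    also have "\<dots> = ennreal (Gamma (real n + 1))" by (rule standard_exponential_moments) simp
    finally show "(\<integral>\<^sup>+x. ennreal (x ^ n) \<partial>?B) = ennreal (fact n)"
      by (simp add: Gamma_fact add.commute)
    show "AE x in ?A. 0 \<le> x" by (subst AE_distr_iff) auto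
    show "AE x in ?B. 0 \<le> x" by (subst AE_density) (auto simp: exponential_density_def)
  qed auto
qed

text \<open>
  The moment of order \<open>s\<close> of the standard exponential law is the product of the moments of its two
  independent factors.
\<close>

theorem remainder_moments:
  assumes R: "remainder_variable psi N R" and s: "-1 < s"
  shows "integrable N (\<lambda>x. R x powr s)" and "(\<integral>x. R x powr s \<partial>N) = Gamma (s + 1) / mellin s"
proof -
  have N: "prob_space N" and [measurable]: "R \<in> borel_measurable N" and pos: "AE x in N. 0 < R x"
    using R by (auto simp: remainder_variable_def)
  define r where "r = (\<integral>\<^sup>+x. ennreal (R x powr s) \<partial>N)"
  have r: "r = (\<integral>\<^sup>+x. ennreal (max 0 (R x) powr s) \<partial>N)"
    unfolding r_def using pos by (intro nn_integral_cong_AE) (auto elim: eventually_mono)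
  have "ennreal (Gamma (s + 1))
      = (\<integral>\<^sup>+x. ennreal (x powr s) \<partial>distr (Q \<Otimes>\<^sub>M N) borel (\<lambda>p. J 0 (fst p) * max 0 (R (snd p))))"
    unfolding remainder_factorization[OF R] by (rule standard_exponential_moments[OF s, symmetric])
  also have "\<dots> = (\<integral>\<^sup>+p. ennreal (J 0 (fst p) powr s) * ennreal (max 0 (R (snd p)) powr s) \<partial>(Q \<Otimes>\<^sub>M N))"
    by (subst nn_integral_distr) (auto simp: powr_mult ennreal_mult)
  also have "\<dots> = (\<integral>\<^sup>+\<omega>. ennreal (J 0 \<omega> powr s) \<partial>Q) * (\<integral>\<^sup>+x. ennreal (max 0 (R x) powr s) \<partial>N)"
    by (rule nn_integral_times) (auto intro: prob_space_axioms N)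
  also have "\<dots> = ennreal (mellin s) * r" unfolding r using s by (simp add: mellin_nn)
  finally have eq: "ennreal (Gamma (s + 1)) = ennreal (mellin s) * r" .
  have pm: "0 < mellin s" using s by (rule mellin_pos)
  have G: "0 < Gamma (s + 1)" using s by (intro Gamma_real_pos) simp
  have fin: "r \<noteq> \<infinity>"
  proof
    assume "r = \<infinity>"
    with eq pm show False by (simp add: ennreal_mult_top)
  qed
  then obtain x where x: "r = ennreal x" "0 \<le> x" by (cases r) auto
  from eq have "Gamma (s + 1) = mellin s * x"
    unfolding x(1) using x(2) pm G by (simp add: ennreal_mult[symmetric])
  then have "x = Gamma (s + 1) / mellin s" using pm by simp
  with x show "(\<integral>x. R x powr s \<partial>N) = Gamma (s + 1) / mellin s"
    unfolding r_def by (subst integral_eq_nn_integral) auto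
  show "integrable N (\<lambda>x. R x powr s)"
    using fin by (intro integrableI_nonneg) (auto simp: r_def less_top)
qed

lemma mellin_nat: "mellin (real n) = moment n"
proof -
  have "ennreal (mellin (real n)) = (\<integral>\<^sup>+\<omega>. ennreal (J 0 \<omega> powr real n) \<partial>Q)" by (simp add: mellin_nn)
  also have "\<dots> = (\<integral>\<^sup>+\<omega>. ennreal (J 0 \<omega> ^ n) \<partial>Q)"
    using J_0_pos by (intro nn_integral_cong_AE) (auto simp: powr_realpow elim: eventually_mono)
  finally show ?thesis using mellin_pos[of "real n"] moment_nonneg[of n] by (simp add: J_0_moments)
qed

end

lemma enn2real_nn_integral_eq_set_integral:
  assumes "\<And>u. u \<in> A \<Longrightarrow> 0 \<le> f u" and "set_borel_measurable lborel A f"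
  shows "(LINT u:A|lborel. f u) = enn2real (\<integral>\<^sup>+u. ennreal (f u) * indicator A u \<partial>lborel)"
proof -
  have "(LINT u:A|lborel. f u) = enn2real (\<integral>\<^sup>+u. ennreal (indicator A u *\<^sub>R f u) \<partial>lborel)"
    unfolding set_lebesgue_integral_def using assms
    by (intro integral_eq_nn_integral) (auto simp: set_borel_measurable_def split: split_indicator)
  also have "(\<integral>\<^sup>+u. ennreal (indicator A u *\<^sub>R f u) \<partial>lborel) = (\<integral>\<^sup>+u. ennreal (f u) * indicator A u \<partial>lborel)"
    by (intro nn_integral_cong) (auto split: split_indicator)
  finally show ?thesis .
qed

context subordinator
begin

lemma xi_path_set_measurable:
  assumes \<omega>: "\<omega> \<in> space M" and A: "A \<subseteq> {0..}" "A \<in> sets borel"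
  shows "set_borel_measurable lborel A (\<lambda>u. exp_neg 1 (xi u \<omega>))"
proof -
  have "(\<lambda>u. X (fst (u, \<omega>)) (snd (u, \<omega>))) \<in> borel_measurable borel"
    using \<omega> by measurable
  then have [measurable]: "(\<lambda>u. X u \<omega>) \<in> borel_measurable borel" by simp
  have "(\<lambda>u. indicator A u *\<^sub>R exp_neg 1 (xi u \<omega>)) = (\<lambda>u. indicator A u *\<^sub>R X u \<omega>)"
    using A(1) by (intro ext) (auto simp: X_def split: split_indicator)
  moreover have "(\<lambda>u. indicator A u *\<^sub>R X u \<omega>) \<in> borel_measurable lborel" using A(2) by measurable
  ultimately show ?thesis by (simp add: set_borel_measurable_def)
qed

lemma exp_functional_eq:
  assumes ex: "\<exists>l\<ge>0. phi l \<noteq> 0" and \<omega>: "\<omega> \<in> space M"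
  shows "exp_functional xi \<omega> = multiplicative_process.J X 0 \<omega>"
proof -
  interpret P: multiplicative_process M X "\<lambda>t. borel_measurable (F t)" phi
    by (rule multiplicative_process_X[OF ex])
  have "exp_functional xi \<omega> = enn2real (\<integral>\<^sup>+u. ennreal (exp_neg 1 (xi u \<omega>)) * indicator {0..} u \<partial>lborel)"
    unfolding exp_functional_def
    by (intro enn2real_nn_integral_eq_set_integral xi_path_set_measurable \<omega>) auto
  also have "\<dots> = P.J 0 \<omega>"
    unfolding P.J_def by (intro arg_cong[where f = enn2real] nn_integral_cong) (auto simp: X_def split: split_indicator)
  finally show ?thesis .
qed

theorem exp_functional_and_remainder_moments:
  assumes ex: "\<exists>l\<ge>0. phi l \<noteq> 0" and R: "remainder_variable phi N R" and s: "-1 < s"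
  shows "integrable N (\<lambda>x. R x powr s)"
    and "(\<integral>x. R x powr s \<partial>N) = gen_Gamma phi (s + 1)"
    and "integrable M (\<lambda>\<omega>. exp_functional xi \<omega> powr s)"
    and "(\<integral>\<omega>. exp_functional xi \<omega> powr s \<partial>M) = gen_Gamma (conjugate_exponent phi) (s + 1)"
    and "gen_Gamma (conjugate_exponent phi) (s + 1) = Gamma (s + 1) / gen_Gamma phi (s + 1)"
proof -
  interpret P: multiplicative_process M X "\<lambda>t. borel_measurable (F t)" phi
    by (rule multiplicative_process_X[OF ex])
  note J = exp_functional_eq[OF ex]
  have conj: "gen_Gamma (conjugate_exponent phi) (s + 1) = P.mellin s"
    by (intro P.mellin_eq_gen_Gamma webster_phi[OF ex] webster_conjugate_phi[OF ex] s)
  have phi: "gen_Gamma phi (s + 1) = Gamma (s + 1) / P.mellin s"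
    by (intro P.Gamma_divide_mellin_eq_gen_Gamma webster_phi[OF ex] s)
  show "integrable N (\<lambda>x. R x powr s)" by (rule P.remainder_moments[OF R s])
  show "(\<integral>x. R x powr s \<partial>N) = gen_Gamma phi (s + 1)"
    unfolding phi by (rule P.remainder_moments[OF R s])
  show "integrable M (\<lambda>\<omega>. exp_functional xi \<omega> powr s)"
    using P.J_powr_integrable[OF s] by (simp add: J cong: Bochner_Integration.integrable_cong)
  show "(\<integral>\<omega>. exp_functional xi \<omega> powr s \<partial>M) = gen_Gamma (conjugate_exponent phi) (s + 1)"
    unfolding conj P.mellin_def by (simp add: J cong: Bochner_Integration.integral_cong)
  have "0 < P.mellin s" "0 < Gamma (s + 1)" using s by (auto intro: P.mellin_pos Gamma_real_pos)
  then show "gen_Gamma (conjugate_exponent phi) (s + 1) = Gamma (s + 1) / gen_Gamma phi (s + 1)"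
    unfolding conj phi by simp
qed

end

section \<open>Stopping at an independent exponential time\<close>

locale killed_at_exponential_time = subordinator +
  fixes \<alpha> :: real and e :: "'a \<Rightarrow> real" and \<mu> :: real
  assumes \<alpha>: "0 < \<alpha>" and e: "independent_exponential_time M xi \<alpha> e" and \<mu>: "0 \<le> \<mu>"
begin

definition Finf :: "'a measure" where "Finf = process_sigma M xi {0..}"

lemma e_measurable [measurable]: "e \<in> borel_measurable M"
  using e by (auto simp: independent_exponential_time_def distributed_def)

lemma e_nonneg: "\<omega> \<in> space M \<Longrightarrow> 0 \<le> e \<omega>"
  using e by (auto simp: independent_exponential_time_def)

lemma space_Finf [simp]: "space Finf = space M" by (simp add: Finf_def)

lemma Finf_subalgebra: "subalgebra M Finf"
  unfolding subalgebra_def Finf_def using process_sigma_subset[of "{0..}" xi M] by auto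

lemma F_Finf:
  assumes "w \<in> borel_measurable (F t)"
  shows "w \<in> borel_measurable Finf"
proof -
  have "sets (F t) \<subseteq> sets Finf" unfolding F_def Finf_def by (rule process_sigma_mono) auto
  then have "subalgebra Finf (F t)" by (simp add: subalgebra_def)
  then show ?thesis using assms by (rule measurable_from_subalg)
qed

text \<open>
  Independence of the time and the whole process, stated as a product law of the pair (time, outcome)
  where outcomes only carry the sigma-algebra of the process. In this form any jointly measurable
  functional of time and path can be integrated by Fubini.
\<close>

lemma law_time_and_path:
  "distr M (borel \<Otimes>\<^sub>M Finf) (\<lambda>\<omega>. (e \<omega>, \<omega>)) = density lborel (exponential_density \<alpha>) \<Otimes>\<^sub>M restr_to_subalg M Finf"
proof (rule pair_measure_eqI[symmetric])
  let ?D = "density lborel (exponential_density \<alpha>)" and ?M = "restr_to_subalg M Finf"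
  have D: "distr M borel e = ?D"
    using e by (auto simp: independent_exponential_time_def distributed_def cong: distr_cong)
  interpret D: prob_space ?D unfolding D[symmetric] by (rule prob_space_distr) simp
  interpret M': prob_space ?M
    by (rule prob_spaceI)
       (use Finf_subalgebra in \<open>simp add: space_restr_to_subalg emeasure_restr_to_subalg emeasure_space_1 sets.top[of Finf, simplified]\<close>)
  show "sigma_finite_measure ?D" ..
  show "sigma_finite_measure ?M" ..
  show "sets (?D \<Otimes>\<^sub>M ?M) = sets (distr M (borel \<Otimes>\<^sub>M Finf) (\<lambda>\<omega>. (e \<omega>, \<omega>)))"
    using Finf_subalgebra by (auto intro!: sets_pair_measure_cong simp: sets_restr_to_subalg)
  have id: "(\<lambda>\<omega>. \<omega>) \<in> measurable M Finf"
    using Finf_subalgebra by (auto intro!: measurableI dest: sets.sets_into_space simp: subalgebra_def Int_absorb2)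
  fix A B assume A: "A \<in> sets ?D" and B': "B \<in> sets ?M"
  then have A: "A \<in> sets borel" and B: "B \<in> sets Finf"
    using Finf_subalgebra by (auto simp: sets_restr_to_subalg)
  have indep: "indep_set {e -` B \<inter> space M | B. B \<in> sets borel} (sets Finf)"
    using e by (simp add: independent_exponential_time_def Finf_def)
  have "emeasure ?D A * emeasure ?M B = emeasure M (e -` A \<inter> space M) * emeasure M B"
    using A B Finf_subalgebra by (simp add: D[symmetric] emeasure_distr emeasure_restr_to_subalg)
  also have "\<dots> = emeasure M ((e -` A \<inter> space M) \<inter> B)"
  proof -
    have "measure M ((e -` A \<inter> space M) \<inter> B) = measure M (e -` A \<inter> space M) * measure M B"
      by (rule indep_setD[OF indep]) (use A B in blast)+
    then show ?thesis by (simp add: emeasure_eq_measure ennreal_mult)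
  qed
  also have "(e -` A \<inter> space M) \<inter> B = (\<lambda>\<omega>. (e \<omega>, \<omega>)) -` (A \<times> B) \<inter> space M" by auto
  also have "emeasure M \<dots> = emeasure (distr M (borel \<Otimes>\<^sub>M Finf) (\<lambda>\<omega>. (e \<omega>, \<omega>))) (A \<times> B)"
    using A B id by (subst emeasure_distr) auto
  finally show "emeasure ?D A * emeasure ?M B = emeasure (distr M (borel \<Otimes>\<^sub>M Finf) (\<lambda>\<omega>. (e \<omega>, \<omega>))) (A \<times> B)" .
qed

lemma nn_integral_at_e:
  assumes G: "(\<lambda>p. G (fst p) (snd p)) \<in> borel_measurable (borel \<Otimes>\<^sub>M Finf)"
  shows "(\<integral>\<^sup>+\<omega>. G (e \<omega>) \<omega> \<partial>M) = (\<integral>\<^sup>+r. ennreal (exponential_density \<alpha> r) * (\<integral>\<^sup>+\<omega>. G r \<omega> \<partial>M) \<partial>lborel)"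
proof -
  let ?D = "density lborel (exponential_density \<alpha>)" and ?M = "restr_to_subalg M Finf"
  interpret M': prob_space ?M
    by (rule prob_spaceI)
       (use Finf_subalgebra in \<open>simp add: space_restr_to_subalg emeasure_restr_to_subalg emeasure_space_1 sets.top[of Finf, simplified]\<close>)
  have id: "(\<lambda>\<omega>. \<omega>) \<in> measurable M Finf"
    using Finf_subalgebra by (auto intro!: measurableI dest: sets.sets_into_space simp: subalgebra_def Int_absorb2)
  have sets: "sets (?D \<Otimes>\<^sub>M ?M) = sets (borel \<Otimes>\<^sub>M Finf)"
    using Finf_subalgebra by (intro sets_pair_measure_cong) (auto simp: sets_restr_to_subalg)
  have G': "(\<lambda>p. G (fst p) (snd p)) \<in> borel_measurable (?D \<Otimes>\<^sub>M ?M)"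
    using G by (simp add: measurable_cong_sets[OF sets refl])
  have G'': "(\<lambda>p. G (fst p) (snd p)) \<in> borel_measurable (lborel \<Otimes>\<^sub>M ?M)"
  proof -
    have eq: "sets (lborel \<Otimes>\<^sub>M ?M) = sets (borel \<Otimes>\<^sub>M Finf)"
      using Finf_subalgebra by (intro sets_pair_measure_cong) (auto simp: sets_restr_to_subalg)
    show ?thesis by (subst measurable_cong_sets[OF eq refl]) (rule G)
  qed
  have G_r: "G r \<in> borel_measurable Finf" for r
  proof -
    have "(\<lambda>\<omega>. G (fst (r, \<omega>)) (snd (r, \<omega>))) \<in> borel_measurable Finf"
      by (rule measurable_compose[OF _ G]) measurable
    then show ?thesis by simp
  qed
  have "(\<integral>\<^sup>+\<omega>. G (e \<omega>) \<omega> \<partial>M) = (\<integral>\<^sup>+p. G (fst p) (snd p) \<partial>distr M (borel \<Otimes>\<^sub>M Finf) (\<lambda>\<omega>. (e \<omega>, \<omega>)))"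
    using id G by (subst nn_integral_distr) auto
  also have "\<dots> = (\<integral>\<^sup>+r. \<integral>\<^sup>+\<omega>. G r \<omega> \<partial>?M \<partial>?D)"
    unfolding law_time_and_path by (subst M'.nn_integral_fst[OF G', symmetric]) simp
  also have "\<dots> = (\<integral>\<^sup>+r. ennreal (exponential_density \<alpha> r) * (\<integral>\<^sup>+\<omega>. G r \<omega> \<partial>?M) \<partial>lborel)"
    using M'.borel_measurable_nn_integral_fst[OF G''] by (subst nn_integral_density) auto
  also have "\<dots> = (\<integral>\<^sup>+r. ennreal (exponential_density \<alpha> r) * (\<integral>\<^sup>+\<omega>. G r \<omega> \<partial>M) \<partial>lborel)"
    using nn_integral_subalgebra2[OF Finf_subalgebra G_r] by simp
  finally show ?thesis .
qed

lemma exp_neg_xi_joint_Finf: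
  "(\<lambda>p. if 0 \<le> fst p then exp_neg p' (xi (fst p) (snd p)) else 0) \<in> borel_measurable (borel \<Otimes>\<^sub>M Finf)"
proof (rule right_continuous_jointly_measurable[where X = "\<lambda>t \<omega>. exp_neg p' (xi t \<omega>)"])
  show "(\<lambda>\<omega>. exp_neg p' (xi t \<omega>)) \<in> borel_measurable Finf" if "0 \<le> t" for t
    by (rule F_Finf[OF exp_neg_xi_F[OF that order.refl]])
  show "continuous (at_right t) (\<lambda>u. exp_neg p' (xi u \<omega>))" if "0 \<le> t" "\<omega> \<in> space Finf" for t \<omega>
    using that by (intro exp_neg_xi_rc) auto
qed

abbreviation psi :: "real \<Rightarrow> real" where "psi \<equiv> shifted_exponent phi \<mu> \<alpha>"

definition weight_mean :: real where "weight_mean = \<alpha> / (\<alpha> + phi \<mu>)"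

lemma weight_mean_pos: "0 < weight_mean"
  using \<alpha> phi_nonneg[OF \<mu>] by (simp add: weight_mean_def)

text \<open>
  Condition on \<open>e = r > u\<close>: the Markov property from \<open>u\<close> to \<open>r\<close> contributes
  \<open>exp (- (r - u) * phi \<mu>)\<close>, and integrating against the exponential density gives the constant.
\<close>

lemma nn_integral_exp_neg_at_e:
  assumes u: "0 \<le> u" and p: "0 \<le> p" and v: "v \<in> borel_measurable (F u)"
  shows "(\<integral>\<^sup>+\<omega>. v \<omega> * ennreal (exp_neg p (xi u \<omega>)) * indicator {\<omega>. u < e \<omega>} \<omega> * ennreal (exp_neg \<mu> (xi (e \<omega>) \<omega>)) \<partial>M)
    = ennreal (weight_mean * exp (- (\<alpha> * u))) * (\<integral>\<^sup>+\<omega>. v \<omega> * ennreal (exp_neg (p + \<mu>) (xi u \<omega>)) \<partial>M)"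
proof -
  define K where "K = (\<integral>\<^sup>+\<omega>. v \<omega> * ennreal (exp_neg (p + \<mu>) (xi u \<omega>)) \<partial>M)"
  define k where "k = (\<lambda>\<omega>. v \<omega> * ennreal (exp_neg p (xi u \<omega>)))"
  define G where "G = (\<lambda>r \<omega>. k \<omega> * (if u < r then 1 else 0) * ennreal (if 0 \<le> r then exp_neg \<mu> (xi r \<omega>) else 0))"
  have k: "k \<in> borel_measurable (F u)"
    unfolding k_def using v exp_neg_xi_F[OF u order.refl, of p] by measurable
  have [measurable]: "k \<in> borel_measurable Finf" using k by (rule F_Finf)
  note [measurable] = exp_neg_xi_joint_Finf
  have G: "(\<lambda>p. G (fst p) (snd p)) \<in> borel_measurable (borel \<Otimes>\<^sub>M Finf)"
    unfolding G_def by measurable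
  have "(\<integral>\<^sup>+\<omega>. v \<omega> * ennreal (exp_neg p (xi u \<omega>)) * indicator {\<omega>. u < e \<omega>} \<omega> * ennreal (exp_neg \<mu> (xi (e \<omega>) \<omega>)) \<partial>M)
    = (\<integral>\<^sup>+\<omega>. G (e \<omega>) \<omega> \<partial>M)"
    using u by (intro nn_integral_cong) (auto simp: G_def k_def split: split_indicator)
  also have "\<dots> = (\<integral>\<^sup>+r. ennreal (exponential_density \<alpha> r) * (\<integral>\<^sup>+\<omega>. G r \<omega> \<partial>M) \<partial>lborel)"
    by (rule nn_integral_at_e[OF G])
  also have "\<dots> = (\<integral>\<^sup>+r. ennreal (\<alpha> * exp (- (\<alpha> * u))) * K * (ennreal (exp (- ((r - u) * (\<alpha> + phi \<mu>)))) * indicator {u..} r) \<partial>lborel)"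
  proof (rule nn_integral_cong_AE)
    have "AE r in lborel. r \<noteq> u" by (rule AE_lborel_singleton)
    then show "AE r in lborel. ennreal (exponential_density \<alpha> r) * (\<integral>\<^sup>+\<omega>. G r \<omega> \<partial>M)
      = ennreal (\<alpha> * exp (- (\<alpha> * u))) * K * (ennreal (exp (- ((r - u) * (\<alpha> + phi \<mu>)))) * indicator {u..} r)"
    proof eventually_elim
      case (elim r)
      show ?case
      proof (cases "u < r")
        case True
        have "(\<integral>\<^sup>+\<omega>. G r \<omega> \<partial>M) = (\<integral>\<^sup>+\<omega>. k \<omega> * ennreal (exp_neg \<mu> (xi (u + (r - u)) \<omega>)) \<partial>M)"
          using True u by (intro nn_integral_cong) (simp add: G_def)
        also have "\<dots> = ennreal (exp (- ((r - u) * phi \<mu>))) * (\<integral>\<^sup>+\<omega>. k \<omega> * ennreal (exp_neg \<mu> (xi u \<omega>)) \<partial>M)"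
          using True u k \<mu> by (intro exp_neg_markov) auto
        also have "(\<integral>\<^sup>+\<omega>. k \<omega> * ennreal (exp_neg \<mu> (xi u \<omega>)) \<partial>M) = K"
          unfolding K_def k_def
          by (intro nn_integral_cong) (simp add: mult.assoc ennreal_mult[symmetric] exp_neg_add)
        finally have Gr: "(\<integral>\<^sup>+\<omega>. G r \<omega> \<partial>M) = ennreal (exp (- ((r - u) * phi \<mu>))) * K" .
        have "exponential_density \<alpha> r * exp (- ((r - u) * phi \<mu>)) = (\<alpha> * exp (- (\<alpha> * u))) * exp (- ((r - u) * (\<alpha> + phi \<mu>)))"
          using True u by (simp add: exponential_density_def exp_add[symmetric] algebra_simps)
        then have "ennreal (exponential_density \<alpha> r) * ennreal (exp (- ((r - u) * phi \<mu>)))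
          = ennreal (\<alpha> * exp (- (\<alpha> * u))) * ennreal (exp (- ((r - u) * (\<alpha> + phi \<mu>))))"
          using \<alpha> exponential_density_nonneg[OF \<alpha>] by (subst (1 2) ennreal_mult[symmetric]) auto
        then show ?thesis using True by (simp add: Gr mult_ac)
      next
        case False
        with elim show ?thesis by (simp add: G_def)
      qed
    qed
  qed
  also have "\<dots> = ennreal (\<alpha> * exp (- (\<alpha> * u))) * K * ennreal (1 / (\<alpha> + phi \<mu>))"
    using \<alpha> phi_nonneg[OF \<mu>] by (subst nn_integral_cmult) (auto simp: nn_integral_exp_tail)
  also have "\<dots> = (ennreal (\<alpha> * exp (- (\<alpha> * u))) * ennreal (1 / (\<alpha> + phi \<mu>))) * K" by (simp only: mult_ac)
  also have "ennreal (\<alpha> * exp (- (\<alpha> * u))) * ennreal (1 / (\<alpha> + phi \<mu>)) = ennreal (weight_mean * exp (- (\<alpha> * u)))"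
    using \<alpha> phi_nonneg[OF \<mu>] by (subst ennreal_mult[symmetric]) (auto simp: weight_mean_def)
  finally show ?thesis unfolding K_def .
qed

definition weight :: "'a \<Rightarrow> real" where "weight \<omega> = exp_neg \<mu> (xi (e \<omega>) \<omega>)"

text \<open>
  The change of measure that absorbs the factor \<open>exp (- \<mu> * xi e)\<close> of the joint transform.
\<close>

definition Q :: "'a measure" where "Q = density M (\<lambda>\<omega>. ennreal (weight \<omega> / weight_mean))"

text \<open>
  The strict inequality \<open>t < e\<close> keeps the stopped path right-continuous.
\<close>

definition Y :: "real \<Rightarrow> 'a \<Rightarrow> real" where
  "Y t \<omega> = (if 0 \<le> t \<and> t < e \<omega> then exp_neg 1 (xi t \<omega>) else 0)"

lemma joint_measurable_at_e:
  fixes g :: "real \<Rightarrow> 'a \<Rightarrow> 'b :: {second_countable_topology, topological_space}"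
  assumes "(\<lambda>p. g (fst p) (snd p)) \<in> borel_measurable (borel \<Otimes>\<^sub>M Finf)"
  shows "(\<lambda>\<omega>. g (e \<omega>) \<omega>) \<in> borel_measurable M"
proof -
  have id: "(\<lambda>\<omega>. \<omega>) \<in> measurable M Finf"
    using Finf_subalgebra by (auto intro!: measurableI dest: sets.sets_into_space simp: subalgebra_def Int_absorb2)
  have "(\<lambda>\<omega>. g (fst (e \<omega>, \<omega>)) (snd (e \<omega>, \<omega>))) \<in> borel_measurable M"
    by (rule measurable_compose[OF _ assms]) (use id in measurable)
  then show ?thesis by simp
qed

lemma exp_neg_at_e_measurable: "(\<lambda>\<omega>. exp_neg p (xi (e \<omega>) \<omega>)) \<in> borel_measurable M"
proof -
  have "(\<lambda>\<omega>. if 0 \<le> e \<omega> then exp_neg p (xi (e \<omega>) \<omega>) else 0) \<in> borel_measurable M"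
    using joint_measurable_at_e[of "\<lambda>r \<omega>. if 0 \<le> r then exp_neg p (xi r \<omega>) else 0"] exp_neg_xi_joint_Finf by simp
  then show ?thesis by (rule measurable_cong[THEN iffD1, rotated]) (simp add: e_nonneg)
qed

lemma weight_measurable [measurable]: "weight \<in> borel_measurable M"
  unfolding weight_def[abs_def] by (rule exp_neg_at_e_measurable)

lemma weight_nonneg: "0 \<le> weight \<omega>" and weight_le_1: "weight \<omega> \<le> 1"
  using \<mu> by (auto simp: weight_def exp_neg_le_1)

lemma nn_integral_weight: "(\<integral>\<^sup>+\<omega>. ennreal (weight \<omega>) \<partial>M) = ennreal weight_mean"
proof -
  let ?G = "\<lambda>r \<omega>. ennreal (if 0 \<le> r then exp_neg \<mu> (xi r \<omega>) else 0)"
  note [measurable] = exp_neg_xi_joint_Finf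
  have "(\<integral>\<^sup>+\<omega>. ennreal (weight \<omega>) \<partial>M) = (\<integral>\<^sup>+\<omega>. ?G (e \<omega>) \<omega> \<partial>M)"
    by (intro nn_integral_cong) (simp add: weight_def e_nonneg)
  also have "\<dots> = (\<integral>\<^sup>+r. ennreal (exponential_density \<alpha> r) * (\<integral>\<^sup>+\<omega>. ?G r \<omega> \<partial>M) \<partial>lborel)"
    by (rule nn_integral_at_e) measurable
  also have "\<dots> = (\<integral>\<^sup>+r. ennreal \<alpha> * (ennreal (exp (- ((r - 0) * (\<alpha> + phi \<mu>)))) * indicator {0..} r) \<partial>lborel)"
  proof (intro nn_integral_cong)
    fix r :: real
    show "ennreal (exponential_density \<alpha> r) * (\<integral>\<^sup>+\<omega>. ?G r \<omega> \<partial>M)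
      = ennreal \<alpha> * (ennreal (exp (- ((r - 0) * (\<alpha> + phi \<mu>)))) * indicator {0..} r)"
    proof (cases "0 \<le> r")
      case True
      have "exponential_density \<alpha> r * exp (- (r * phi \<mu>)) = \<alpha> * exp (- ((r - 0) * (\<alpha> + phi \<mu>)))"
        using True by (simp add: exponential_density_def exp_add[symmetric] algebra_simps)
      then have "ennreal (exponential_density \<alpha> r) * ennreal (exp (- (r * phi \<mu>))) = ennreal \<alpha> * ennreal (exp (- ((r - 0) * (\<alpha> + phi \<mu>))))"
        using \<alpha> exponential_density_nonneg[OF \<alpha>] by (subst (1 2) ennreal_mult[symmetric]) auto
      with True show ?thesis using \<mu> by (simp add: laplace_nn laplace_eq)
    qed simp
  qed
  also have "\<dots> = ennreal \<alpha> * ennreal (1 / (\<alpha> + phi \<mu>))"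
    using \<alpha> phi_nonneg[OF \<mu>] by (subst nn_integral_cmult) (auto simp: nn_integral_exp_tail[of _ 0, simplified])
  also have "\<dots> = ennreal weight_mean"
    using \<alpha> phi_nonneg[OF \<mu>] by (subst ennreal_mult[symmetric]) (auto simp: weight_mean_def)
  finally show ?thesis .
qed

lemma nn_integral_Q:
  assumes [measurable]: "g \<in> borel_measurable M"
  shows "(\<integral>\<^sup>+\<omega>. g \<omega> \<partial>Q) = ennreal (1 / weight_mean) * (\<integral>\<^sup>+\<omega>. g \<omega> * ennreal (weight \<omega>) \<partial>M)"
proof -
  have "(\<integral>\<^sup>+\<omega>. g \<omega> \<partial>Q) = (\<integral>\<^sup>+\<omega>. ennreal (1 / weight_mean) * (g \<omega> * ennreal (weight \<omega>)) \<partial>M)"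
    unfolding Q_def
    using weight_mean_pos weight_nonneg ennreal_mult[of "1 / weight_mean" "weight _"]
    by (subst nn_integral_density) (auto intro!: nn_integral_cong simp: mult_ac)
  then show ?thesis by (subst (asm) nn_integral_cmult) auto
qed

lemma prob_space_Q: "prob_space Q"
proof (rule prob_spaceI)
  have "emeasure Q (space Q) = (\<integral>\<^sup>+\<omega>. 1 \<partial>Q)" by simp
  also have "\<dots> = ennreal (1 / weight_mean) * ennreal weight_mean" by (subst nn_integral_Q) (auto simp: nn_integral_weight)
  also have "\<dots> = 1" using weight_mean_pos by (simp add: ennreal_mult[symmetric])
  finally show "emeasure Q (space Q) = 1" .
qed

lemma e_pos: "AE \<omega> in M. 0 < e \<omega>"
proof -
  have "(\<integral>\<^sup>+\<omega>. (if e \<omega> \<le> 0 then 1 else 0) \<partial>M) = (\<integral>\<^sup>+r. ennreal (exponential_density \<alpha> r) * (\<integral>\<^sup>+\<omega>. (if r \<le> 0 then 1 else 0) \<partial>M) \<partial>lborel)"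
    by (rule nn_integral_at_e) measurable
  also have "\<dots> = (\<integral>\<^sup>+(r::real). 0 \<partial>lborel)"
  proof (rule nn_integral_cong_AE)
    have "AE r in lborel. r \<noteq> (0::real)" by (rule AE_lborel_singleton)
    then show "AE r in lborel. ennreal (exponential_density \<alpha> r) * (\<integral>\<^sup>+\<omega>. (if r \<le> 0 then 1 else 0) \<partial>M) = 0"
      by eventually_elim (simp add: exponential_density_def)
  qed
  finally have "(\<integral>\<^sup>+\<omega>. (if e \<omega> \<le> 0 then 1 else 0) \<partial>M) = 0" by simp
  then have "AE \<omega> in M. (if e \<omega> \<le> 0 then 1 else 0 :: ennreal) = 0"
    by (subst (asm) nn_integral_0_iff_AE) auto
  then show ?thesis by eventually_elim (auto split: if_splits)
qed

lemma Y_rc: "\<omega> \<in> space M \<Longrightarrow> 0 \<le> t \<Longrightarrow> continuous (at_right t) (\<lambda>u. Y u \<omega>)"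
proof -
  assume \<omega>: "\<omega> \<in> space M" and t: "0 \<le> t"
  show "continuous (at_right t) (\<lambda>u. Y u \<omega>)"
  proof (cases "t < e \<omega>")
    case True
    have "((\<lambda>u. exp_neg 1 (xi u \<omega>)) \<longlongrightarrow> exp_neg 1 (xi t \<omega>)) (at_right t)"
      using exp_neg_xi_rc[OF \<omega> t] by (simp add: continuous_within)
    moreover have "eventually (\<lambda>u. exp_neg 1 (xi u \<omega>) = Y u \<omega>) (at_right t)"
      using eventually_at_right_real[OF True] by eventually_elim (use t in \<open>simp add: Y_def\<close>)
    ultimately have "((\<lambda>u. Y u \<omega>) \<longlongrightarrow> exp_neg 1 (xi t \<omega>)) (at_right t)" by (rule Lim_transform_eventually)
    then show ?thesis using t True by (simp add: continuous_within Y_def)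
  next
    case False
    have "eventually (\<lambda>u. Y u \<omega> = Y t \<omega>) (at_right t)"
      using eventually_at_right_less[of t] by eventually_elim (use False in \<open>simp add: Y_def\<close>)
    then show ?thesis by (simp add: continuous_within tendsto_eventually)
  qed
qed

definition weights_before_e :: "real \<Rightarrow> ('a \<Rightarrow> ennreal) set" where
  "weights_before_e t = {w. \<exists>v\<in>borel_measurable (F t). w = (\<lambda>\<omega>. v \<omega> * indicator {\<omega>. t < e \<omega>} \<omega>)}"

text \<open>
  By \<open>nn_integral_exp_neg_at_e\<close>, on functionals of the past that live on survival up to \<open>t\<close> the changed
  measure acts as the original one, with \<open>xi\<close> discounted at the extra rate \<open>\<mu>\<close> and time at the rate
  \<open>\<alpha>\<close>. Hence the exponent \<open>phi (p + \<mu>) + \<alpha>\<close>.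
\<close>

lemma multiplicative_process_Y:
  "multiplicative_process Q Y weights_before_e psi"
proof -
  interpret Q: prob_space Q by (rule prob_space_Q)
  have [simp]: "space Q = space M" "sets Q = sets M" by (simp_all add: Q_def)
  have ind: "(\<lambda>\<omega>. indicator {\<omega>. t < e \<omega>} \<omega> :: ennreal) \<in> borel_measurable M" for t
  proof -
    have "(\<lambda>\<omega>. if t < e \<omega> then 1 else 0 :: ennreal) \<in> borel_measurable M" by measurable
    then show ?thesis by (simp add: indicator_def)
  qed
  have Y_ind: "ennreal (Y t \<omega> powr r) = ennreal (exp_neg r (xi t \<omega>)) * indicator {\<omega>. t < e \<omega>} \<omega>" if "0 \<le> t" for t r \<omega>
    using that by (auto simp: Y_def exp_neg_powr[symmetric] split: split_indicator)
  have base: "(\<integral>\<^sup>+\<omega>. v \<omega> * indicator {\<omega>. t < e \<omega>} \<omega> * ennreal (Y u \<omega> powr p) \<partial>Q)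
      = ennreal (exp (- (\<alpha> * u))) * (\<integral>\<^sup>+\<omega>. v \<omega> * ennreal (exp_neg (p + \<mu>) (xi u \<omega>)) \<partial>M)"
    if t: "0 \<le> t" and tu: "t \<le> u" and p: "0 < p" and v: "v \<in> borel_measurable (F t)" for t u p and v :: "'a \<Rightarrow> ennreal"
  proof -
    have vM [measurable]: "v \<in> borel_measurable M" using v by (rule F_measurable_M)
    have [measurable]: "(\<lambda>\<omega>. exp_neg p (xi u \<omega>)) \<in> borel_measurable M"
      by (rule exp_neg_xi_measurable[OF order.trans[OF t tu]])
    note [measurable] = ind
    have "(\<integral>\<^sup>+\<omega>. v \<omega> * indicator {\<omega>. t < e \<omega>} \<omega> * ennreal (Y u \<omega> powr p) \<partial>Q)
        = (\<integral>\<^sup>+\<omega>. v \<omega> * ennreal (exp_neg p (xi u \<omega>)) * indicator {\<omega>. u < e \<omega>} \<omega> \<partial>Q)"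
      using t tu by (intro nn_integral_cong) (auto simp: Y_ind mult_ac split: split_indicator)
    also have "\<dots> = ennreal (1 / weight_mean) * (\<integral>\<^sup>+\<omega>. v \<omega> * ennreal (exp_neg p (xi u \<omega>)) * indicator {\<omega>. u < e \<omega>} \<omega> * ennreal (weight \<omega>) \<partial>M)"
      by (rule nn_integral_Q) measurable
    also have "\<dots> = ennreal (1 / weight_mean) * (ennreal (weight_mean * exp (- (\<alpha> * u))) * (\<integral>\<^sup>+\<omega>. v \<omega> * ennreal (exp_neg (p + \<mu>) (xi u \<omega>)) \<partial>M))"
      unfolding weight_def using t tu p by (subst nn_integral_exp_neg_at_e) (auto intro: F_measurable_mono[OF tu v])
    also have "\<dots> = (ennreal (1 / weight_mean) * ennreal (weight_mean * exp (- (\<alpha> * u)))) * (\<integral>\<^sup>+\<omega>. v \<omega> * ennreal (exp_neg (p + \<mu>) (xi u \<omega>)) \<partial>M)"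
      by (simp only: mult.assoc)
    also have "ennreal (1 / weight_mean) * ennreal (weight_mean * exp (- (\<alpha> * u))) = ennreal (exp (- (\<alpha> * u)))"
      using weight_mean_pos by (subst ennreal_mult[symmetric]) auto
    finally show ?thesis .
  qed
  show ?thesis
  proof
    fix t u h p r :: real and w :: "'a \<Rightarrow> ennreal" and \<omega>
    note [measurable] = X_joint
    have "Y = (\<lambda>t \<omega>. if t < e \<omega> then X t \<omega> else 0)" by (auto simp: Y_def X_def fun_eq_iff)
    moreover have "(\<lambda>p. if fst p < e (snd p) then X (fst p) (snd p) else 0) \<in> borel_measurable (borel \<Otimes>\<^sub>M M)" by measurable
    ultimately have YM: "(\<lambda>p. Y (fst p) (snd p)) \<in> borel_measurable (borel \<Otimes>\<^sub>M M)" by simp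
    have eq: "sets (borel \<Otimes>\<^sub>M Q) = sets (borel \<Otimes>\<^sub>M M)" by (rule sets_pair_measure_cong) (simp_all add: Q_def)
    show "(\<lambda>p. Y (fst p) (snd p)) \<in> borel_measurable (borel \<Otimes>\<^sub>M Q)"
      by (subst measurable_cong_sets[OF eq refl]) (rule YM)
    show "0 \<le> Y t \<omega>" "t < 0 \<Longrightarrow> Y t \<omega> = 0" by (auto simp: Y_def)
    show "Y u \<omega> \<le> Y t \<omega>" if "\<omega> \<in> space Q" "0 \<le> t" "t \<le> u"
      using that by (auto simp: Y_def intro!: exp_neg_antimono xi_mono)
    show "continuous (at_right t) (\<lambda>u. Y u \<omega>)" if "\<omega> \<in> space Q" "0 \<le> t"
      using that by (intro Y_rc) auto
    have "AE \<omega> in M. Y 0 \<omega> = 1" using e_pos AE_space by eventually_elim (simp add: Y_def xi_0)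
    then show "AE \<omega> in Q. Y 0 \<omega> = 1" unfolding Q_def by (subst AE_density) (auto elim: eventually_mono)
    show "w \<in> borel_measurable Q" if w: "w \<in> weights_before_e t"
    proof -
      obtain v where v: "v \<in> borel_measurable (F t)" "w = (\<lambda>\<omega>. v \<omega> * indicator {\<omega>. t < e \<omega>} \<omega>)" using w by (auto simp: weights_before_e_def)
      have "w \<in> borel_measurable M" unfolding v(2)
        by (intro borel_measurable_times_ennreal F_measurable_M[OF v(1)] ind)
      then show ?thesis by (simp add: Q_def)
    qed
    show "(\<lambda>\<omega>. w \<omega> * ennreal (Y u \<omega>)) \<in> weights_before_e u"
      if t: "0 \<le> t" "t \<le> u" and w: "w \<in> weights_before_e t"
    proof -
      obtain v where v: "v \<in> borel_measurable (F t)" "w = (\<lambda>\<omega>. v \<omega> * indicator {\<omega>. t < e \<omega>} \<omega>)" using w by (auto simp: weights_before_e_def)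
      have [measurable]: "v \<in> borel_measurable (F u)" by (rule F_measurable_mono[OF t(2) v(1)])
      have [measurable]: "(\<lambda>\<omega>. exp_neg 1 (xi u \<omega>)) \<in> borel_measurable (F u)" using t by (intro exp_neg_xi_F) auto
      have vF: "(\<lambda>\<omega>. v \<omega> * ennreal (exp_neg 1 (xi u \<omega>))) \<in> borel_measurable (F u)" by measurable
      have eq: "(\<lambda>\<omega>. w \<omega> * ennreal (Y u \<omega>)) = (\<lambda>\<omega>. v \<omega> * ennreal (exp_neg 1 (xi u \<omega>)) * indicator {\<omega>. u < e \<omega>} \<omega>)"
        using t by (intro ext) (auto simp: v(2) Y_def split: split_indicator)
      show ?thesis unfolding weights_before_e_def mem_Collect_eq eq by (rule bexI[OF refl vF])
    qed
    show "(\<lambda>\<omega>. ennreal (Y t \<omega> powr r)) \<in> weights_before_e t" if t: "0 \<le> t"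
    proof -
      have [measurable]: "(\<lambda>\<omega>. exp_neg r (xi t \<omega>)) \<in> borel_measurable (F t)" using t by (intro exp_neg_xi_F) auto
      have "(\<lambda>\<omega>. ennreal (exp_neg r (xi t \<omega>))) \<in> borel_measurable (F t)" by measurable
      then show ?thesis unfolding weights_before_e_def mem_Collect_eq by (rule bexI[rotated]) (intro ext Y_ind t)
    qed
    show "(\<integral>\<^sup>+\<omega>. w \<omega> * ennreal (Y (t + h) \<omega> powr p) \<partial>Q) = ennreal (exp (- (h * psi p))) * (\<integral>\<^sup>+\<omega>. w \<omega> * ennreal (Y t \<omega> powr p) \<partial>Q)"
      if t: "0 \<le> t" "0 \<le> h" "0 < p" and w: "w \<in> weights_before_e t"
    proof -
      obtain v where v: "v \<in> borel_measurable (F t)" "w = (\<lambda>\<omega>. v \<omega> * indicator {\<omega>. t < e \<omega>} \<omega>)" using w by (auto simp: weights_before_e_def)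
      have "(\<integral>\<^sup>+\<omega>. w \<omega> * ennreal (Y (t + h) \<omega> powr p) \<partial>Q)
        = ennreal (exp (- (\<alpha> * (t + h)))) * (\<integral>\<^sup>+\<omega>. v \<omega> * ennreal (exp_neg (p + \<mu>) (xi (t + h) \<omega>)) \<partial>M)"
        unfolding v(2) using t v by (intro base) auto
      also have "(\<integral>\<^sup>+\<omega>. v \<omega> * ennreal (exp_neg (p + \<mu>) (xi (t + h) \<omega>)) \<partial>M)
        = ennreal (exp (- (h * phi (p + \<mu>)))) * (\<integral>\<^sup>+\<omega>. v \<omega> * ennreal (exp_neg (p + \<mu>) (xi t \<omega>)) \<partial>M)"
        using t v \<mu> by (intro exp_neg_markov) auto
      also have "ennreal (exp (- (\<alpha> * (t + h)))) * (ennreal (exp (- (h * phi (p + \<mu>)))) * (\<integral>\<^sup>+\<omega>. v \<omega> * ennreal (exp_neg (p + \<mu>) (xi t \<omega>)) \<partial>M))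
        = (ennreal (exp (- (\<alpha> * (t + h)))) * ennreal (exp (- (h * phi (p + \<mu>))))) * (\<integral>\<^sup>+\<omega>. v \<omega> * ennreal (exp_neg (p + \<mu>) (xi t \<omega>)) \<partial>M)"
        by (simp only: mult.assoc)
      also have "ennreal (exp (- (\<alpha> * (t + h)))) * ennreal (exp (- (h * phi (p + \<mu>)))) = ennreal (exp (- (h * psi p))) * ennreal (exp (- (\<alpha> * t)))"
        by (simp add: ennreal_mult[symmetric] exp_add[symmetric] shifted_exponent_def algebra_simps)
      also have "\<dots> * (\<integral>\<^sup>+\<omega>. v \<omega> * ennreal (exp_neg (p + \<mu>) (xi t \<omega>)) \<partial>M) = ennreal (exp (- (h * psi p))) * (\<integral>\<^sup>+\<omega>. w \<omega> * ennreal (Y t \<omega> powr p) \<partial>Q)"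
        unfolding v(2) using t v by (subst base) (auto simp: mult.assoc)
      finally show ?thesis .
    qed
    show "0 < psi p" if "0 < p"
      using that \<alpha> \<mu> phi_nonneg[of "p + \<mu>"] by (simp add: shifted_exponent_def)
    show "psi 1 \<le> psi p" if "1 \<le> p"
      using that \<mu> by (simp add: shifted_exponent_def phi_mono)
  qed
qed

end

context killed_at_exponential_time
begin

lemma exp_functional_upto_eq:
  assumes \<omega>: "\<omega> \<in> space M"
  shows "exp_functional_upto xi (e \<omega>) \<omega> = multiplicative_process.J Y 0 \<omega>"
proof -
  interpret P: multiplicative_process Q Y weights_before_e psi
    by (rule multiplicative_process_Y)
  have "exp_functional_upto xi (e \<omega>) \<omega> = enn2real (\<integral>\<^sup>+u. ennreal (exp_neg 1 (xi u \<omega>)) * indicator {0..e \<omega>} u \<partial>lborel)"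
    unfolding exp_functional_upto_def
    by (intro enn2real_nn_integral_eq_set_integral xi_path_set_measurable \<omega>) auto
  also have "(\<integral>\<^sup>+u. ennreal (exp_neg 1 (xi u \<omega>)) * indicator {0..e \<omega>} u \<partial>lborel) = (\<integral>\<^sup>+u. ennreal (Y u \<omega>) * indicator {0..} u \<partial>lborel)"
  proof (rule nn_integral_cong_AE)
    have "AE u in lborel. u \<noteq> e \<omega>" by (rule AE_lborel_singleton)
    then show "AE u in lborel. ennreal (exp_neg 1 (xi u \<omega>)) * indicator {0..e \<omega>} u = ennreal (Y u \<omega>) * indicator {0..} u"
      by eventually_elim (auto simp: Y_def split: split_indicator)
  qed
  finally show ?thesis by (simp add: P.J_def)
qed

lemma webster_psi: "webster_conditions psi"
proof (rule concave_on_imp_webster)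
  show "0 < psi s" if "0 < s" for s
    using that \<alpha> \<mu> phi_nonneg[of "s + \<mu>"] by (simp add: shifted_exponent_def)
  show "psi s \<le> psi t" if "0 < s" "s \<le> t" for s t
    using that \<mu> by (simp add: shifted_exponent_def phi_mono)
  show "concave_on {0<..} psi"
    unfolding concave_on_iff
  proof (intro conjI ballI allI impI)
    fix x y u v :: real assume xy: "x \<in> {0<..}" "y \<in> {0<..}" and uv: "0 \<le> u" "0 \<le> v" "u + v = 1"
    have "u * phi (x + \<mu>) + v * phi (y + \<mu>) \<le> phi (u * (x + \<mu>) + v * (y + \<mu>))"
      using phi_concave xy uv \<mu> by (simp add: concave_on_iff)
    also have "u * (x + \<mu>) + v * (y + \<mu>) = u * x + v * y + (u + v) * \<mu>" by (simp add: algebra_simps)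
    finally have "u * phi (x + \<mu>) + v * phi (y + \<mu>) + (u + v) * \<alpha> \<le> phi (u * x + v * y + \<mu>) + \<alpha>"
      using uv by simp
    then show "u * psi x + v * psi y \<le> psi (u *\<^sub>R x + v *\<^sub>R y)"
      by (simp add: shifted_exponent_def algebra_simps)
  qed simp
qed

text \<open>
  The factorial bound on the transform at integer \<open>n\<close> and its normalization serve to identify the
  joint law.
\<close>

theorem joint_transform:
  assumes s: "-1 < s"
  shows "integrable M (\<lambda>\<omega>. exp_functional_upto xi (e \<omega>) \<omega> powr s * exp_neg \<mu> (xi (e \<omega>) \<omega>))" (is "integrable M ?f")
    and "(\<integral>\<omega>. exp_functional_upto xi (e \<omega>) \<omega> powr s * exp_neg \<mu> (xi (e \<omega>) \<omega>) \<partial>M)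
      = \<alpha> / (\<alpha> + phi \<mu>) * (Gamma (s + 1) / gen_Gamma psi (s + 1))"
    and "Gamma (real n + 1) / gen_Gamma psi (real n + 1) \<le> (1 / psi 1) ^ n * fact n"
    and "gen_Gamma psi 1 = 1"
proof -
  interpret P: multiplicative_process Q Y weights_before_e psi
    by (rule multiplicative_process_Y)
  have mellin: "P.mellin r = Gamma (r + 1) / gen_Gamma psi (r + 1)" if r: "-1 < r" for r
  proof -
    have "0 < P.mellin r" "0 < Gamma (r + 1)" using r by (auto intro: P.mellin_pos Gamma_real_pos)
    then show ?thesis using P.Gamma_divide_mellin_eq_gen_Gamma[OF webster_psi r] by simp
  qed
  have [measurable]: "(\<lambda>\<omega>. P.J 0 \<omega> powr s) \<in> borel_measurable M"
    using P.J_measurable[of 0] by (simp add: Q_def)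
  have f: "?f \<omega> = weight_mean * (weight \<omega> / weight_mean * P.J 0 \<omega> powr s)" if "\<omega> \<in> space M" for \<omega>
    using that weight_mean_pos by (simp add: exp_functional_upto_eq weight_def)
  have "integrable M (\<lambda>\<omega>. weight \<omega> / weight_mean * P.J 0 \<omega> powr s)"
    using P.J_powr_integrable[OF s] weight_mean_pos weight_nonneg unfolding Q_def
    by (subst (asm) integrable_density) auto
  then have "integrable M (\<lambda>\<omega>. weight_mean * (weight \<omega> / weight_mean * P.J 0 \<omega> powr s))" by (rule integrable_mult_right)
  then show "integrable M ?f" by (subst Bochner_Integration.integrable_cong[OF refl f])
  have "P.mellin s = (\<integral>\<omega>. weight \<omega> / weight_mean * P.J 0 \<omega> powr s \<partial>M)"
    unfolding P.mellin_def using weight_mean_pos weight_nonneg unfolding Q_def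
    by (subst integral_density) auto
  then have "(\<integral>\<omega>. ?f \<omega> \<partial>M) = weight_mean * P.mellin s"
    by (subst Bochner_Integration.integral_cong[OF refl f]) auto
  then show "(\<integral>\<omega>. ?f \<omega> \<partial>M) = \<alpha> / (\<alpha> + phi \<mu>) * (Gamma (s + 1) / gen_Gamma psi (s + 1))"
    unfolding mellin[OF s] weight_mean_def .
  show "Gamma (real n + 1) / gen_Gamma psi (real n + 1) \<le> (1 / psi 1) ^ n * fact n"
    using P.moment_le[of n] mellin[of "real n"] by (simp add: P.mellin_nat)
  show "gen_Gamma psi 1 = 1"
    using P.Gamma_divide_mellin_eq_gen_Gamma[OF webster_psi, of 0] by (simp add: P.mellin_0)
qed

lemma exp_functional_upto_measurable [measurable]:
  "(\<lambda>\<omega>. exp_functional_upto xi (e \<omega>) \<omega>) \<in> borel_measurable M"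
proof -
  interpret P: multiplicative_process Q Y weights_before_e psi
    by (rule multiplicative_process_Y)
  have "P.J 0 \<in> borel_measurable M" using P.J_measurable[of 0] by (simp add: Q_def)
  then show ?thesis by (rule measurable_cong[THEN iffD1, rotated]) (simp add: exp_functional_upto_eq)
qed

text \<open>
  \<open>xi e\<close> is a Borel function of \<open>exp (- xi e)\<close>, whose measurability comes from joint measurability
  in time.
\<close>

lemma xi_at_e_measurable [measurable]: "(\<lambda>\<omega>. xi (e \<omega>) \<omega>) \<in> borel_measurable M"
proof -
  \<comment> \<open>A Borel inverse of \<open>exp_neg 1\<close>, including the value \<open>0\<close> at \<open>\<infinity>\<close>.\<close>
  define g :: "real \<Rightarrow> ennreal" where "g = (\<lambda>y. if y = 0 then \<infinity> else ennreal (- ln y))"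
  have [measurable]: "g \<in> borel_measurable borel" unfolding g_def by measurable
  have g: "g (exp_neg 1 x) = x" for x
    by (cases x) (auto simp: g_def exp_neg_def)
  note [measurable] = exp_neg_at_e_measurable
  have "(\<lambda>\<omega>. g (exp_neg 1 (xi (e \<omega>) \<omega>))) \<in> borel_measurable M" by measurable
  then show ?thesis by (simp add: g)
qed

end

section \<open>Uniqueness of the joint law\<close>

text \<open>
  At \<open>s = \<mu> = 0\<close> the integrand is the indicator that the first coordinate is nonzero and the second is
  finite, because \<open>0 powr 0 = 0\<close> and \<open>exp_neg 0 \<infinity> = 0\<close>.
\<close>

lemma AE_positive_finite:
  fixes \<nu> :: "(real \<times> ennreal) measure"
  assumes \<nu>: "prob_space \<nu>" and nn: "AE p in \<nu>. 0 \<le> fst p"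
    and int: "integrable \<nu> (\<lambda>p. fst p powr 0 * exp_neg 0 (snd p))"
    and eq: "(\<integral>p. fst p powr 0 * exp_neg 0 (snd p) \<partial>\<nu>) = 1"
  shows "AE p in \<nu>. 0 < fst p \<and> snd p \<noteq> \<infinity>"
proof -
  interpret prob_space \<nu> by fact
  have le: "fst p powr 0 * exp_neg 0 (snd p) \<le> 1" for p :: "real \<times> ennreal"
    by (auto simp: exp_neg_def)
  have "(\<integral>p. 1 - fst p powr 0 * exp_neg 0 (snd p) \<partial>\<nu>) = 0"
    using int eq by (simp add: prob_space)
  then have "AE p in \<nu>. 1 - fst p powr 0 * exp_neg 0 (snd p) = 0"
    using int le by (subst (asm) integral_nonneg_eq_0_iff_AE) auto
  with nn show ?thesis
    by eventually_elim (auto simp: exp_neg_def less_le split: if_splits)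
qed

text \<open>
  Two applications of moment determinacy. For fixed \<open>k\<close> the moments in \<open>n\<close> determine the law of the
  first coordinate under the density \<open>exp (- k * y)\<close>, where \<open>y\<close> is the second coordinate. Restricting
  the first coordinate to a fixed Borel set, this yields all moments of the bounded variable
  \<open>exp (- y)\<close>, and so its law there. Hence the two measures agree on rectangles.
\<close>

theorem joint_law_determined:
  fixes \<nu>1 \<nu>2 :: "(real \<times> ennreal) measure"
  assumes prob: "prob_space \<nu>1" "prob_space \<nu>2"
    and sets: "sets \<nu>1 = sets (borel \<Otimes>\<^sub>M borel)" "sets \<nu>2 = sets (borel \<Otimes>\<^sub>M borel)"
    and nn: "AE p in \<nu>1. 0 \<le> fst p" "AE p in \<nu>2. 0 \<le> fst p"
    and int: "\<And>n k :: nat. integrable \<nu>1 (\<lambda>p. fst p powr real n * exp_neg (real k) (snd p))"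
             "\<And>n k :: nat. integrable \<nu>2 (\<lambda>p. fst p powr real n * exp_neg (real k) (snd p))"
    and eq: "\<And>n k :: nat. (\<integral>p. fst p powr real n * exp_neg (real k) (snd p) \<partial>\<nu>1) = T n k"
             "\<And>n k :: nat. (\<integral>p. fst p powr real n * exp_neg (real k) (snd p) \<partial>\<nu>2) = T n k"
    and T0: "T 0 0 = 1" and bd: "\<And>k. \<exists>K C. 0 < C \<and> (\<forall>n. T n k \<le> K * C ^ n * fact n)"
  shows "\<nu>1 = \<nu>2"
proof -
  have fst_measurable: "fst \<in> borel_measurable \<nu>" and snd_measurable: "snd \<in> borel_measurable \<nu>"
    if "sets \<nu> = sets (borel \<Otimes>\<^sub>M borel)" for \<nu> :: "(real \<times> ennreal) measure"
    using that by (simp_all cong: measurable_cong_sets)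
  note [measurable] = fst_measurable[OF sets(1)] fst_measurable[OF sets(2)] snd_measurable[OF sets(1)] snd_measurable[OF sets(2)]
  have pos1: "AE p in \<nu>1. 0 < fst p \<and> snd p \<noteq> \<infinity>"
    by (rule AE_positive_finite[OF prob(1) nn(1)]) (use int(1)[of 0 0] eq(1)[of 0 0] T0 in simp_all)
  have pos2: "AE p in \<nu>2. 0 < fst p \<and> snd p \<noteq> \<infinity>"
    by (rule AE_positive_finite[OF prob(2) nn(2)]) (use int(2)[of 0 0] eq(2)[of 0 0] T0 in simp_all)
  note pos = pos1 pos2
  have T_nonneg: "0 \<le> T n k" for n k
    unfolding eq(1)[of n k, symmetric] by (intro integral_nonneg_AE) auto
  have moment: "(\<integral>\<^sup>+x. ennreal (x ^ n) \<partial>distr (density \<nu> (\<lambda>p. ennreal (exp_neg (real k) (snd p)))) borel fst) = ennreal (T n k)"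
    if [measurable]: "fst \<in> borel_measurable \<nu>" "snd \<in> borel_measurable \<nu>"
      and pos: "AE p in \<nu>. 0 < fst p \<and> snd p \<noteq> \<infinity>"
      and int: "integrable \<nu> (\<lambda>p. fst p powr real n * exp_neg (real k) (snd p))"
      and eq: "(\<integral>p. fst p powr real n * exp_neg (real k) (snd p) \<partial>\<nu>) = T n k"
    for \<nu> :: "(real \<times> ennreal) measure" and n k
  proof -
    have "(\<integral>\<^sup>+x. ennreal (x ^ n) \<partial>distr (density \<nu> (\<lambda>p. ennreal (exp_neg (real k) (snd p)))) borel fst)
      = (\<integral>\<^sup>+p. ennreal (exp_neg (real k) (snd p)) * ennreal (fst p ^ n) \<partial>\<nu>)"
      by (simp add: nn_integral_distr nn_integral_density)
    also have "\<dots> = (\<integral>\<^sup>+p. ennreal (fst p powr real n * exp_neg (real k) (snd p)) \<partial>\<nu>)"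
      using pos by (intro nn_integral_cong_AE) (auto simp: powr_realpow ennreal_mult[symmetric] mult.commute elim!: eventually_mono)
    also have "\<dots> = ennreal (T n k)"
      unfolding eq[symmetric] by (intro nn_integral_eq_integral int) auto
    finally show ?thesis .
  qed
  have nonneg: "AE x in distr (density \<nu> f) borel fst. 0 \<le> x"
    if [measurable]: "fst \<in> borel_measurable \<nu>" "f \<in> borel_measurable \<nu>" and pos: "AE p in \<nu>. 0 < fst p \<and> snd p \<noteq> \<infinity>"
    for \<nu> :: "(real \<times> ennreal) measure" and f
    using pos by (subst AE_distr_iff, simp, simp) (auto simp: AE_density elim!: eventually_mono)
  have A: "distr (density \<nu>1 (\<lambda>p. ennreal (exp_neg (real k) (snd p)))) borel fst
      = distr (density \<nu>2 (\<lambda>p. ennreal (exp_neg (real k) (snd p)))) borel fst" for k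
  proof -
    obtain K C where KC: "0 < C" "\<And>n. T n k \<le> K * C ^ n * fact n" using bd[of k] by blast
    show ?thesis
    proof (rule moment_determinacy_nonneg[where m = "\<lambda>n. T n k" and K = K and C = C])
      show "AE x in distr (density \<nu>1 (\<lambda>p. ennreal (exp_neg (real k) (snd p)))) borel fst. 0 \<le> x"
        by (rule nonneg[OF _ _ pos1]) measurable
      show "AE x in distr (density \<nu>2 (\<lambda>p. ennreal (exp_neg (real k) (snd p)))) borel fst. 0 \<le> x"
        by (rule nonneg[OF _ _ pos2]) measurable
      fix n
      show "(\<integral>\<^sup>+x. ennreal (x ^ n) \<partial>distr (density \<nu>1 (\<lambda>p. ennreal (exp_neg (real k) (snd p)))) borel fst) = ennreal (T n k)"
        by (rule moment[OF _ _ pos1 int(1) eq(1)]) measurable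
      show "(\<integral>\<^sup>+x. ennreal (x ^ n) \<partial>distr (density \<nu>2 (\<lambda>p. ennreal (exp_neg (real k) (snd p)))) borel fst) = ennreal (T n k)"
        by (rule moment[OF _ _ pos2 int(2) eq(2)]) measurable
    qed (simp_all add: T_nonneg KC)
  qed
  have A': "(\<integral>\<^sup>+p. indicator S (fst p) * ennreal (exp_neg (real k) (snd p)) \<partial>\<nu>1)
      = (\<integral>\<^sup>+p. indicator S (fst p) * ennreal (exp_neg (real k) (snd p)) \<partial>\<nu>2)" if [measurable]: "S \<in> sets borel" for S k
  proof -
    have "(\<integral>\<^sup>+x. indicator S x \<partial>distr (density \<nu>1 (\<lambda>p. ennreal (exp_neg (real k) (snd p)))) borel fst)
      = (\<integral>\<^sup>+x. indicator S x \<partial>distr (density \<nu>2 (\<lambda>p. ennreal (exp_neg (real k) (snd p)))) borel fst)"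
      unfolding A ..
    then show ?thesis by (simp add: nn_integral_distr nn_integral_density mult.commute del: nn_integral_indicator)
  qed
  have power: "(\<integral>\<^sup>+y. ennreal (y ^ k) \<partial>distr (density \<nu> (\<lambda>p. indicator S (fst p))) borel (\<lambda>p. exp_neg 1 (snd p)))
      = (\<integral>\<^sup>+p. indicator S (fst p) * ennreal (exp_neg (real k) (snd p)) \<partial>\<nu>)"
    if [measurable]: "fst \<in> borel_measurable \<nu>" "snd \<in> borel_measurable \<nu>" "S \<in> sets borel"
      and pos: "AE p in \<nu>. 0 < fst p \<and> snd p \<noteq> \<infinity>"
    for \<nu> :: "(real \<times> ennreal) measure" and S k
  proof -
    have pow: "exp_neg 1 x ^ k = exp_neg (real k) x" if "x \<noteq> \<infinity>" for x
      using that by (simp add: exp_neg_def exp_of_nat_mult[symmetric])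
    have "(\<integral>\<^sup>+y. ennreal (y ^ k) \<partial>distr (density \<nu> (\<lambda>p. indicator S (fst p))) borel (\<lambda>p. exp_neg 1 (snd p)))
      = (\<integral>\<^sup>+p. indicator S (fst p) * ennreal (exp_neg 1 (snd p) ^ k) \<partial>\<nu>)"
      by (simp add: nn_integral_distr nn_integral_density)
    also have "\<dots> = (\<integral>\<^sup>+p. indicator S (fst p) * ennreal (exp_neg (real k) (snd p)) \<partial>\<nu>)"
    proof (rule nn_integral_cong_AE)
      show "AE p in \<nu>. indicator S (fst p) * ennreal (exp_neg 1 (snd p) ^ k) = indicator S (fst p) * ennreal (exp_neg (real k) (snd p))"
        using pos by eventually_elim (subst pow, simp_all)
    qed
    finally show ?thesis .
  qed
  have B: "distr (density \<nu>1 (\<lambda>p. indicator S (fst p))) borel (\<lambda>p. exp_neg 1 (snd p))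
      = distr (density \<nu>2 (\<lambda>p. indicator S (fst p))) borel (\<lambda>p. exp_neg 1 (snd p))" if S [measurable]: "S \<in> sets borel" for S
  proof (rule moment_determinacy_nonneg)
    interpret prob_space \<nu>1 by (rule prob)
    let ?m = "\<lambda>k. enn2real (\<integral>\<^sup>+p. indicator S (fst p) * ennreal (exp_neg (real k) (snd p)) \<partial>\<nu>1)"
    have le: "(\<integral>\<^sup>+p. indicator S (fst p) * ennreal (exp_neg (real k) (snd p)) \<partial>\<nu>1) \<le> 1" for k
    proof -
      have "(\<integral>\<^sup>+p. indicator S (fst p) * ennreal (exp_neg (real k) (snd p)) \<partial>\<nu>1) \<le> (\<integral>\<^sup>+p. 1 \<partial>\<nu>1)"
        by (intro nn_integral_mono) (auto simp: exp_neg_le_1 split: split_indicator)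
      then show ?thesis by (simp add: emeasure_space_1)
    qed
    then have fin: "(\<integral>\<^sup>+p. indicator S (fst p) * ennreal (exp_neg (real k) (snd p)) \<partial>\<nu>1) = ennreal (?m k)" for k
      using le_less_trans[OF le[of k]] by (simp add: ennreal_enn2real)
    show "(\<integral>\<^sup>+y. ennreal (y ^ k) \<partial>distr (density \<nu>1 (\<lambda>p. indicator S (fst p))) borel (\<lambda>p. exp_neg 1 (snd p))) = ennreal (?m k)" for k
      unfolding fin[symmetric] by (rule power[OF _ _ S pos1]) measurable
    show "(\<integral>\<^sup>+y. ennreal (y ^ k) \<partial>distr (density \<nu>2 (\<lambda>p. indicator S (fst p))) borel (\<lambda>p. exp_neg 1 (snd p))) = ennreal (?m k)" for k
      by (rule trans[OF power[OF _ _ S pos2] trans[OF A'[OF S, symmetric] fin]]) measurable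
    show "?m k \<le> 1 * 1 ^ k * fact k" for k
    proof -
      have "?m k \<le> 1" using enn2real_mono[OF le[of k]] by simp
      also have "\<dots> \<le> 1 * 1 ^ k * fact k" by simp
      finally show ?thesis .
    qed
  qed (auto simp: AE_distr_iff AE_density)
  define g :: "real \<Rightarrow> ennreal" where "g = (\<lambda>y. if y = 0 then \<infinity> else ennreal (- ln y))"
  have [measurable]: "g \<in> borel_measurable borel" unfolding g_def by measurable
  have g: "g (exp_neg 1 x) = x" for x
    by (cases x) (auto simp: g_def exp_neg_def)
  have rect: "emeasure \<nu> (S \<times> S') = (\<integral>\<^sup>+y. indicator S' (g y) \<partial>distr (density \<nu> (\<lambda>p. indicator S (fst p))) borel (\<lambda>p. exp_neg 1 (snd p)))"
    if [measurable]: "fst \<in> borel_measurable \<nu>" "snd \<in> borel_measurable \<nu>" and sets: "sets \<nu> = sets (borel \<Otimes>\<^sub>M borel)"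
      and S: "S \<in> sets borel" "S' \<in> sets borel" for \<nu> :: "(real \<times> ennreal) measure" and S S'
  proof -
    note [measurable] = S
    have "(\<integral>\<^sup>+y. indicator S' (g y) \<partial>distr (density \<nu> (\<lambda>p. indicator S (fst p))) borel (\<lambda>p. exp_neg 1 (snd p)))
      = (\<integral>\<^sup>+p. indicator S (fst p) * indicator S' (snd p) \<partial>\<nu>)"
      by (subst nn_integral_distr, simp, simp, subst nn_integral_density) (auto simp: g)
    also have "\<dots> = (\<integral>\<^sup>+p. indicator (S \<times> S') p \<partial>\<nu>)"
      by (intro nn_integral_cong) (auto split: split_indicator)
    also have "\<dots> = emeasure \<nu> (S \<times> S')"
      using S sets by (intro nn_integral_indicator) auto
    finally show ?thesis ..
  qed
  interpret \<nu>1: prob_space \<nu>1 by (rule prob)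
  show ?thesis
  proof (rule measure_eqI_generator_eq[where A = "\<lambda>_::nat. UNIV \<times> UNIV" and \<Omega> = UNIV
      and E = "{a \<times> b | a b. a \<in> sets borel \<and> b \<in> sets borel}"])
    show "Int_stable {a \<times> b | a b. a \<in> sets (borel :: real measure) \<and> b \<in> sets (borel :: ennreal measure)}"
      by (rule Int_stable_pair_measure_generator)
    show "sets \<nu>1 = sigma_sets UNIV {a \<times> b | a b. a \<in> sets borel \<and> b \<in> sets borel}"
         "sets \<nu>2 = sigma_sets UNIV {a \<times> b | a b. a \<in> sets borel \<and> b \<in> sets borel}"
      by (simp_all add: sets sets_pair_measure)
    show "emeasure \<nu>1 X = emeasure \<nu>2 X" if "X \<in> {a \<times> b | a b. a \<in> sets borel \<and> b \<in> sets borel}" for X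
      using that by (auto simp: rect sets B)
    show "range (\<lambda>_::nat. UNIV \<times> UNIV) \<subseteq> {a \<times> b | a b. a \<in> sets (borel :: real measure) \<and> b \<in> sets (borel :: ennreal measure)}"
      by auto (metis UNIV_Times_UNIV sets.top space_borel)
  qed auto
qed

section \<open>Moments of the exponential functional and its remainder\<close>

theorem theorem2:
  fixes M :: "'a measure" and xi :: "real \<Rightarrow> 'a \<Rightarrow> ennreal"
    and phi :: "real \<Rightarrow> real"
    and N :: "'b measure" and R :: "'b \<Rightarrow> real"
  assumes subordinator: "killed_subordinator M xi"
    and exponent: "phi = laplace_exponent M xi"
    and nontrivial: "\<exists>l\<ge>0. phi l \<noteq> 0"
    and remainder: "remainder_variable phi N R"
  shows
    "(webster_conditions phi \<and> webster_conditions (conjugate_exponent phi) \<and>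
      (\<forall>s>-1.
         integrable N (\<lambda>x. R x powr s) \<and>
         (\<integral>x. R x powr s \<partial>N) = gen_Gamma phi (s + 1) \<and>
         integrable M (\<lambda>\<omega>. exp_functional xi \<omega> powr s) \<and>
         (\<integral>\<omega>. exp_functional xi \<omega> powr s \<partial>M) = gen_Gamma (conjugate_exponent phi) (s + 1) \<and>
         gen_Gamma (conjugate_exponent phi) (s + 1) = Gamma (s + 1) / gen_Gamma phi (s + 1)))
     \<and>
     (phi 0 = 0 \<longrightarrow>
      (\<forall>(\<alpha>::real)>0. \<forall>e :: 'a \<Rightarrow> real.
         independent_exponential_time M xi \<alpha> e \<longrightarrow>
         (\<forall>\<mu>\<ge>0. \<forall>s>-1.
            integrable M (\<lambda>\<omega>. exp_functional_upto xi (e \<omega>) \<omega> powr s * exp_neg \<mu> (xi (e \<omega>) \<omega>)) \<and>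
            (\<integral>\<omega>. exp_functional_upto xi (e \<omega>) \<omega> powr s * exp_neg \<mu> (xi (e \<omega>) \<omega>) \<partial>M)
            = \<alpha> / (\<alpha> + phi \<mu>) * (Gamma (s + 1) / gen_Gamma (shifted_exponent phi \<mu> \<alpha>) (s + 1))) \<and>
         (\<forall>\<nu> :: (real \<times> ennreal) measure.
            prob_space \<nu> \<longrightarrow> sets \<nu> = sets (borel \<Otimes>\<^sub>M borel) \<longrightarrow> (AE p in \<nu>. 0 \<le> fst p) \<longrightarrow>
            (\<forall>\<mu>\<ge>0. \<forall>s>-1.
               integrable \<nu> (\<lambda>p. fst p powr s * exp_neg \<mu> (snd p)) \<and>
               (\<integral>p. fst p powr s * exp_neg \<mu> (snd p) \<partial>\<nu>)
               = \<alpha> / (\<alpha> + phi \<mu>) * (Gamma (s + 1) / gen_Gamma (shifted_exponent phi \<mu> \<alpha>) (s + 1))) \<longrightarrow>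
            \<nu> = distr M (borel \<Otimes>\<^sub>M borel) (\<lambda>\<omega>. (exp_functional_upto xi (e \<omega>) \<omega>, xi (e \<omega>) \<omega>)))))"
proof -
  interpret S: subordinator M xi
    using subordinator by (intro subordinator.intro subordinator_axioms.intro) (simp_all add: killed_subordinator_def)
  have ex: "\<exists>l\<ge>0. laplace_exponent M xi l \<noteq> 0" using nontrivial unfolding exponent .
  show ?thesis
    unfolding exponent
  proof (intro conjI allI impI)
    show "webster_conditions (laplace_exponent M xi)" by (rule S.webster_phi[OF ex])
    show "webster_conditions (conjugate_exponent (laplace_exponent M xi))" by (rule S.webster_conjugate_phi[OF ex])
    note part1 = S.exp_functional_and_remainder_moments[OF ex remainder[unfolded exponent]]
    fix s :: real assume s: "-1 < s"
    show "integrable N (\<lambda>x. R x powr s)" by (rule part1[OF s])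
    show "(\<integral>x. R x powr s \<partial>N) = gen_Gamma (laplace_exponent M xi) (s + 1)" by (rule part1[OF s])
    show "integrable M (\<lambda>\<omega>. exp_functional xi \<omega> powr s)" by (rule part1[OF s])
    show "(\<integral>\<omega>. exp_functional xi \<omega> powr s \<partial>M) = gen_Gamma (conjugate_exponent (laplace_exponent M xi)) (s + 1)"
      by (rule part1[OF s])
    show "gen_Gamma (conjugate_exponent (laplace_exponent M xi)) (s + 1) = Gamma (s + 1) / gen_Gamma (laplace_exponent M xi) (s + 1)"
      by (rule part1[OF s])
  next
    fix \<alpha> :: real and e :: "'a \<Rightarrow> real"
    assume unkilled: "laplace_exponent M xi 0 = 0" and \<alpha>: "0 < \<alpha>" and e: "independent_exponential_time M xi \<alpha> e"
    have K: "killed_at_exponential_time M xi \<alpha> e \<mu>" if "0 \<le> \<mu>" for \<mu>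
      using \<alpha> e that by unfold_locales
    let ?rhs = "\<lambda>\<mu> s. \<alpha> / (\<alpha> + laplace_exponent M xi \<mu>) * (Gamma (s + 1) / gen_Gamma (shifted_exponent (laplace_exponent M xi) \<mu> \<alpha>) (s + 1))"
    fix \<mu> s :: real assume \<mu>: "0 \<le> \<mu>" and s: "-1 < s"
    interpret K: killed_at_exponential_time M xi \<alpha> e \<mu> by (rule K[OF \<mu>])
    show "integrable M (\<lambda>\<omega>. exp_functional_upto xi (e \<omega>) \<omega> powr s * exp_neg \<mu> (xi (e \<omega>) \<omega>))"
      by (rule K.joint_transform[OF s])
    show "(\<integral>\<omega>. exp_functional_upto xi (e \<omega>) \<omega> powr s * exp_neg \<mu> (xi (e \<omega>) \<omega>) \<partial>M) = ?rhs \<mu> s"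
      by (rule K.joint_transform[OF s])
  next
    fix \<alpha> :: real and e :: "'a \<Rightarrow> real" and \<nu> :: "(real \<times> ennreal) measure"
    assume unkilled: "laplace_exponent M xi 0 = 0" and \<alpha>: "0 < \<alpha>" and e: "independent_exponential_time M xi \<alpha> e"
    let ?rhs = "\<lambda>\<mu> s. \<alpha> / (\<alpha> + laplace_exponent M xi \<mu>) * (Gamma (s + 1) / gen_Gamma (shifted_exponent (laplace_exponent M xi) \<mu> \<alpha>) (s + 1))"
    assume \<nu>: "prob_space \<nu>" "sets \<nu> = sets (borel \<Otimes>\<^sub>M borel)" "AE p in \<nu>. 0 \<le> fst p"
      and tr: "\<forall>\<mu>\<ge>0. \<forall>s>-1. integrable \<nu> (\<lambda>p. fst p powr s * exp_neg \<mu> (snd p)) \<and>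
         (\<integral>p. fst p powr s * exp_neg \<mu> (snd p) \<partial>\<nu>) = ?rhs \<mu> s"
    have K: "killed_at_exponential_time M xi \<alpha> e \<mu>" if "0 \<le> \<mu>" for \<mu>
      using \<alpha> e that by unfold_locales
    interpret K0: killed_at_exponential_time M xi \<alpha> e 0 by (rule K) simp
    let ?Z = "\<lambda>\<omega>. (exp_functional_upto xi (e \<omega>) \<omega>, xi (e \<omega>) \<omega>)"
    have Z [measurable]: "?Z \<in> measurable M (borel \<Otimes>\<^sub>M borel)" by measurable
    note joint = killed_at_exponential_time.joint_transform[OF K]
    show "\<nu> = distr M (borel \<Otimes>\<^sub>M borel) ?Z"
    proof (rule joint_law_determined[where T = "\<lambda>n k. ?rhs (real k) (real n)"])
      show "prob_space \<nu>" "sets \<nu> = sets (borel \<Otimes>\<^sub>M borel)" "AE p in \<nu>. 0 \<le> fst p" by (fact \<nu>)+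
      show "prob_space (distr M (borel \<Otimes>\<^sub>M borel) ?Z)" by (rule S.prob_space_distr[OF Z])
      show "sets (distr M (borel \<Otimes>\<^sub>M borel) ?Z) = sets (borel \<Otimes>\<^sub>M borel)" by simp
      show "AE p in distr M (borel \<Otimes>\<^sub>M borel) ?Z. 0 \<le> fst p"
        by (subst AE_distr_iff[OF Z])
           (auto simp: exp_functional_upto_def set_lebesgue_integral_def intro!: AE_I2 integral_nonneg_AE)
      show "integrable \<nu> (\<lambda>p. fst p powr real n * exp_neg (real k) (snd p))"
        "(\<integral>p. fst p powr real n * exp_neg (real k) (snd p) \<partial>\<nu>) = ?rhs (real k) (real n)" for n k
        using tr by auto
      have m: "(\<lambda>p. fst p powr real n * exp_neg (real k) (snd p)) \<in> borel_measurable (borel \<Otimes>\<^sub>M borel)" for n k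
        by measurable
      show "integrable (distr M (borel \<Otimes>\<^sub>M borel) ?Z) (\<lambda>p. fst p powr real n * exp_neg (real k) (snd p))" for n k
        using joint(1)[of "real k" "real n"] by (subst integrable_distr_eq[OF Z m]) simp
      show "(\<integral>p. fst p powr real n * exp_neg (real k) (snd p) \<partial>distr M (borel \<Otimes>\<^sub>M borel) ?Z) = ?rhs (real k) (real n)" for n k
        using joint(2)[of "real k" "real n"] by (subst integral_distr[OF Z m]) simp
      show "?rhs (real 0) (real 0) = 1" using \<alpha> unkilled joint(4)[of 0 0] by simp
      show "\<exists>K C. 0 < C \<and> (\<forall>n. ?rhs (real k) (real n) \<le> K * C ^ n * fact n)" for k
      proof (intro exI conjI allI)
        fix n
        let ?psi = "shifted_exponent (laplace_exponent M xi) (real k) \<alpha>"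
        show "0 < 1 / ?psi 1" using \<alpha> S.phi_nonneg[of "1 + real k"] by (simp add: shifted_exponent_def)
        show "?rhs (real k) (real n) \<le> (\<alpha> / (\<alpha> + laplace_exponent M xi (real k))) * (1 / ?psi 1) ^ n * fact n"
          using mult_left_mono[OF joint(3)[of "real k" 0 n], of "\<alpha> / (\<alpha> + laplace_exponent M xi (real k))"] \<alpha> S.phi_nonneg[of "real k"]
          by (simp add: mult.assoc)
      qed
    qed
  qed
qed

end
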